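(* Let $\mathbf{x}=\epsilon(n)\mathbf{y}$, where $\mathbf{y}$ is a non-negative bounded random variable with law independent of $n$, and $\epsilon(n)$ is a Bernoulli random variable independent of $\mathbf{y}$ with parameter $p(n)$ satisfying $p(n)\to0$ and $np(n)\to\infty$. Let $m=m(n)$ and $\sigma^2=\sigma^2(n)>0$ be the mean and variance of $\mathbf{x}$, and assume $$\lim_{n\to\infty}\frac{n\sigma^2}{\log(n)}=+\infty.$$ Then with probability one, for $n\gg1$, every eigenvalue $\underline\lambda$ of $\underline L$ satisfies $$|\Re\underline\lambda|\le(2+o(1))\sigma\sqrt{n\log(n)}+\mathcal{O}\big(\sigma^{1/2}n^{1/4}\log(n)\big)$$ and $$|\Im\underline\lambda|\le(2+o(1))\sigma\sqrt n+\mathcal{O}\big(\sigma^{1/2}n^{1/4}\log(n)\big).$$ Moreover, with probability one, for $n\gg1$, every eigenvalue $\lambda\neq0$ of $L$ satisfies $$|\Re\lambda+mn|\le(2+o(1))\sigma\sqrt{n\log(n)}+\mathcal{O}\big(\sigma^{1/2}n^{1/4}\log(n)\big)$$ and $$|\Im\lambda|\le(2+o(1))\sigma\sqrt n+\mathcal{O}\big(\sigma^{1/2}n^{1/4}\log(n)\big).$$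
   Context: For each $n$, $X=(X_{ij})_{1\le i,j\le n}$ is a random matrix with entries i.i.d. copies of $\mathbf{x}=\mathbf{x}(n)$ (all random variables for all $n$ being defined on a common probability space). $D$ is the $n\times n$ diagonal matrix with $D_{ii}=\sum_{k=1}^nX_{ik}$, $L=X-D$, and $\underline L=L-\mathbb{E}L$. (So $\mathbb{E}L=mJ-mnI$, with $J$ the all-ones matrix, and $0$ is always an eigenvalue of $L$.) "With probability one, for $n\gg1$, …" with $o(1)$ and $\mathcal{O}(\cdot)$ means: almost surely there exist a (possibly random) sequence $\varepsilon_n\to0$, a constant $C$ and an $n_0$ such that for all $n\ge n_0$ the bounds hold, simultaneously for all the eigenvalues considered, with $\varepsilon_n$ in place of $o(1)$ and $C\,(\cdot)$ in place of $\mathcal{O}(\cdot)$. *)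

theory Defs
  imports "HOL-Probability.Probability" "Jordan_Normal_Form.Char_Poly"
begin

text \<open>The indices \<open>1, \<dots>, n\<close> are rendered as \<open>0, \<dots>, n - 1\<close>. The matrix type is
  \<^type>\<open>Matrix.mat\<close>, whose dimensions are ordinary natural numbers.\<close>

definition sample_matrix :: "nat \<Rightarrow> (nat \<Rightarrow> nat \<Rightarrow> 'a \<Rightarrow> real) \<Rightarrow> 'a \<Rightarrow> real Matrix.mat" where
  "sample_matrix n X \<omega> = Matrix.mat n n (\<lambda>(i, j). X i j \<omega>)"

definition row_sum_diag :: "nat \<Rightarrow> (nat \<Rightarrow> nat \<Rightarrow> 'a \<Rightarrow> real) \<Rightarrow> 'a \<Rightarrow> real Matrix.mat" where
  "row_sum_diag n X \<omega> = Matrix.mat n n (\<lambda>(i, j). if i = j then (\<Sum>k<n. X i k \<omega>) else 0)"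

definition random_laplacian :: "nat \<Rightarrow> (nat \<Rightarrow> nat \<Rightarrow> 'a \<Rightarrow> real) \<Rightarrow> 'a \<Rightarrow> real Matrix.mat" where
  "random_laplacian n X \<omega> = sample_matrix n X \<omega> - row_sum_diag n X \<omega>"

definition mean_matrix :: "'a measure \<Rightarrow> nat \<Rightarrow> ('a \<Rightarrow> real Matrix.mat) \<Rightarrow> real Matrix.mat" where
  "mean_matrix M n A = Matrix.mat n n (\<lambda>(i, j). \<integral>\<omega>. A \<omega> $$ (i, j) \<partial>M)"

definition centered_laplacian ::
  "'a measure \<Rightarrow> nat \<Rightarrow> (nat \<Rightarrow> nat \<Rightarrow> 'a \<Rightarrow> real) \<Rightarrow> 'a \<Rightarrow> real Matrix.mat" where
  "centered_laplacian M n X \<omega> = random_laplacian n X \<omega> - mean_matrix M n (random_laplacian n X)"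

text \<open>Eigenvalues of a real matrix are taken in the complex plane.\<close>

definition complex_eigenvalue :: "real Matrix.mat \<Rightarrow> complex \<Rightarrow> bool" where
  "complex_eigenvalue A z \<longleftrightarrow> eigenvalue (map_mat complex_of_real A) z"

end

theory Submission
  imports Defs
begin

text \<open>
  The real part of the numerical range of the centred Laplacian is controlled by the symmetric part of
  the centred matrix \<open>X - mJ\<close> together with the centred row sums, the imaginary part by the
  antisymmetric part alone. The row sums are bounded by a Bernstein inequality and a union bound, which
  gives the leading term of the real part.

  Both the symmetric and the antisymmetric part have norm at most
  \<open>(2 + \<eta>) \<sigma> \<surd>n + O(log n)\<close>, and \<open>log n\<close> is negligible against \<open>\<sigma>\<^sup>1\<^sup>/\<^sup>2 n\<^sup>1\<^sup>/\<^sup>4 log n\<close>.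
  By symmetrisation with an independent copy one may take entries with symmetric laws, at
  the price of doubling their variance \<open>\<sigma>\<^sup>2/2\<close>. The trace of a power of order \<open>log n\<close> then becomes a sum over closed
  walks which use every edge an even number of times. It is estimated step by step: the state of a
  walk is the set \<open>P\<close> of edges used an odd number of times so far, and the potential
  \<open>y\<^bsup>|P|\<^esup> c(P)\<^bsup>q\<^esup>\<close>, where \<open>c(P)\<close> is the number of even subsets of \<open>P\<close>, grows by at most a
  factor \<open>\<Lambda> \<approx> 2\<surd>(n\<tau>)\<close> in each step, because at most one of the steps which shrink \<open>P\<close> leaves \<open>c(P)\<close> unchanged.

  Finally, a left eigenvector of the Laplacian for an eigenvalue \<open>\<lambda> \<noteq> 0\<close> is orthogonal to the constant
  vector, so \<open>\<lambda> + mn\<close> is an eigenvalue of the centred Laplacian.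
\<close>

subsection \<open>Even subsets of edge sets\<close>

text \<open>The two constants 2 have different origins. At level (2 + \<eta>) \<sigma> sqrt(n log n)
  Bernstein gives each row sum probability of order n^(-2-\<eta>); the union over n rows leaves
  n^(-1-\<eta>), so 2 is where the bound becomes summable for Borel-Cantelli. For the imaginary
  part, entries of variance \<sigma>^2/2 would suggest the constant sqrt 2; the factor sqrt 2 lost
  by symmetrisation lands exactly on 2. In the real part this norm is below the row sums by a factor
  sqrt(log n) and vanishes in the o(1). The obstacle in counting walks of length a of order log n is
  that up to a edges at the current vertex may be candidates for removal; counting them all alike
  would cost a factor of order sqrt a per step. The factor c(P)^q discounts every removal from a
  cycle by 2^(-q). The price is a factor 2^q for insertions that may close a cycle, but these lead
  to at most 2a vertices, against a weight n \<tau> for free insertions. With 2^q a constant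
  multiple of a, the corrections are O(log^2 n) under a square root, hence O(log n).\<close>

definition boundary :: "'v set set \<Rightarrow> 'v set" where
  "boundary Q = {v. odd (card {e \<in> Q. v \<in> e})}"

definition doubleton :: "'v set \<Rightarrow> bool" where
  "doubleton e \<longleftrightarrow> card e = 2"

notation sym_diff (infixl "\<triangle>" 65)

lemma odd_card_sym_diff:
  assumes "finite A" "finite B"
  shows "odd (card (A \<triangle> B)) \<longleftrightarrow> odd (card A) \<noteq> odd (card B)"
proof -
  have "card (A \<triangle> B) = card (A - B) + card (B - A)"
    using assms by (intro card_Un_disjoint) auto
  moreover have "card A = card (A - B) + card (A \<inter> B)"
    using assms by (metis card_Diff_subset_Int card_mono finite_Int inf_le1 le_add_diff_inverse2)
  moreover have "card B = card (B - A) + card (A \<inter> B)"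
    using assms by (metis card_Diff_subset_Int card_mono finite_Int inf_le1 le_add_diff_inverse2 inf_commute)
  ultimately show ?thesis by auto
qed

lemma boundary_empty [simp]: "boundary {} = {}"
  by (simp add: boundary_def)

text \<open>Degrees add modulo 2 under symmetric difference, so \<open>boundary\<close> is linear
  over the field with two elements. The exchange arguments below are translations by elements of its
  kernel, the cycle space.\<close>

lemma boundary_sym_diff:
  assumes "finite Q" "finite R"
  shows "boundary (Q \<triangle> R) = boundary Q \<triangle> boundary R"
proof (rule Set.set_eqI)
  fix v
  have "{e \<in> Q \<triangle> R. v \<in> e} = {e \<in> Q. v \<in> e} \<triangle> {e \<in> R. v \<in> e}" by auto
  then have "odd (card {e \<in> Q \<triangle> R. v \<in> e}) \<longleftrightarrow>
      odd (card {e \<in> Q. v \<in> e}) \<noteq> odd (card {e \<in> R. v \<in> e})"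
    using odd_card_sym_diff[of "{e \<in> Q. v \<in> e}" "{e \<in> R. v \<in> e}"] assms by simp
  then show "v \<in> boundary (Q \<triangle> R) \<longleftrightarrow> v \<in> boundary Q \<triangle> boundary R"
    by (auto simp: boundary_def)
qed

lemma boundary_singleton [simp]: "boundary {e} = e"
proof (rule Set.set_eqI)
  fix v
  have "{e'. e' = e \<and> v \<in> e'} = (if v \<in> e then {e} else {})" by auto
  then show "v \<in> boundary {e} \<longleftrightarrow> v \<in> e" by (simp add: boundary_def)
qed

lemma boundary_subset: "boundary Q \<subseteq> \<Union>Q"
proof
  fix v assume "v \<in> boundary Q"
  then have "card {e \<in> Q. v \<in> e} \<noteq> 0" unfolding boundary_def by (intro notI) simp
  then have "{e \<in> Q. v \<in> e} \<noteq> {}" by (metis card.empty)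
  then show "v \<in> \<Union>Q" by auto
qed

lemma finite_Union_doubletons:
  assumes "finite Q" "\<forall>e\<in>Q. doubleton e"
  shows "finite (\<Union>Q)"
proof -
  have "finite e" if "e \<in> Q" for e
    using that assms by (auto simp: doubleton_def intro!: card_ge_0_finite)
  then show ?thesis using assms by blast
qed

lemma finite_boundary:
  assumes "finite Q" "\<forall>e\<in>Q. doubleton e"
  shows "finite (boundary Q)"
  by (rule finite_subset[OF boundary_subset finite_Union_doubletons[OF assms]])

text \<open>The handshake lemma modulo 2: adding an edge toggles the parity of exactly two vertices.
  It supplies the contradiction in \<open>at_most_one_bridge\<close>.\<close>

lemma even_card_boundary:
  assumes "finite Q" "\<forall>e\<in>Q. doubleton e"
  shows "even (card (boundary Q))"
  using assms
proof (induction Q)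
  case empty
  then show ?case by simp
next
  case (insert e Q)
  have "insert e Q = Q \<triangle> {e}" using insert by auto
  then have "boundary (insert e Q) = boundary Q \<triangle> e"
    using boundary_sym_diff[of Q "{e}"] insert by simp
  moreover have "finite (boundary Q)" using insert finite_boundary by blast
  moreover have "card e = 2" "finite e"
    using insert by (auto simp: doubleton_def intro: card_ge_0_finite)
  ultimately show ?case
    using odd_card_sym_diff[of "boundary Q" e] insert by auto
qed

text \<open>The number of even subsets of \<open>P\<close> is 2 to the power of the cyclomatic number of \<open>P\<close>.\<close>

definition even_subs :: "'v set set \<Rightarrow> 'v set set set" where
  "even_subs P = {Q. Q \<subseteq> P \<and> boundary Q = {}}"

lemma finite_even_subs: "finite P \<Longrightarrow> finite (even_subs P)"
  unfolding even_subs_def by (rule finite_subset[of _ "Pow P"]) auto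

lemma card_even_subs_mono:
  assumes "finite P" "P' \<subseteq> P" shows "card (even_subs P') \<le> card (even_subs P)"
  using assms finite_even_subs[of P] by (intro card_mono) (auto simp: even_subs_def)

text \<open>The edge is pendant at \<open>x\<close>: any subset containing it has degree one there,
  so it lies on no cycle. This is the generic insertion step of a walk.\<close>

lemma even_subs_insert_fresh:
  assumes "x \<notin> \<Union>P" "x \<in> e"
  shows "even_subs (insert e P) = even_subs P"
proof -
  have "e \<notin> Q" if "Q \<subseteq> insert e P" "boundary Q = {}" for Q
  proof
    assume "e \<in> Q"
    have "{e' \<in> Q. x \<in> e'} = {e}" using assms that \<open>e \<in> Q\<close> by auto
    then have "x \<in> boundary Q" by (simp add: boundary_def)
    then show False using that by simp
  qed
  then show ?thesis unfolding even_subs_def by blast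
qed

text \<open>One edge raises the dimension of the cycle space by at most one. If some even
  \<open>R\<close> contains the new edge, translation by \<open>R\<close> embeds all the even
  subsets through that edge into the old ones.\<close>

lemma card_even_subs_insert:
  assumes "finite P"
  shows "card (even_subs (insert e P)) \<le> 2 * card (even_subs P)"
proof (cases "e \<in> P \<or> (\<forall>Q\<in>even_subs (insert e P). e \<notin> Q)")
  case True
  have "Q \<in> even_subs P" if "Q \<in> even_subs (insert e P)" for Q
  proof (cases "e \<in> P")
    case True
    then show ?thesis using that by (simp add: insert_absorb)
  next
    case False
    then have "e \<notin> Q" using \<open>e \<in> P \<or> _\<close> that by (elim disjE) simp_all
    then show ?thesis using that by (simp add: even_subs_def subset_insert)
  qed
  then have "even_subs (insert e P) \<subseteq> even_subs P" by (rule subsetI)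
  then have "card (even_subs (insert e P)) \<le> card (even_subs P)"
    by (intro card_mono finite_even_subs assms)
  then show ?thesis by linarith
next
  case False
  then obtain R where R: "R \<in> even_subs (insert e P)" "e \<in> R" and "e \<notin> P" by auto
  let ?A = "{Q \<in> even_subs (insert e P). e \<in> Q}"
  have fin: "finite Q" if "Q \<in> even_subs (insert e P)" for Q
    using that assms finite_subset by (auto simp: even_subs_def)
  have "inj_on (\<lambda>Q. Q \<triangle> R) ?A"
    by (rule inj_onI) blast
  moreover have "(\<lambda>Q. Q \<triangle> R) ` ?A \<subseteq> even_subs P"
  proof clarify
    fix Q assume Q: "Q \<in> even_subs (insert e P)" "e \<in> Q"
    have "boundary (Q \<triangle> R) = {}"
      using boundary_sym_diff[OF fin[OF Q(1)] fin[OF R(1)]] Q R by (simp add: even_subs_def)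
    moreover have "Q \<triangle> R \<subseteq> P" using Q R by (auto simp: even_subs_def)
    ultimately show "Q \<triangle> R \<in> even_subs P" by (simp add: even_subs_def)
  qed
  ultimately have "card ?A \<le> card (even_subs P)"
    using card_inj_on_le finite_even_subs[OF assms] by blast
  moreover have "even_subs (insert e P) = ?A \<union> even_subs P"
    by (auto simp: even_subs_def)
  then have "card (even_subs (insert e P)) \<le> card ?A + card (even_subs P)"
    using card_Un_le by metis
  ultimately show ?thesis by linarith
qed

text \<open>Translation by a cycle \<open>R\<close> through \<open>e\<close> embeds the even subsets
  avoiding \<open>e\<close> into those containing it, so removing \<open>e\<close> destroys at least
  half of them.\<close>

lemma card_even_subs_remove:
  assumes "finite P" "R \<in> even_subs P" "e \<in> R"
  shows "2 * card (even_subs (P - {e})) \<le> card (even_subs P)"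
proof -
  let ?A = "{Q \<in> even_subs P. e \<in> Q}"
  have fin: "finite Q" if "Q \<in> even_subs P" for Q
    using that assms finite_subset by (auto simp: even_subs_def)
  have sub: "even_subs (P - {e}) = even_subs P - ?A" by (auto simp: even_subs_def)
  have "inj_on (\<lambda>Q. Q \<triangle> R) (even_subs (P - {e}))"
    by (rule inj_onI) blast
  moreover have "(\<lambda>Q. Q \<triangle> R) ` even_subs (P - {e}) \<subseteq> ?A"
  proof clarify
    fix Q assume "Q \<in> even_subs (P - {e})"
    then have Q: "Q \<in> even_subs P" "e \<notin> Q" by (auto simp: even_subs_def)
    have "boundary (Q \<triangle> R) = {}"
      using boundary_sym_diff[OF fin[OF Q(1)] fin[OF assms(2)]] Q assms by (simp add: even_subs_def)
    moreover have "Q \<triangle> R \<subseteq> P" using Q assms by (auto simp: even_subs_def)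
    ultimately show "Q \<triangle> R \<in> even_subs P \<and> e \<in> Q \<triangle> R"
      using Q assms(3) by (simp add: even_subs_def)
  qed
  moreover have "finite ?A" using finite_even_subs[OF assms(1)] by simp
  ultimately have "card (even_subs (P - {e})) \<le> card ?A"
    using card_inj_on_le by blast
  moreover have "card (even_subs P) = card (even_subs (P - {e})) + card ?A"
    using finite_even_subs[OF assms(1)] unfolding sub
    by (metis (no_types, lifting) card_Diff_subset card_mono finite_subset le_add_diff_inverse2
        mem_Collect_eq subsetI)
  ultimately show ?thesis by linarith
qed

text \<open>An edge contained in no even subset is a bridge. Since the degree sum of a component is even, the
  far side of a bridge at \<open>u\<close> contains \<open>v\<close>, so there cannot be two of them.\<close>

lemma at_most_one_bridge:
  assumes fin: "finite P" and dbl: "\<forall>e\<in>P. doubleton e"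
    and bd: "boundary P = {u} \<triangle> {v}"
    and e1: "{u, x1} \<in> P" and e2: "{u, x2} \<in> P" and ne: "x1 \<noteq> x2"
    and br1: "\<forall>Q\<in>even_subs P. {u, x1} \<notin> Q"
    and br2: "\<forall>Q\<in>even_subs P. {u, x2} \<notin> Q"
  shows False
proof -
  define P' where "P' = {e \<in> P. u \<notin> e}"
  \<comment> \<open>Connectivity avoiding u is expressed by boundaries modulo 2 instead of walks:
    \<open>Q\<close> need not be a path, and transitivity is just a symmetric difference.\<close>
  define reach where "reach x y \<longleftrightarrow> (\<exists>Q. Q \<subseteq> P' \<and> boundary Q = {x} \<triangle> {y})" for x y
  have finP': "finite P'" using fin by (simp add: P'_def)
  have reach_trans: "reach x z" if "reach x y" "reach y z" for x y z
  proof -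
    from that(1) obtain Q where Q: "Q \<subseteq> P'" "boundary Q = {x} \<triangle> {y}"
      unfolding reach_def by (elim exE conjE)
    from that(2) obtain R where R: "R \<subseteq> P'" "boundary R = {y} \<triangle> {z}"
      unfolding reach_def by (elim exE conjE)
    have "finite Q" "finite R" using finite_subset[OF _ finP'] Q(1) R(1) by auto
    then have "boundary (Q \<triangle> R) = ({x} \<triangle> {y}) \<triangle> ({y} \<triangle> {z})"
      using boundary_sym_diff[of Q R] Q(2) R(2) by simp
    also have "\<dots> = {x} \<triangle> {z}" by auto
    finally show ?thesis unfolding reach_def using Q(1) R(1)
      by (intro exI[of _ "Q \<triangle> R"]) auto
  qed
  have reach_sym: "reach x y \<Longrightarrow> reach y x" for x y
    unfolding reach_def by (metis Un_commute)
  have reach_refl: "reach x x" for x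
    unfolding reach_def by (rule exI[of _ "{}"]) simp
  have reach_edge: "reach x y" if "{x, y} \<in> P'" for x y
  proof -
    have "x \<noteq> y" using that dbl by (auto simp: P'_def doubleton_def)
    then have "{x, y} = {x} \<triangle> {y}" by auto
    then show ?thesis unfolding reach_def using that
      by (intro exI[of _ "{{x, y}}"]) simp
  qed
  have u_ne: "x \<noteq> u" if "{u, x} \<in> P" for x
    using that dbl by (auto simp: doubleton_def)
  \<comment> \<open>A connection from x to y away from u closes up with the edges {u, x} and {u, y}
    to an even subset, so a bridge admits none.\<close>
  have cyc: False if "{u, x} \<in> P" "{u, y} \<in> P" "x \<noteq> y" "reach x y"
      "\<forall>Q\<in>even_subs P. {u, x} \<notin> Q" for x y
  proof -
    from that(4) obtain Q where Q: "Q \<subseteq> P'" "boundary Q = {x} \<triangle> {y}"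
      unfolding reach_def by (elim exE conjE)
    have finQ: "finite Q" using Q(1) finP' by (rule finite_subset)
    have *: "{{u,x}} \<triangle> {{u,y}} = {{u,x},{u,y}}" using that(3) by (auto simp: doubleton_eq_iff)
    have "boundary {{u,x},{u,y}} = {u,x} \<triangle> {u,y}"
      using boundary_sym_diff[of "{{u,x}}" "{{u,y}}"] unfolding * by simp
    also have "\<dots> = {x} \<triangle> {y}" using u_ne that by auto
    finally have "boundary (Q \<triangle> {{u,x},{u,y}}) = {}"
      using boundary_sym_diff[OF finQ, of "{{u,x},{u,y}}"] Q by simp
    moreover have "Q \<triangle> {{u,x},{u,y}} \<subseteq> P"
      using Q(1) that(1,2) unfolding P'_def by blast
    ultimately have "Q \<triangle> {{u,x},{u,y}} \<in> even_subs P" by (simp add: even_subs_def)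
    with that(5) have "{u,x} \<notin> Q \<triangle> {{u,x},{u,y}}" by (rule bspec)
    moreover have "{u,x} \<notin> Q" using Q(1) unfolding P'_def by blast
    ultimately show False by simp
  qed
  have key: "reach x v" if ex: "{u, x} \<in> P" and br: "\<forall>Q\<in>even_subs P. {u, x} \<notin> Q" for x
  proof (rule ccontr)
    assume nv: "\<not> reach x v"
    \<comment> \<open>\<open>C\<close> is the far side of the bridge and \<open>P1\<close> its
      edges. If v is not in \<open>C\<close>, every vertex of \<open>C\<close> other than x keeps
      its full, even degree in \<open>P1\<close>, while x loses only the edge to u. A single odd
      vertex contradicts the handshake lemma.\<close>
    define C where "C = {y. reach x y}"
    define P1 where "P1 = {e \<in> P'. e \<inter> C \<noteq> {}}"
    have inC: "e \<subseteq> C" if "e \<in> P1" for e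
    proof -
      from that have "e \<in> P'" "card e = 2" using dbl by (auto simp: P1_def P'_def doubleton_def)
      then obtain a b where ab: "e = {a, b}" by (auto simp: card_2_iff)
      then have "reach a b" using reach_edge \<open>e \<in> P'\<close> by simp
      moreover from this have "reach b a" by (rule reach_sym)
      moreover have "reach x a \<or> reach x b" using that ab by (auto simp: P1_def C_def)
      ultimately have "reach x a" "reach x b" by (meson reach_trans)+
      then show ?thesis using ab by (simp add: C_def)
    qed
    have uC: "u \<notin> C"
    proof
      assume "u \<in> C"
      then obtain Q where "Q \<subseteq> P'" "boundary Q = {x} \<triangle> {u}"
        unfolding C_def reach_def by (elim CollectE exE conjE)
      then have "u \<in> boundary Q" using u_ne[OF ex] by simp
      then have "u \<in> \<Union>Q" using boundary_subset by (rule rev_subsetD)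
      then show False using \<open>Q \<subseteq> P'\<close> by (auto simp: P'_def)
    qed
    have "y \<in> boundary P1 \<longleftrightarrow> y = x" for y
    proof (cases "y \<in> C")
      case False
      then have "y \<notin> \<Union>P1" using inC by blast
      then have "y \<notin> boundary P1" using boundary_subset[of P1] by (meson subsetD)
      moreover have "y \<noteq> x" using False reach_refl[of x] by (auto simp: C_def)
      ultimately show ?thesis by simp
    next
      case True
      then have y: "y \<noteq> u" "y \<noteq> v" using uC nv by (auto simp: C_def)
      have A: "{e \<in> P1. y \<in> e} = {e \<in> P. y \<in> e} - {{u, y}}"
      proof -
        have "e = {u, y}" if "e \<in> P" "y \<in> e" "u \<in> e" for e
          using that dbl y by (auto simp: doubleton_def card_2_iff)
        then show ?thesis using True by (auto simp: P1_def P'_def)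
      qed
      have even_y: "even (card {e \<in> P. y \<in> e})"
        using bd y by (auto simp: boundary_def)
      show ?thesis
      proof (cases "y = x")
        case True
        have "card {e \<in> P. y \<in> e} = Suc (card ({e \<in> P. y \<in> e} - {{u, y}}))"
          using fin ex True by (intro card.remove) auto
        then have "odd (card {e \<in> P1. y \<in> e})" using even_y A by simp
        then show ?thesis using True by (simp add: boundary_def)
      next
        case False
        have "{u, y} \<notin> P"
        proof
          assume "{u, y} \<in> P"
          then show False
            by (rule cyc[OF ex _ _ _ br]) (use False True in \<open>simp_all add: C_def\<close>)
        qed
        then have "{e \<in> P1. y \<in> e} = {e \<in> P. y \<in> e}" using A by auto
        then show ?thesis using False even_y by (simp add: boundary_def)
      qed
    qed
    then have "boundary P1 = {x}" by auto
    moreover have "finite P1" using finP' by (simp add: P1_def)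
    moreover have "\<forall>e\<in>P1. doubleton e"
      using dbl by (auto simp: P1_def P'_def)
    ultimately show False using even_card_boundary[of P1] by simp
  qed
  have "reach x1 x2" using key[OF e1 br1] reach_sym[OF key[OF e2 br2]] by (rule reach_trans)
  then show False by (rule cyc[OF e1 e2 ne _ br1])
qed

section \<open>Growth of the walk potential\<close>

definition admissible :: "nat \<Rightarrow> (nat set \<Rightarrow> nat) \<Rightarrow> bool" where
  "admissible n h \<longleftrightarrow> finite {e. h e > 0} \<and> (\<forall>e. h e > 0 \<longrightarrow> e \<subseteq> {..<n} \<and> doubleton e)"

lemma sum_indicator_le_card:
  assumes "finite A" "card {x \<in> A. R x} \<le> N"
  shows "(\<Sum>x\<in>A. if R x then (1::real) else 0) \<le> real N"
proof -
  have "(\<Sum>x\<in>A. if R x then (1::real) else 0) = real (card {x \<in> A. R x})"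
    using assms(1) by (simp add: sum.If_cases Int_def)
  then show ?thesis using assms(2) by simp
qed

lemma card_neighbours_le:
  assumes "finite P"
  shows "card {x \<in> A. {u, x} \<in> P} \<le> card P"
proof (rule card_inj_on_le)
  show "inj_on (\<lambda>x. {u, x}) {x \<in> A. {u, x} \<in> P}"
    by (rule inj_onI) (auto simp: doubleton_eq_iff)
qed (use assms in auto)

text \<open>\<open>P\<close> is the set of edges used an odd number of times by a walk from \<open>v\<close> to \<open>u\<close>, and \<open>S\<close> is the set
  of all its edges. A step to \<open>x\<close> either inserts \<open>{u, x}\<close> into \<open>P\<close>, leaving the number of even
  subsets unchanged unless \<open>x\<close> already lies on \<open>P\<close>, or removes it, halving this number
  unless the edge is a bridge.\<close>

lemma walk_potential_step:
  fixes P :: "nat set set" and \<tau> y :: real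
  assumes fin: "finite P" "finite S" and sub: "P \<subseteq> S" and dbl: "\<forall>e\<in>P. doubleton e"
    and bd: "boundary P = {u} \<triangle> {v}"
    and S: "card S \<le> N" and \<tau>: "0 \<le> \<tau>" "\<tau> \<le> 1" and y: "y > 0"
  shows "(\<Sum>x\<in>{..<n} - {u}. \<tau> ^ card (insert {u, x} S) * y ^ card (P \<triangle> {{u, x}})
            * real (card (even_subs (P \<triangle> {{u, x}}))) ^ q)
      \<le> \<tau> ^ card S * y ^ card P * real (card (even_subs P)) ^ q *
        (y * (real n * \<tau> + real N + 2 * real N * 2 ^ q) + (1 + real N / 2 ^ q) / y)"
proof -
  let ?c = "\<lambda>P. real (card (even_subs P))"
  let ?K = "\<tau> ^ card S * y ^ card P * ?c P ^ q"
  let ?A = "{..<n} - {u}"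
  let ?I = "\<lambda>b. if b then (1::real) else 0"
  define Br where "Br x \<longleftrightarrow> {u, x} \<in> P \<and> (\<forall>Q\<in>even_subs P. {u, x} \<notin> Q)" for x
  \<comment> \<open>One term per kind of step: removal of a bridge; removal of an edge on a cycle,
    where c(P) halves, counted for every edge of \<open>P\<close>; and insertion. An inserted edge
    costs nothing if it is already in \<open>S\<close>, carries \<tau> if it is new, and is charged
    the full 2^q if it may close a cycle, that is if x lies on \<open>P\<close>.\<close>
  define w where "w x = ?I (Br x) / y + ?I ({u, x} \<in> P) / (y * 2 ^ q)
      + y * (?I ({u, x} \<in> S) + \<tau> + ?I (x \<in> \<Union>P) * 2 ^ q)" for x
  have K: "0 \<le> ?K" using \<tau> y by simp
  have alg: "a * (b / y) * (c * (i + j / z)) = a * b * c * (i / y + j / (y * z))" for a b c i j z :: real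
    by (simp add: algebra_simps add_divide_distrib)
  have cP: "card P \<le> N" using card_mono[OF fin(2) sub] S by linarith
  have step: "\<tau> ^ card (insert {u, x} S) * y ^ card (P \<triangle> {{u, x}}) * ?c (P \<triangle> {{u, x}}) ^ q \<le> ?K * w x"
    if x: "x \<in> ?A" for x
  proof (cases "{u, x} \<in> P")
    case True
    then have eq: "P \<triangle> {{u, x}} = P - {{u, x}}" "insert {u, x} S = S" using sub by auto
    have "card P = Suc (card (P - {{u, x}}))" using True fin by (intro card.remove) auto
    then have yy: "y ^ card (P - {{u, x}}) = y ^ card P / y" using y by simp
    have "?c (P - {{u, x}}) ^ q \<le> ?c P ^ q * (?I (Br x) + ?I ({u, x} \<in> P) / 2 ^ q)"
    proof (cases "Br x")
      case True
      have "?c (P - {{u, x}}) ^ q \<le> ?c P ^ q"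
        using card_even_subs_mono[OF fin(1), of "P - {{u, x}}"] by (intro power_mono) auto
      also have "\<dots> \<le> ?c P ^ q * (?I (Br x) + ?I ({u, x} \<in> P) / 2 ^ q)"
        using True by (simp add: mult_le_cancel_left1)
      finally show ?thesis .
    next
      case False
      then obtain Q where "Q \<in> even_subs P" "{u, x} \<in> Q" using True by (auto simp: Br_def)
      then have "2 * card (even_subs (P - {{u, x}})) \<le> card (even_subs P)"
        by (rule card_even_subs_remove[OF fin(1)])
      then have "2 * ?c (P - {{u, x}}) \<le> ?c P" by linarith
      then have "(2 * ?c (P - {{u, x}})) ^ q \<le> ?c P ^ q" by (intro power_mono) auto
      then show ?thesis using False True by (simp add: field_simps)
    qed
    then have "\<tau> ^ card S * (y ^ card P / y) * ?c (P - {{u, x}}) ^ q \<le>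
        \<tau> ^ card S * (y ^ card P / y) * (?c P ^ q * (?I (Br x) + ?I ({u, x} \<in> P) / 2 ^ q))"
      using \<tau> y by (intro mult_left_mono) auto
    also have "\<dots> = ?K * (?I (Br x) / y + ?I ({u, x} \<in> P) / (y * 2 ^ q))"
      by (rule alg)
    also have "\<dots> \<le> ?K * w x"
      using \<tau> y by (intro mult_left_mono K) (auto simp: w_def)
    finally show ?thesis unfolding eq yy .
  next
    case False
    then have eq: "P \<triangle> {{u, x}} = insert {u, x} P" by auto
    have yy: "y ^ card (insert {u, x} P) = y ^ card P * y" using False fin by simp
    have tt: "\<tau> ^ card (insert {u, x} S) \<le> \<tau> ^ card S * (?I ({u, x} \<in> S) + \<tau>)"
    proof (cases "{u, x} \<in> S")
      case True
      then show ?thesis using \<tau> by (simp add: insert_absorb mult_le_cancel_left1)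
    next
      case False
      then show ?thesis using fin by simp
    qed
    show ?thesis
    proof (cases "x \<in> \<Union>P")
      case True
      have "?c (insert {u, x} P) \<le> 2 * ?c P"
        using card_even_subs_insert[OF fin(1), of "{u, x}"] by linarith
      then have "?c (insert {u, x} P) ^ q \<le> (2 * ?c P) ^ q" by (intro power_mono) auto
      then have c: "?c (insert {u, x} P) ^ q \<le> ?c P ^ q * 2 ^ q" by (simp add: power_mult_distrib mult.commute)
      \<comment> \<open>The factor \<tau> of a possibly new edge is given away here, which is
        affordable since at most 2N vertices lie on \<open>P\<close>.\<close>
      have t: "\<tau> ^ card (insert {u, x} S) \<le> \<tau> ^ card S"
        using \<tau> fin card_mono[of "insert {u, x} S" S] by (intro power_decreasing) auto
      have "\<tau> ^ card (insert {u, x} S) * (y ^ card P * y) * ?c (insert {u, x} P) ^ q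
          \<le> \<tau> ^ card S * (y ^ card P * y) * (?c P ^ q * 2 ^ q)"
        using t c \<tau> y by (intro mult_mono) auto
      also have "\<dots> = ?K * (y * (?I (x \<in> \<Union>P) * 2 ^ q))" using True by simp
      also have "\<dots> \<le> ?K * w x"
      proof (intro mult_left_mono K)
        have "0 \<le> ?I (Br x) / y" "0 \<le> ?I ({u, x} \<in> P) / (y * 2 ^ q)"
          "0 \<le> ?I ({u, x} \<in> S) + \<tau>" using \<tau> y by auto
        then show "y * (?I (x \<in> \<Union>P) * 2 ^ q) \<le> w x"
          using y \<tau> unfolding w_def by (intro add_increasing mult_left_mono) auto
      qed
      finally show ?thesis unfolding eq yy .
    next
      case False
      then have c: "even_subs (insert {u, x} P) = even_subs P"
        by (intro even_subs_insert_fresh) auto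
      have "\<tau> ^ card (insert {u, x} S) * (y ^ card P * y) * ?c P ^ q
          \<le> \<tau> ^ card S * (?I ({u, x} \<in> S) + \<tau>) * (y ^ card P * y) * ?c P ^ q"
        using tt \<tau> y by (intro mult_right_mono) auto
      also have "\<dots> = ?K * (y * (?I ({u, x} \<in> S) + \<tau>))" by (simp only: ac_simps)
      also have "\<dots> \<le> ?K * w x"
      proof (intro mult_left_mono K)
        have "0 \<le> ?I (Br x) / y" "0 \<le> ?I ({u, x} \<in> P) / (y * 2 ^ q)" using y by auto
        moreover have "0 \<le> ?I (x \<in> \<Union>P) * 2 ^ q" by simp
        then have "y * (?I ({u, x} \<in> S) + \<tau>) \<le> y * (?I ({u, x} \<in> S) + \<tau> + ?I (x \<in> \<Union>P) * 2 ^ q)"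
          using y by (intro mult_left_mono) linarith+
        ultimately show "y * (?I ({u, x} \<in> S) + \<tau>) \<le> w x" unfolding w_def by linarith
      qed
      finally show ?thesis unfolding eq yy c .
    qed
  qed
  have sw: "sum w ?A \<le> y * (real n * \<tau> + real N + 2 * real N * 2 ^ q) + (1 + real N / 2 ^ q) / y"
  proof -
    have "card {x \<in> ?A. Br x} \<le> 1"
    proof (rule ccontr)
      assume "\<not> ?thesis"
      then obtain a b where "a \<in> {x \<in> ?A. Br x}" "b \<in> {x \<in> ?A. Br x}" "a \<noteq> b"
        using card_le_Suc0_iff_eq[of "{x \<in> ?A. Br x}"] by auto
      then show False
        using at_most_one_bridge[OF fin(1) dbl bd, of a b] by (simp add: Br_def)
    qed
    then have 1: "(\<Sum>x\<in>?A. ?I (Br x)) \<le> real 1" by (intro sum_indicator_le_card) auto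
    have "card {x \<in> ?A. {u, x} \<in> P} \<le> N" using card_neighbours_le[OF fin(1), of ?A u] cP by linarith
    then have 2: "(\<Sum>x\<in>?A. ?I ({u, x} \<in> P)) \<le> real N" by (intro sum_indicator_le_card) auto
    have "card {x \<in> ?A. {u, x} \<in> S} \<le> N" using card_neighbours_le[OF fin(2), of ?A u] S by linarith
    then have 3: "(\<Sum>x\<in>?A. ?I ({u, x} \<in> S)) \<le> real N" by (intro sum_indicator_le_card) auto
    have "card (\<Union>P) \<le> (\<Sum>e\<in>P. card e)" using card_Union_le_sum_card by blast
    also have "\<dots> = 2 * card P" using dbl by (simp add: doubleton_def)
    finally have cU: "card (\<Union>P) \<le> 2 * N" using cP by linarith
    have finU: "finite (\<Union>P)" by (rule finite_Union_doubletons[OF fin(1) dbl])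
    have "card {x \<in> ?A. x \<in> \<Union>P} \<le> card (\<Union>P)" by (intro card_mono finU) auto
    then have 4: "(\<Sum>x\<in>?A. ?I (x \<in> \<Union>P)) \<le> real (2 * N)" using cU by (intro sum_indicator_le_card) auto
    have 5: "(\<Sum>x\<in>?A. \<tau>) \<le> real n * \<tau>"
      using \<tau> card_mono[of "{..<n}" ?A] by (auto intro!: mult_right_mono)
    have "sum w ?A = (\<Sum>x\<in>?A. ?I (Br x)) / y + (\<Sum>x\<in>?A. ?I ({u, x} \<in> P)) / (y * 2 ^ q)
      + y * ((\<Sum>x\<in>?A. ?I ({u, x} \<in> S)) + (\<Sum>x\<in>?A. \<tau>) + (\<Sum>x\<in>?A. ?I (x \<in> \<Union>P)) * 2 ^ q)"
      unfolding w_def by (simp only: sum.distrib sum_distrib_left[symmetric]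
          sum_distrib_right[symmetric] sum_divide_distrib[symmetric])
    also have "\<dots> \<le> real 1 / y + real N / (y * 2 ^ q) + y * (real N + real n * \<tau> + real (2 * N) * 2 ^ q)"
      using y 1 2 3 4 5 by (intro add_mono divide_right_mono mult_left_mono mult_right_mono) auto
    also have "\<dots> = y * (real n * \<tau> + real N + 2 * real N * 2 ^ q) + (1 + real N / 2 ^ q) / y"
      using y by (simp add: field_simps)
    finally show ?thesis .
  qed
  have "(\<Sum>x\<in>?A. \<tau> ^ card (insert {u, x} S) * y ^ card (P \<triangle> {{u, x}}) * ?c (P \<triangle> {{u, x}}) ^ q)
      \<le> (\<Sum>x\<in>?A. ?K * w x)" by (intro sum_mono step)
  also have "\<dots> = ?K * sum w ?A" by (simp only: sum_distrib_left)
  also have "\<dots> \<le> ?K * (y * (real n * \<tau> + real N + 2 * real N * 2 ^ q) + (1 + real N / 2 ^ q) / y)"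
    by (rule mult_left_mono[OF sw K])
  finally show ?thesis .
qed

text \<open>\<open>F a h u\<close> stands for the weighted number of continuations by \<open>a\<close> steps of a walk which has used the
  edge \<open>e\<close> \<open>h e\<close> times and is now at \<open>u\<close>.\<close>

lemma walk_potential:
  fixes F :: "nat \<Rightarrow> (nat set \<Rightarrow> nat) \<Rightarrow> nat \<Rightarrow> real" and \<tau> y :: real
  assumes F0: "\<And>h u. admissible n h \<Longrightarrow> u < n \<Longrightarrow>
      \<bar>F 0 h u\<bar> \<le> (if \<exists>e. odd (h e) then 0 else \<tau> ^ card {e. h e > 0})"
    and FS: "\<And>a h u. admissible n h \<Longrightarrow> u < n \<Longrightarrow>
      \<bar>F (Suc a) h u\<bar> \<le> (\<Sum>x\<in>{..<n} - {u}. \<bar>F a (h({u, x} := h {u, x} + 1)) x\<bar>)"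
    and \<tau>: "0 \<le> \<tau>" "\<tau> \<le> 1" and y: "y > 0"
    and h: "admissible n h" "u < n" "boundary {e. odd (h e)} = {u} \<triangle> {v}"
    and N: "card {e. h e > 0} + a \<le> N"
  shows "\<bar>F a h u\<bar> \<le> \<tau> ^ card {e. h e > 0} * y ^ card {e. odd (h e)}
      * real (card (even_subs {e. odd (h e)})) ^ q
      * (y * (real n * \<tau> + real N + 2 * real N * 2 ^ q) + (1 + real N / 2 ^ q) / y) ^ a"
  using h N
proof (induction a arbitrary: h u)
  case 0
  show ?case
  proof (cases "\<exists>e. odd (h e)")
    case True
    then have "F 0 h u = 0" using F0[OF 0(1,2)] by simp
    then show ?thesis using \<tau> y by simp
  next
    case False
    then have "{e. odd (h e)} = {}" by auto
    moreover have "even_subs {} = {{} :: nat set set}" by (auto simp: even_subs_def)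
    moreover have "\<bar>F 0 h u\<bar> \<le> \<tau> ^ card {e. h e > 0}" using F0[OF 0(1,2)] False by simp
    ultimately show ?thesis by simp
  qed
next
  case (Suc a)
  let ?\<Lambda> = "y * (real n * \<tau> + real N + 2 * real N * 2 ^ q) + (1 + real N / 2 ^ q) / y"
  let ?S = "{e. h e > 0}" and ?P = "{e. odd (h e)}"
  have sub: "?P \<subseteq> ?S" by (auto intro: odd_pos)
  have fin: "finite ?S" "finite ?P" and dbl: "\<forall>e\<in>?P. doubleton e"
    using Suc.prems(1) sub finite_subset by (auto simp: admissible_def intro: odd_pos)
  have \<Lambda>: "0 \<le> ?\<Lambda>" using \<tau> y by simp
  have le: "\<bar>F a (h({u, x} := h {u, x} + 1)) x\<bar> \<le> \<tau> ^ card (insert {u, x} ?S) * y ^ card (?P \<triangle> {{u, x}})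
            * real (card (even_subs (?P \<triangle> {{u, x}}))) ^ q * ?\<Lambda> ^ a" if x: "x \<in> {..<n} - {u}" for x
  proof -
    let ?h = "h({u, x} := h {u, x} + 1)"
    have S': "{e. ?h e > 0} = insert {u, x} ?S" by auto
    have P': "{e. odd (?h e)} = ?P \<triangle> {{u, x}}" by auto
    have "doubleton {u, x}" using x by (simp add: doubleton_def)
    then have adm: "admissible n ?h"
      using Suc.prems(1,2) x fin(1) S' unfolding admissible_def by auto
    have "boundary (?P \<triangle> {{u, x}}) = ({u} \<triangle> {v}) \<triangle> {u, x}"
      using boundary_sym_diff[OF fin(2), of "{{u, x}}"] Suc.prems(3) by simp
    also have "\<dots> = {x} \<triangle> {v}" using x by auto
    finally have bd: "boundary {e. odd (?h e)} = {x} \<triangle> {v}" unfolding P' .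
    \<comment> \<open>A step adds at most one edge and uses up one unit of \<open>a\<close>, so the
      budget \<open>N\<close> bounds all edge sets met along the whole walk.\<close>
    have "card (insert {u, x} ?S) \<le> Suc (card ?S)" by (rule card_insert_le_m1) auto
    then have "card {e. ?h e > 0} + a \<le> N" unfolding S' using Suc.prems(4) by linarith
    moreover have "x < n" using x by simp
    ultimately show ?thesis using Suc.IH[OF adm _ bd] unfolding S' P' by blast
  qed
  have "\<bar>F (Suc a) h u\<bar> \<le> (\<Sum>x\<in>{..<n} - {u}. \<bar>F a (h({u, x} := h {u, x} + 1)) x\<bar>)"
    by (rule FS[OF Suc.prems(1,2)])
  also have "\<dots> \<le> (\<Sum>x\<in>{..<n} - {u}. \<tau> ^ card (insert {u, x} ?S) * y ^ card (?P \<triangle> {{u, x}})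
            * real (card (even_subs (?P \<triangle> {{u, x}}))) ^ q * ?\<Lambda> ^ a)"
    by (intro sum_mono le)
  also have "\<dots> = (\<Sum>x\<in>{..<n} - {u}. \<tau> ^ card (insert {u, x} ?S) * y ^ card (?P \<triangle> {{u, x}})
            * real (card (even_subs (?P \<triangle> {{u, x}}))) ^ q) * ?\<Lambda> ^ a"
    by (simp only: sum_distrib_right)
  also have "\<dots> \<le> (\<tau> ^ card ?S * y ^ card ?P * real (card (even_subs ?P)) ^ q * ?\<Lambda>) * ?\<Lambda> ^ a"
    using Suc.prems(4) \<Lambda>
    by (intro mult_right_mono walk_potential_step[OF fin(2,1) sub dbl Suc.prems(3) _ \<tau> y]) auto
  finally show ?case by (simp only: power_Suc ac_simps)
qed

subsection \<open>Moments of random matrices with independent symmetric entries\<close>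

text \<open>Powers are unfolded at the left index, so that one unfolding is one step of a walk
  starting at \<open>u\<close>.\<close>

fun mpow :: "nat \<Rightarrow> (nat \<Rightarrow> nat \<Rightarrow> real) \<Rightarrow> nat \<Rightarrow> nat \<Rightarrow> nat \<Rightarrow> real" where
  "mpow n A 0 u v = (if u = v then 1 else 0)"
| "mpow n A (Suc a) u v = (\<Sum>x<n. A u x * mpow n A a x v)"

lemma abs_mpow_le:
  assumes "\<And>u x. u < n \<Longrightarrow> x < n \<Longrightarrow> \<bar>A u x\<bar> \<le> c" "0 \<le> c" "u < n"
  shows "\<bar>mpow n A a u v\<bar> \<le> (real n * c) ^ a"
  using assms(3)
proof (induction a arbitrary: u)
  case 0
  then show ?case by simp
next
  case (Suc a)
  have "\<bar>mpow n A (Suc a) u v\<bar> \<le> (\<Sum>x<n. \<bar>A u x * mpow n A a x v\<bar>)"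
    by (simp only: mpow.simps sum_abs)
  also have "\<dots> \<le> (\<Sum>x<n. c * (real n * c) ^ a)"
    using assms Suc unfolding abs_mult by (intro sum_mono mult_mono) auto
  finally show ?case by simp
qed

lemma borel_measurable_mpow:
  assumes "\<And>u x. u < n \<Longrightarrow> x < n \<Longrightarrow> (\<lambda>\<omega>. A \<omega> u x) \<in> borel_measurable N" "u < n"
  shows "(\<lambda>\<omega>. mpow n (A \<omega>) a u v) \<in> borel_measurable N"
  using assms(2)
proof (induction a arbitrary: u)
  case 0
  then show ?case by simp
next
  case (Suc a)
  then show ?case using assms(1) by (simp only: mpow.simps) (intro borel_measurable_sum borel_measurable_times, auto)
qed

definition edges :: "nat \<Rightarrow> nat set set" where
  "edges n = {e. e \<subseteq> {..<n} \<and> doubleton e}"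

lemma finite_edges: "finite (edges n)"
  unfolding edges_def by (rule finite_subset[of _ "Pow {..<n}"]) auto

text \<open>The sign \<open>s\<close> allows symmetric and antisymmetric matrices to be treated together.\<close>

definition signed_matrix :: "(nat \<Rightarrow> nat \<Rightarrow> real) \<Rightarrow> (nat set \<Rightarrow> real) \<Rightarrow> nat \<Rightarrow> nat \<Rightarrow> real" where
  "signed_matrix s z u x = (if u = x then 0 else s u x * z {u, x})"

lemma doubleton_in_edges: "u < n \<Longrightarrow> x < n \<Longrightarrow> u \<noteq> x \<Longrightarrow> {u, x} \<in> edges n"
  by (simp add: edges_def doubleton_def)

lemma abs_signed_matrix_le:
  assumes "\<And>e. e \<in> edges n \<Longrightarrow> \<bar>z e\<bar> \<le> 1" "\<And>u x. \<bar>s u x\<bar> \<le> 1" "u < n" "x < n"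
  shows "\<bar>signed_matrix s z u x\<bar> \<le> 1"
proof (cases "u = x")
  case False
  have "\<bar>s u x\<bar> * \<bar>z {u, x}\<bar> \<le> 1 * 1"
    using assms(1)[OF doubleton_in_edges[OF assms(3,4) False]] assms(2)[of u x] by (intro mult_mono) auto
  then show ?thesis using False by (simp add: signed_matrix_def abs_mult)
qed (simp add: signed_matrix_def)

text \<open>The product \<open>Z h\<close> of the entries used so far is carried along with the
  remaining matrix power, so that expanding one factor is one step of \<open>walk_potential\<close>.
  Factorisation of the mixed moments stands in for independence; it is the form in which the
  symmetrised family on the product space delivers it.\<close>

lemma (in prob_space) trace_moment_bound:
  fixes \<zeta> :: "nat set \<Rightarrow> 'a \<Rightarrow> real" and \<tau> y :: real
  assumes meas: "\<And>e. e \<in> edges n \<Longrightarrow> \<zeta> e \<in> borel_measurable M"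
    and bdd: "\<And>e \<omega>. e \<in> edges n \<Longrightarrow> \<omega> \<in> space M \<Longrightarrow> \<bar>\<zeta> e \<omega>\<bar> \<le> 1"
    and fact: "\<And>h :: nat set \<Rightarrow> nat. expectation (\<lambda>\<omega>. \<Prod>e\<in>edges n. \<zeta> e \<omega> ^ h e)
        = (\<Prod>e\<in>edges n. expectation (\<lambda>\<omega>. \<zeta> e \<omega> ^ h e))"
    and odd0: "\<And>e m. e \<in> edges n \<Longrightarrow> odd m \<Longrightarrow> expectation (\<lambda>\<omega>. \<zeta> e \<omega> ^ m) = 0"
    and var: "\<And>e. e \<in> edges n \<Longrightarrow> expectation (\<lambda>\<omega>. (\<zeta> e \<omega>)\<^sup>2) \<le> \<tau>"
    and s: "\<And>u x. \<bar>s u x\<bar> \<le> 1"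
    and \<tau>: "0 \<le> \<tau>" "\<tau> \<le> 1" and y: "y > 0" and v: "v < n"
  shows "\<bar>expectation (\<lambda>\<omega>. mpow n (signed_matrix s (\<lambda>e. \<zeta> e \<omega>)) a v v)\<bar>
    \<le> (y * (real n * \<tau> + real a + 2 * real a * 2 ^ q) + (1 + real a / 2 ^ q) / y) ^ a"
proof -
  define W where "W a u \<omega> = mpow n (signed_matrix s (\<lambda>e. \<zeta> e \<omega>)) a u v" for a u \<omega>
  define Z where "Z h \<omega> = (\<Prod>e\<in>edges n. \<zeta> e \<omega> ^ h e)" for h :: "nat set \<Rightarrow> nat" and \<omega>
  define F where "F a h u = expectation (\<lambda>\<omega>. Z h \<omega> * W a u \<omega>)" for a h u
  have A_meas: "(\<lambda>\<omega>. signed_matrix s (\<lambda>e. \<zeta> e \<omega>) u x) \<in> borel_measurable M" if "u < n" "x < n" for u x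
    using that meas doubleton_in_edges by (cases "u = x") (auto simp: signed_matrix_def)
  have A_le: "\<bar>signed_matrix s (\<lambda>e. \<zeta> e \<omega>) u x\<bar> \<le> 1" if "u < n" "x < n" "\<omega> \<in> space M" for u x \<omega>
    using bdd s that by (intro abs_signed_matrix_le) auto
  have W_meas: "W a u \<in> borel_measurable M" if "u < n" for a u
    unfolding W_def using A_meas that by (intro borel_measurable_mpow)
  have W_le: "\<bar>W a u \<omega>\<bar> \<le> real n ^ a" if "u < n" "\<omega> \<in> space M" for a u \<omega>
    unfolding W_def using abs_mpow_le[of n _ 1 u a v] A_le that by simp
  have Z_meas: "Z h \<in> borel_measurable M" for h
    unfolding Z_def using meas by (intro borel_measurable_prod borel_measurable_power) auto
  have Z_le: "\<bar>Z h \<omega>\<bar> \<le> 1" if "\<omega> \<in> space M" for h \<omega>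
    unfolding Z_def abs_prod power_abs using bdd that
    by (intro prod_le_1) (auto intro!: power_le_one)
  have ZW_int: "integrable M (\<lambda>\<omega>. Z h \<omega> * W a u \<omega>)" if "u < n" for h a u
  proof (rule integrable_const_bound[of _ "real n ^ a"])
    show "AE \<omega> in M. norm (Z h \<omega> * W a u \<omega>) \<le> real n ^ a"
    proof (rule AE_I2)
      fix \<omega> assume "\<omega> \<in> space M"
      then have "\<bar>Z h \<omega>\<bar> * \<bar>W a u \<omega>\<bar> \<le> 1 * real n ^ a"
        using W_le Z_le that by (intro mult_mono) auto
      then show "norm (Z h \<omega> * W a u \<omega>) \<le> real n ^ a" by (simp add: abs_mult)
    qed
  qed (use W_meas Z_meas that in auto)
  have supp: "e \<in> edges n" if "admissible n h" "h e > 0" for h e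
    using that by (auto simp: admissible_def edges_def)
  have F0: "\<bar>F 0 h u\<bar> \<le> (if \<exists>e. odd (h e) then 0 else \<tau> ^ card {e. h e > 0})"
    if h: "admissible n h" "u < n" for h u
  proof -
    have "F 0 h u = (if u = v then 1 else 0) * (\<Prod>e\<in>edges n. expectation (\<lambda>\<omega>. \<zeta> e \<omega> ^ h e))"
      unfolding F_def W_def fact[symmetric] Z_def by simp
    then have le: "\<bar>F 0 h u\<bar> \<le> (\<Prod>e\<in>edges n. \<bar>expectation (\<lambda>\<omega>. \<zeta> e \<omega> ^ h e)\<bar>)"
      by (simp add: abs_prod prod_nonneg)
    show ?thesis
    proof (cases "\<exists>e. odd (h e)")
      case True
      then obtain e where e: "odd (h e)" by blast
      then have "e \<in> edges n" using supp[OF h(1)] odd_pos by blast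
      then have "(\<Prod>e\<in>edges n. \<bar>expectation (\<lambda>\<omega>. \<zeta> e \<omega> ^ h e)\<bar>) = 0"
        using odd0[OF _ e] finite_edges by (intro prod_zero) auto
      then show ?thesis using le True by simp
    next
      case False
      have "\<bar>expectation (\<lambda>\<omega>. \<zeta> e \<omega> ^ h e)\<bar> \<le> (if h e > 0 then \<tau> else 1)" if e: "e \<in> edges n" for e
      proof (cases "h e > 0")
        case True
        have ev: "even (h e)" using False by blast
        with True have ge: "2 \<le> h e" by presburger
        have int: "integrable M (\<lambda>\<omega>. \<zeta> e \<omega> ^ j)" for j
          using bdd[OF e] meas[OF e]
          by (intro integrable_const_bound[of _ 1] AE_I2) (auto simp: power_abs intro: power_le_one)
        have pos: "0 \<le> \<zeta> e \<omega> ^ h e" for \<omega> using ev by (rule zero_le_even_power)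
        \<comment> \<open>Entries are bounded by 1, so an even moment of positive order is at most
          the second moment: every distinct edge contributes one factor \<tau>, however often it is
          used.\<close>
        have "expectation (\<lambda>\<omega>. \<zeta> e \<omega> ^ h e) \<le> expectation (\<lambda>\<omega>. (\<zeta> e \<omega>)\<^sup>2)"
        proof (rule integral_mono[OF int int])
          fix \<omega> assume "\<omega> \<in> space M"
          then have "\<bar>\<zeta> e \<omega>\<bar> ^ h e \<le> \<bar>\<zeta> e \<omega>\<bar> ^ 2" using bdd[OF e] ge by (intro power_decreasing) auto
          then show "\<zeta> e \<omega> ^ h e \<le> (\<zeta> e \<omega>)\<^sup>2" using ev by (simp add: power_even_abs)
        qed
        moreover have "0 \<le> expectation (\<lambda>\<omega>. \<zeta> e \<omega> ^ h e)" using pos by simp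
        ultimately show ?thesis using True var[OF e] by simp
      qed (simp add: prob_space)
      then have "\<bar>F 0 h u\<bar> \<le> (\<Prod>e\<in>edges n. if h e > 0 then \<tau> else 1)"
        using le by (elim order.trans) (intro prod_mono, auto)
      also have "\<dots> = \<tau> ^ card {e. h e > 0}"
      proof -
        have "{e. h e > 0} = edges n \<inter> {e. h e > 0}" using supp[OF h(1)] by auto
        then show ?thesis using finite_edges by (simp add: prod.If_cases)
      qed
      finally show ?thesis using False by simp
    qed
  qed
  have FS: "\<bar>F (Suc a) h u\<bar> \<le> (\<Sum>x\<in>{..<n} - {u}. \<bar>F a (h({u, x} := h {u, x} + 1)) x\<bar>)"
    if h: "admissible n h" "u < n" for a h u
  proof -
    have upd: "Z (h({u, x} := h {u, x} + 1)) \<omega> = Z h \<omega> * \<zeta> {u, x} \<omega>" if x: "x \<in> {..<n} - {u}" for x \<omega>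
    proof -
      have e: "{u, x} \<in> edges n" using x h by (intro doubleton_in_edges) auto
      show ?thesis unfolding Z_def prod.remove[OF finite_edges e] by simp
    qed
    have ZW: "Z h \<omega> * W (Suc a) u \<omega> = (\<Sum>x\<in>{..<n} - {u}. s u x * (Z (h({u, x} := h {u, x} + 1)) \<omega> * W a x \<omega>))" for \<omega>
    proof -
      have "W (Suc a) u \<omega> = (\<Sum>x<n. signed_matrix s (\<lambda>e. \<zeta> e \<omega>) u x * W a x \<omega>)"
        unfolding W_def by simp
      also have "\<dots> = (\<Sum>x\<in>{..<n} - {u}. s u x * \<zeta> {u, x} \<omega> * W a x \<omega>)"
        by (rule sum.mono_neutral_cong_right) (auto simp: signed_matrix_def)
      finally show ?thesis using upd by (simp add: sum_distrib_left ac_simps)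
    qed
    have "F (Suc a) h u = (\<Sum>x\<in>{..<n} - {u}.
        expectation (\<lambda>\<omega>. s u x * (Z (h({u, x} := h {u, x} + 1)) \<omega> * W a x \<omega>)))"
      unfolding F_def ZW by (intro Bochner_Integration.integral_sum integrable_mult_right ZW_int) auto
    then have "F (Suc a) h u = (\<Sum>x\<in>{..<n} - {u}. s u x * F a (h({u, x} := h {u, x} + 1)) x)"
      unfolding F_def by (simp only: integral_mult_right_zero)
    then have "\<bar>F (Suc a) h u\<bar> \<le> (\<Sum>x\<in>{..<n} - {u}. \<bar>s u x * F a (h({u, x} := h {u, x} + 1)) x\<bar>)"
      by (simp only: sum_abs)
    also have "\<dots> \<le> (\<Sum>x\<in>{..<n} - {u}. \<bar>F a (h({u, x} := h {u, x} + 1)) x\<bar>)"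
      unfolding abs_mult using s by (intro sum_mono mult_left_le_one_le) auto
    finally show ?thesis .
  qed
  have "even_subs {} = {{} :: nat set set}" by (auto simp: even_subs_def)
  \<comment> \<open>The walk starts with no edge used: \<open>P\<close> is empty, its potential is
    1, and the boundary condition reads {v} \<triangle> {v} = {}. The edge budget N is the length
    a.\<close>
  then have "\<bar>F a (\<lambda>_. 0) v\<bar> \<le> (y * (real n * \<tau> + real a + 2 * real a * 2 ^ q) + (1 + real a / 2 ^ q) / y) ^ a"
    using walk_potential[of n F, OF F0 FS \<tau> y _ v, of "\<lambda>_. 0" v a a q] by (simp add: admissible_def)
  moreover have "F a (\<lambda>_. 0) v = expectation (\<lambda>\<omega>. mpow n (signed_matrix s (\<lambda>e. \<zeta> e \<omega>)) a v v)"
    unfolding F_def Z_def W_def by simp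
  ultimately show ?thesis by simp
qed

subsection \<open>Quadratic forms and traces\<close>

lemma mpow_1:
  assumes "v < n"
  shows "mpow n A 1 u v = A u v"
proof -
  have "mpow n A 1 u v = (\<Sum>x<n. if x = v then A u x else 0)"
    unfolding One_nat_def mpow.simps by (intro sum.cong) auto
  then show ?thesis using assms by simp
qed

lemma mpow_add:
  assumes "u < n"
  shows "mpow n A (a + b) u v = (\<Sum>x<n. mpow n A a u x * mpow n A b x v)"
  using assms
proof (induction a arbitrary: u)
  case 0
  have "(\<Sum>x<n. mpow n A 0 u x * mpow n A b x v) = (\<Sum>x<n. if x = u then mpow n A b x v else 0)"
    by (intro sum.cong) auto
  then show ?case using 0 by simp
next
  case (Suc a)
  have "mpow n A (Suc a + b) u v = (\<Sum>y<n. A u y * (\<Sum>x<n. mpow n A a y x * mpow n A b x v))"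
    using Suc by simp
  also have "\<dots> = (\<Sum>x<n. \<Sum>y<n. A u y * (mpow n A a y x * mpow n A b x v))"
    unfolding sum_distrib_left by (rule sum.swap)
  also have "\<dots> = (\<Sum>x<n. mpow n A (Suc a) u x * mpow n A b x v)"
    by (simp add: sum_distrib_right mult.assoc)
  finally show ?case .
qed

lemma mpow_transpose:
  assumes A: "\<And>u x. u < n \<Longrightarrow> x < n \<Longrightarrow> A x u = \<theta> * A u x" and "u < n" "v < n"
  shows "mpow n A a v u = \<theta> ^ a * mpow n A a u v"
  using assms(2-)
proof (induction a arbitrary: u v)
  case 0
  then show ?case by simp
next
  case (Suc a)
  have "mpow n A (Suc a) v u = (\<Sum>x<n. A v x * mpow n A a x u)" by simp
  also have "\<dots> = (\<Sum>x<n. \<theta> ^ Suc a * (mpow n A a u x * mpow n A 1 x v))"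
  proof (intro sum.cong refl)
    fix x assume "x \<in> {..<n}"
    then have x: "x < n" by simp
    show "A v x * mpow n A a x u = \<theta> ^ Suc a * (mpow n A a u x * mpow n A 1 x v)"
      unfolding mpow_1[OF Suc.prems(2)] A[OF x Suc.prems(2)] Suc.IH[OF Suc.prems(1) x]
      by (simp only: power_Suc ac_simps)
  qed
  also have "\<dots> = \<theta> ^ Suc a * mpow n A (a + 1) u v"
    unfolding mpow_add[OF Suc.prems(1), of A a 1 v] by (simp only: sum_distrib_left)
  finally show ?case by (simp only: Suc_eq_plus1[symmetric])
qed

definition mat_act :: "nat \<Rightarrow> (nat \<Rightarrow> nat \<Rightarrow> real) \<Rightarrow> (nat \<Rightarrow> complex) \<Rightarrow> nat \<Rightarrow> complex" where
  "mat_act n A w u = (\<Sum>x<n. of_real (A u x) * w x)"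

definition quad_form :: "nat \<Rightarrow> (nat \<Rightarrow> nat \<Rightarrow> real) \<Rightarrow> (nat \<Rightarrow> complex) \<Rightarrow> complex" where
  "quad_form n A w = (\<Sum>u<n. cnj (w u) * mat_act n A w u)"

definition vnorm :: "nat \<Rightarrow> (nat \<Rightarrow> complex) \<Rightarrow> real" where
  "vnorm n w = L2_set (\<lambda>u. norm (w u)) {..<n}"

lemma norm_inner_le: "norm (\<Sum>u<n. cnj (w u) * z u) \<le> vnorm n w * vnorm n z"
proof -
  have "norm (\<Sum>u<n. cnj (w u) * z u) \<le> (\<Sum>u<n. \<bar>norm (w u)\<bar> * \<bar>norm (z u)\<bar>)"
    by (rule order.trans[OF norm_sum]) (simp add: norm_mult)
  also have "\<dots> \<le> vnorm n w * vnorm n z" unfolding vnorm_def by (rule L2_set_mult_ineq)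
  finally show ?thesis .
qed

lemma vnorm_nonneg: "0 \<le> vnorm n w" by (simp add: vnorm_def)

lemma vnorm_power2: "(vnorm n w)\<^sup>2 = (\<Sum>u<n. (norm (w u))\<^sup>2)"
  unfolding vnorm_def L2_set_def by (simp add: sum_nonneg)

text \<open>Cauchy-Schwarz in each row: the operator norm is at most the Hilbert-Schmidt
  norm.\<close>

lemma vnorm_mat_act_le:
  assumes "vnorm n w = 1"
  shows "(vnorm n (mat_act n A w))\<^sup>2 \<le> (\<Sum>u<n. \<Sum>x<n. (A u x)\<^sup>2)"
  unfolding vnorm_power2
proof (rule sum_mono)
  fix u
  have "norm (mat_act n A w u) \<le> (\<Sum>x<n. \<bar>A u x\<bar> * \<bar>norm (w x)\<bar>)"
    unfolding mat_act_def by (rule order.trans[OF norm_sum]) (simp add: norm_mult)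
  also have "\<dots> \<le> L2_set (A u) {..<n} * vnorm n w" unfolding vnorm_def by (rule L2_set_mult_ineq)
  finally have "(norm (mat_act n A w u))\<^sup>2 \<le> (L2_set (A u) {..<n})\<^sup>2"
    using assms by (intro power_mono) auto
  then show "(norm (mat_act n A w u))\<^sup>2 \<le> (\<Sum>x<n. (A u x)\<^sup>2)"
    by (simp add: L2_set_def sum_nonneg)
qed

text \<open>Since the transpose of A^a is \<theta>^a A^a, the squared norm of A^a w equals the form
  of A^(2a) at w up to sign, and Cauchy-Schwarz applies.\<close>

lemma vnorm_mat_act_double:
  assumes A: "\<And>u x. u < n \<Longrightarrow> x < n \<Longrightarrow> A x u = \<theta> * A u x" and \<theta>: "\<bar>\<theta>\<bar> = 1" and w: "vnorm n w = 1"
  shows "(vnorm n (mat_act n (mpow n A a) w))\<^sup>2 \<le> vnorm n (mat_act n (mpow n A (2 * a)) w)"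
proof -
  let ?B = "mpow n A a"
  have "of_real ((vnorm n (mat_act n ?B w))\<^sup>2) = (\<Sum>u<n. cnj (mat_act n ?B w u) * mat_act n ?B w u)"
    by (simp only: vnorm_power2 of_real_sum complex_norm_square) (simp only: mult.commute)
  also have "\<dots> = (\<Sum>u<n. \<Sum>x<n. \<Sum>z<n. cnj (w x) * of_real (?B u x * ?B u z) * w z)"
    by (simp only: mat_act_def cnj_sum sum_product complex_cnj_mult complex_cnj_complex_of_real)
      (simp only: of_real_mult ac_simps)
  also have "\<dots> = (\<Sum>x<n. \<Sum>z<n. \<Sum>u<n. cnj (w x) * of_real (?B u x * ?B u z) * w z)"
    by (subst sum.swap) (intro sum.cong refl sum.swap)
  also have "\<dots> = (\<Sum>x<n. \<Sum>z<n. cnj (w x) * of_real (\<theta> ^ a * mpow n A (2 * a) x z) * w z)"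
  proof (intro sum.cong refl)
    fix x z assume "x \<in> {..<n}" "z \<in> {..<n}"
    then have x: "x < n" by simp
    have tr: "?B u x = \<theta> ^ a * ?B x u" if "x < n" "u < n" for x u
      by (rule mpow_transpose) (use A that in blast)+
    have "(\<Sum>u<n. ?B u x * ?B u z) = (\<Sum>u<n. \<theta> ^ a * (?B x u * ?B u z))"
      using tr[OF x] by (intro sum.cong refl) (simp only: lessThan_iff mult.assoc)
    also have "\<dots> = \<theta> ^ a * mpow n A (2 * a) x z"
      by (simp only: mult_2 mpow_add[OF x] sum_distrib_left)
    finally have "(\<Sum>u<n. ?B u x * ?B u z) = \<theta> ^ a * mpow n A (2 * a) x z" .
    moreover have "(\<Sum>u<n. cnj (w x) * of_real (?B u x * ?B u z) * w z)
        = cnj (w x) * of_real (\<Sum>u<n. ?B u x * ?B u z) * w z"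
      by (simp only: of_real_sum sum_distrib_left sum_distrib_right)
    ultimately show "(\<Sum>u<n. cnj (w x) * of_real (?B u x * ?B u z) * w z)
        = cnj (w x) * of_real (\<theta> ^ a * mpow n A (2 * a) x z) * w z"
      by (simp only:)
  qed
  also have "\<dots> = of_real (\<theta> ^ a) * (\<Sum>x<n. cnj (w x) * mat_act n (mpow n A (2 * a)) w x)"
    by (simp add: mat_act_def sum_distrib_left ac_simps)
  finally have "norm (of_real ((vnorm n (mat_act n ?B w))\<^sup>2) :: complex)
      = norm (of_real (\<theta> ^ a) * (\<Sum>x<n. cnj (w x) * mat_act n (mpow n A (2 * a)) w x))"
    by (rule arg_cong)
  then have "(vnorm n (mat_act n ?B w))\<^sup>2 = norm (\<Sum>x<n. cnj (w x) * mat_act n (mpow n A (2 * a)) w x)"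
    using \<theta> by (simp add: norm_mult norm_power power_abs)
  also have "\<dots> \<le> vnorm n w * vnorm n (mat_act n (mpow n A (2 * a)) w)" by (rule norm_inner_le)
  finally show ?thesis by (simp only: w mult_1)
qed

text \<open>Repeated doubling replaces the spectral theorem: the norm of A w to the power 2^j is at
  most the norm of A^(2^j) w, and the Hilbert-Schmidt bound turns the square of the latter into a
  trace. This is why all exponents have the form 2 * 2^j.\<close>

lemma quad_form_power_le_trace:
  assumes A: "\<And>u x. u < n \<Longrightarrow> x < n \<Longrightarrow> A x u = \<theta> * A u x" and \<theta>: "\<bar>\<theta>\<bar> = 1" and w: "vnorm n w = 1"
    and j: "j \<ge> 1"
  shows "norm (quad_form n A w) ^ (2 * 2 ^ j) \<le> (\<Sum>u<n. mpow n A (2 * 2 ^ j) u u)"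
proof -
  define t where "t a = vnorm n (mat_act n (mpow n A a) w)" for a
  have t: "t 1 ^ 2 ^ i \<le> t (2 ^ i)" for i
  proof (induction i)
    case (Suc i)
    have "t 1 ^ 2 ^ Suc i = (t 1 ^ 2 ^ i)\<^sup>2" by (simp only: power_Suc mult.commute[of 2] power_mult)
    also have "\<dots> \<le> (t (2 ^ i))\<^sup>2" using Suc by (intro power_mono) (simp_all add: t_def vnorm_nonneg)
    also have "\<dots> \<le> t (2 ^ Suc i)" unfolding t_def using vnorm_mat_act_double[OF A \<theta> w] by simp
    finally show ?case .
  qed simp
  have "mat_act n (mpow n A 1) w u = mat_act n A w u" for u
    unfolding mat_act_def by (intro sum.cong refl) (simp only: lessThan_iff mpow_1)
  then have "quad_form n A w = (\<Sum>u<n. cnj (w u) * mat_act n (mpow n A 1) w u)"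
    unfolding quad_form_def by (intro sum.cong refl) (simp only: lessThan_iff)
  then have "norm (quad_form n A w) \<le> vnorm n w * t 1"
    unfolding t_def by (simp only: norm_inner_le)
  then have "norm (quad_form n A w) \<le> t 1" by (simp only: w mult_1)
  then have "norm (quad_form n A w) ^ (2 * 2 ^ j) \<le> t 1 ^ (2 * 2 ^ j)" by (intro power_mono) auto
  also have "\<dots> = (t 1 ^ 2 ^ j)\<^sup>2" by (simp only: mult.commute[of 2] power_mult)
  also have "\<dots> \<le> (t (2 ^ j))\<^sup>2" using t by (intro power_mono) (simp_all add: t_def vnorm_nonneg)
  also have "\<dots> \<le> (\<Sum>u<n. \<Sum>x<n. (mpow n A (2 ^ j) u x)\<^sup>2)"
    unfolding t_def by (rule vnorm_mat_act_le[OF w])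
  also have "\<dots> = (\<Sum>u<n. mpow n A (2 * 2 ^ j) u u)"
  proof (intro sum.cong refl)
    fix u assume "u \<in> {..<n}"
    then have u: "u < n" by simp
    \<comment> \<open>Here j \<ge> 1 enters: A^(2^j) is symmetric even for antisymmetric A, so the
      sum of its squared entries is a trace with the right sign.\<close>
    have "even ((2::nat) ^ j)" using j by simp
    then have "\<theta> ^ 2 ^ j = 1" using \<theta> by (metis power_even_abs power_one)
    moreover have "mpow n A (2 ^ j) x u = \<theta> ^ 2 ^ j * mpow n A (2 ^ j) u x" if "x < n" for x
      by (rule mpow_transpose) (use A u that in blast)+
    ultimately show "(\<Sum>x<n. (mpow n A (2 ^ j) u x)\<^sup>2) = mpow n A (2 * 2 ^ j) u u"
      unfolding mult_2 mpow_add[OF u] power2_eq_square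
      by (intro sum.cong refl) (simp only: lessThan_iff mult_1)
  qed
  finally show ?thesis .
qed

subsection \<open>Symmetrisation\<close>

text \<open>The preceding inequality at a coordinate vector. Nonnegativity is what Markov's
  inequality for the trace requires.\<close>

lemma trace_mpow_nonneg:
  assumes A: "\<And>u x. u < n \<Longrightarrow> x < n \<Longrightarrow> A x u = \<theta> * A u x" and \<theta>: "\<bar>\<theta>\<bar> = 1" and "j \<ge> 1"
  shows "0 \<le> (\<Sum>u<n. mpow n A (2 * 2 ^ j) u u)"
proof (cases "n = 0")
  case False
  define w :: "nat \<Rightarrow> complex" where "w u = (if u = 0 then 1 else 0)" for u
  have "(vnorm n w)\<^sup>2 = (\<Sum>u<n. if u = 0 then 1 else 0)"
    unfolding vnorm_power2 by (intro sum.cong) (auto simp: w_def)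
  then have "(vnorm n w)\<^sup>2 = 1\<^sup>2" using False by simp
  then have "vnorm n w = 1" using vnorm_nonneg[of n w] by (simp only: power2_eq_iff_nonneg zero_le_one)
  then have "norm (quad_form n A w) ^ (2 * 2 ^ j) \<le> (\<Sum>u<n. mpow n A (2 * 2 ^ j) u u)"
    by (rule quad_form_power_le_trace[rotated 2]) (use assms in blast)+
  moreover have "0 \<le> norm (quad_form n A w) ^ (2 * 2 ^ j)" by simp
  ultimately show ?thesis by linarith
qed simp

lemma signed_matrix_symmetric:
  assumes "\<And>u x. s x u = \<theta> * s u x"
  shows "signed_matrix s z x u = \<theta> * signed_matrix s z u x"
proof (cases "u = x")
  case False
  then show ?thesis unfolding signed_matrix_def assms[of x u] by (simp add: insert_commute)
qed (simp add: signed_matrix_def)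

lemma quad_form_signed_matrix:
  "quad_form n (signed_matrix s z) w =
    (\<Sum>u<n. \<Sum>x<n. (if u = x then 0 else cnj (w u) * of_real (s u x) * w x) * of_real (z {u, x}))"
  unfolding quad_form_def mat_act_def sum_distrib_left
  by (intro sum.cong refl) (simp add: signed_matrix_def)

text \<open>The oscillation is bounded rather than the absolute value, because only differences of
  two independent copies enter the moment estimate.\<close>

locale bounded_edge_family = prob_space +
  fixes n :: nat and \<xi> :: "nat set \<Rightarrow> 'a \<Rightarrow> real"
  assumes indep: "indep_vars (\<lambda>_. borel) \<xi> (edges n)"
    and diam: "\<And>e \<omega> \<omega>'. e \<in> edges n \<Longrightarrow> \<omega> \<in> space M \<Longrightarrow> \<omega>' \<in> space M \<Longrightarrow> \<bar>\<xi> e \<omega> - \<xi> e \<omega>'\<bar> \<le> 1"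
begin

lemma measurable_\<xi>: "e \<in> edges n \<Longrightarrow> \<xi> e \<in> borel_measurable M"
  using indep by (simp add: indep_vars_def)

lemma bounded_\<xi>:
  assumes "e \<in> edges n"
  obtains K where "\<And>\<omega>. \<omega> \<in> space M \<Longrightarrow> \<bar>\<xi> e \<omega>\<bar> \<le> K"
proof -
  obtain \<omega>\<^sub>0 where "\<omega>\<^sub>0 \<in> space M" using not_empty by auto
  then have "\<bar>\<xi> e \<omega>\<bar> \<le> \<bar>\<xi> e \<omega>\<^sub>0\<bar> + 1" if "\<omega> \<in> space M" for \<omega>
    using diam[OF assms that, of \<omega>\<^sub>0] by linarith
  then show ?thesis using that by blast
qed

lemma integrable_\<xi>:
  assumes "e \<in> edges n" shows "integrable M (\<xi> e)"
proof -
  obtain K where "\<And>\<omega>. \<omega> \<in> space M \<Longrightarrow> \<bar>\<xi> e \<omega>\<bar> \<le> K" using bounded_\<xi>[OF assms] by blast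
  then show ?thesis using measurable_\<xi>[OF assms] by (intro integrable_const_bound[of _ K] AE_I2) auto
qed

definition \<zeta> :: "nat set \<Rightarrow> 'a \<times> 'a \<Rightarrow> real" where
  "\<zeta> e p = \<xi> e (fst p) - \<xi> e (snd p)"

lemma measurable_sym: "e \<in> edges n \<Longrightarrow> \<zeta> e \<in> borel_measurable (M \<Otimes>\<^sub>M M)"
  unfolding \<zeta>_def using measurable_\<xi> by measurable

lemma abs_sym_le: "e \<in> edges n \<Longrightarrow> p \<in> space (M \<Otimes>\<^sub>M M) \<Longrightarrow> \<bar>\<zeta> e p\<bar> \<le> 1"
  unfolding \<zeta>_def using diam by (auto simp: space_pair_measure)

sublocale pair: pair_prob_space M M ..

lemma integrable_sym_prod:
  "integrable (M \<Otimes>\<^sub>M M) (\<lambda>p. \<Prod>e\<in>edges n. \<zeta> e p ^ h e)"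
proof (rule pair.P.integrable_const_bound[of _ 1])
  show "AE p in M \<Otimes>\<^sub>M M. norm (\<Prod>e\<in>edges n. \<zeta> e p ^ h e) \<le> 1"
  proof (rule AE_I2)
    fix p assume p: "p \<in> space (M \<Otimes>\<^sub>M M)"
    show "norm (\<Prod>e\<in>edges n. \<zeta> e p ^ h e) \<le> 1"
      unfolding real_norm_def abs_prod power_abs using abs_sym_le[OF _ p]
      by (intro prod_le_1) (auto intro!: power_le_one)
  qed
  show "(\<lambda>p. \<Prod>e\<in>edges n. \<zeta> e p ^ h e) \<in> borel_measurable (M \<Otimes>\<^sub>M M)"
    using measurable_sym by (intro borel_measurable_prod borel_measurable_power) auto
qed

lemma integrable_sym_power:
  assumes e: "e \<in> edges n" shows "integrable (M \<Otimes>\<^sub>M M) (\<lambda>p. \<zeta> e p ^ m)"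
proof (rule pair.P.integrable_const_bound[of _ 1])
  show "AE p in M \<Otimes>\<^sub>M M. norm (\<zeta> e p ^ m) \<le> 1"
    using abs_sym_le[OF e] by (intro AE_I2) (auto simp: power_abs intro!: power_le_one)
qed (use measurable_sym[OF e] in measurable)

text \<open>Independence is applied twice, first for a fixed first coordinate.\<close>

lemma expectation_sym_prod:
  "pair.P.expectation (\<lambda>p. \<Prod>e\<in>edges n. \<zeta> e p ^ h e) = (\<Prod>e\<in>edges n. pair.P.expectation (\<lambda>p. \<zeta> e p ^ h e))"
proof -
  define g where "g e t = (\<integral>\<omega>'. (t - \<xi> e \<omega>') ^ h e \<partial>M)" for e and t :: real
  have int_inner: "integrable M (\<lambda>\<omega>'. (\<xi> e \<omega> - \<xi> e \<omega>') ^ h e)" if "e \<in> edges n" "\<omega> \<in> space M" for e \<omega>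
  proof (rule integrable_const_bound[of _ 1])
    show "AE \<omega>' in M. norm ((\<xi> e \<omega> - \<xi> e \<omega>') ^ h e) \<le> 1"
      using diam[OF that(1)] that(2) by (intro AE_I2) (auto simp: power_abs intro!: power_le_one)
  qed (use measurable_\<xi>[OF that(1)] in measurable)
  have g_meas: "g e \<in> borel_measurable borel" if "e \<in> edges n" for e
  proof -
    have [measurable]: "\<xi> e \<in> borel_measurable M" by (rule measurable_\<xi>[OF that])
    show ?thesis unfolding g_def by measurable
  qed
  have g_le: "\<bar>g e (\<xi> e \<omega>)\<bar> \<le> 1" if "e \<in> edges n" "\<omega> \<in> space M" for e \<omega>
  proof -
    have "\<bar>g e (\<xi> e \<omega>)\<bar> \<le> (\<integral>\<omega>'. \<bar>(\<xi> e \<omega> - \<xi> e \<omega>') ^ h e\<bar> \<partial>M)"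
      unfolding g_def using integral_norm_bound[of M "\<lambda>\<omega>'. (\<xi> e \<omega> - \<xi> e \<omega>') ^ h e"] by simp
    also have "\<dots> \<le> (\<integral>\<omega>'. 1 \<partial>M)"
      using int_inner[OF that] diam[OF that(1)] that(2)
      by (intro integral_mono integrable_abs) (auto simp: power_abs intro!: power_le_one)
    finally show ?thesis by (simp add: prob_space)
  qed
  have "pair.P.expectation (\<lambda>p. \<Prod>e\<in>edges n. \<zeta> e p ^ h e)
      = (\<integral>\<omega>. (\<integral>\<omega>'. (\<Prod>e\<in>edges n. (\<xi> e \<omega> - \<xi> e \<omega>') ^ h e) \<partial>M) \<partial>M)"
    using pair.integral_fst'[OF integrable_sym_prod[of h]] by (simp add: \<zeta>_def)
  also have "\<dots> = (\<integral>\<omega>. (\<Prod>e\<in>edges n. g e (\<xi> e \<omega>)) \<partial>M)"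
  proof (rule Bochner_Integration.integral_cong[OF refl])
    fix \<omega> assume \<omega>: "\<omega> \<in> space M"
    have "indep_vars (\<lambda>_. borel) (\<lambda>e \<omega>'. (\<xi> e \<omega> - \<xi> e \<omega>') ^ h e) (edges n)"
      by (rule indep_vars_compose2[OF indep, of "\<lambda>e t. (\<xi> e \<omega> - t) ^ h e"]) measurable
    then show "(\<integral>\<omega>'. (\<Prod>e\<in>edges n. (\<xi> e \<omega> - \<xi> e \<omega>') ^ h e) \<partial>M) = (\<Prod>e\<in>edges n. g e (\<xi> e \<omega>))"
      unfolding g_def using int_inner \<omega> by (intro indep_vars_lebesgue_integral finite_edges) auto
  qed
  also have "\<dots> = (\<Prod>e\<in>edges n. (\<integral>\<omega>. g e (\<xi> e \<omega>) \<partial>M))"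
  proof (rule indep_vars_lebesgue_integral[OF finite_edges])
    show "indep_vars (\<lambda>_. borel) (\<lambda>e \<omega>. g e (\<xi> e \<omega>)) (edges n)"
      by (rule indep_vars_compose2[OF indep]) (rule g_meas)
    fix e assume e: "e \<in> edges n"
    then show "integrable M (\<lambda>\<omega>. g e (\<xi> e \<omega>))"
      using g_le[OF e] measurable_compose[OF measurable_\<xi>[OF e] g_meas[OF e]]
      by (intro integrable_const_bound[of _ 1] AE_I2) auto
  qed
  also have "\<dots> = (\<Prod>e\<in>edges n. pair.P.expectation (\<lambda>p. \<zeta> e p ^ h e))"
    using pair.integral_fst'[OF integrable_sym_power] by (intro prod.cong refl) (simp add: \<zeta>_def g_def)
  finally show ?thesis .
qed

text \<open>Exchanging the two copies preserves the product measure and reverses the sign of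
  \<zeta>.\<close>

lemma expectation_sym_odd:
  assumes "e \<in> edges n" "odd m"
  shows "pair.P.expectation (\<lambda>p. \<zeta> e p ^ m) = 0"
proof -
  have "(\<lambda>p. \<zeta> e p ^ m) \<in> borel_measurable (M \<Otimes>\<^sub>M M)"
    using measurable_sym[OF assms(1)] by measurable
  then have "pair.P.expectation (\<lambda>p. \<zeta> e p ^ m) = (\<integral>(x, y). \<zeta> e (y, x) ^ m \<partial>(M \<Otimes>\<^sub>M M))"
    using pair.integral_product_swap[of "\<lambda>p. \<zeta> e p ^ m"] by simp
  also have "\<dots> = pair.P.expectation (\<lambda>p. - (\<zeta> e p ^ m))"
  proof (intro Bochner_Integration.integral_cong refl)
    fix p :: "'a \<times> 'a"
    have "\<zeta> e (snd p, fst p) = - \<zeta> e p" by (simp add: \<zeta>_def)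
    then show "(case p of (x, y) \<Rightarrow> \<zeta> e (y, x) ^ m) = - (\<zeta> e p ^ m)"
      using assms(2) by (simp add: case_prod_beta)
  qed
  finally show ?thesis by simp
qed

lemma expectation_sym_square:
  assumes e: "e \<in> edges n"
  shows "pair.P.expectation (\<lambda>p. (\<zeta> e p)\<^sup>2) = 2 * variance (\<xi> e)"
proof -
  obtain K where K: "\<And>\<omega>. \<omega> \<in> space M \<Longrightarrow> \<bar>\<xi> e \<omega>\<bar> \<le> K" using bounded_\<xi>[OF e] by blast
  have int2: "integrable M (\<lambda>\<omega>. (\<xi> e \<omega>)\<^sup>2)"
  proof (rule integrable_const_bound[of _ "K\<^sup>2"])
    show "AE \<omega> in M. norm ((\<xi> e \<omega>)\<^sup>2) \<le> K\<^sup>2"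
      using K by (intro AE_I2) (simp add: abs_le_square_iff[symmetric] order.trans[OF K abs_ge_self])
  qed (use measurable_\<xi>[OF e] in measurable)
  note int = integrable_\<xi>[OF e]
  have "pair.P.expectation (\<lambda>p. (\<zeta> e p)\<^sup>2) = (\<integral>\<omega>. (\<integral>\<omega>'. (\<xi> e \<omega> - \<xi> e \<omega>')\<^sup>2 \<partial>M) \<partial>M)"
    using pair.integral_fst'[OF integrable_sym_power[OF e, of 2]] by (simp add: \<zeta>_def)
  also have "\<dots> = (\<integral>\<omega>. (\<xi> e \<omega>)\<^sup>2 + expectation (\<lambda>\<omega>. (\<xi> e \<omega>)\<^sup>2) - 2 * \<xi> e \<omega> * expectation (\<xi> e) \<partial>M)"
    using int int2 by (simp add: power2_diff prob_space)
  also have "\<dots> = 2 * (expectation (\<lambda>\<omega>. (\<xi> e \<omega>)\<^sup>2) - (expectation (\<xi> e))\<^sup>2)"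
    using int int2 by (simp add: prob_space power2_eq_square)
  also have "\<dots> = 2 * variance (\<xi> e)" using variance_eq[OF int int2] by simp
  finally show ?thesis .
qed

text \<open>The centred matrix is the mean over the second copy of the symmetrised one, so Jensen's
  inequality for the even power a bounds its form by \<open>G\<close>, the partial mean of the
  trace. As the trace bounds the form at every unit vector, one event serves all w, including the
  random eigenvectors to which it is applied.\<close>

lemma quad_form_tail:
  assumes var: "\<And>e. e \<in> edges n \<Longrightarrow> 2 * variance (\<xi> e) \<le> \<tau>" and \<tau>: "0 \<le> \<tau>" "\<tau> \<le> 1"
    and s: "\<And>u x. \<bar>s u x\<bar> \<le> 1" "\<And>u x. s x u = \<theta> * s u x" and \<theta>: "\<bar>\<theta>\<bar> = 1"
    and j: "j \<ge> 1" and y: "y > 0" and T: "T > 0"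
    and a: "a = 2 * 2 ^ j"
  obtains E where "E \<in> events"
    "prob E \<le> real n * ((y * (real n * \<tau> + real a + 2 * real a * 2 ^ q) + (1 + real a / 2 ^ q) / y) / T) ^ a"
    "\<And>\<omega> w. \<omega> \<in> space M - E \<Longrightarrow> vnorm n w = 1 \<Longrightarrow>
      norm (quad_form n (signed_matrix s (\<lambda>e. \<xi> e \<omega> - expectation (\<xi> e))) w) \<le> T"
proof -
  let ?\<Lambda> = "y * (real n * \<tau> + real a + 2 * real a * 2 ^ q) + (1 + real a / 2 ^ q) / y"
  define tr where "tr p = (\<Sum>u<n. mpow n (signed_matrix s (\<lambda>e. \<zeta> e p)) a u u)" for p
  define G where "G \<omega> = (\<integral>\<omega>'. tr (\<omega>, \<omega>') \<partial>M)" for \<omega>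
  have tr_meas: "tr \<in> borel_measurable (M \<Otimes>\<^sub>M M)"
    unfolding tr_def
  proof (intro borel_measurable_sum borel_measurable_mpow)
    fix u x assume "u < n" "x < n"
    then show "(\<lambda>p. signed_matrix s (\<lambda>e. \<zeta> e p) u x) \<in> borel_measurable (M \<Otimes>\<^sub>M M)"
      using measurable_sym doubleton_in_edges by (cases "u = x") (auto simp: signed_matrix_def)
  qed auto
  have tr_le: "\<bar>tr p\<bar> \<le> real n * real n ^ a" if p: "p \<in> space (M \<Otimes>\<^sub>M M)" for p
  proof -
    have "\<bar>tr p\<bar> \<le> (\<Sum>u<n. \<bar>mpow n (signed_matrix s (\<lambda>e. \<zeta> e p)) a u u\<bar>)"
      unfolding tr_def by (rule sum_abs)
    also have "\<dots> \<le> (\<Sum>u<n. (real n * 1) ^ a)"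
      using abs_sym_le[OF _ p] s(1) by (intro sum_mono abs_mpow_le abs_signed_matrix_le) auto
    finally show ?thesis by simp
  qed
  have tr_int: "integrable (M \<Otimes>\<^sub>M M) tr"
    using tr_le by (intro pair.P.integrable_const_bound[of _ "real n * real n ^ a"] AE_I2 tr_meas) auto
  have symm: "signed_matrix s z x u = \<theta> * signed_matrix s z u x" for z u x
    using s(2) by (rule signed_matrix_symmetric)
  have tr_nonneg: "0 \<le> tr p" for p
    unfolding tr_def a by (rule trace_mpow_nonneg[OF symm \<theta> j])
  have tr_meas2: "(\<lambda>\<omega>'. tr (\<omega>, \<omega>')) \<in> borel_measurable M" if "\<omega> \<in> space M" for \<omega>
    using tr_meas that by measurable
  have tr_int2: "integrable M (\<lambda>\<omega>'. tr (\<omega>, \<omega>'))" if "\<omega> \<in> space M" for \<omega>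
    using tr_le that tr_meas2[OF that] by (intro integrable_const_bound[of _ "real n * real n ^ a"] AE_I2) (auto simp: space_pair_measure)
  have G_int: "integrable M G" unfolding G_def by (rule pair.integrable_fst'[OF tr_int])
  have G_nonneg: "0 \<le> G \<omega>" for \<omega>
    unfolding G_def using tr_nonneg by simp
  have "integral\<^sup>L M G = pair.P.expectation tr"
    unfolding G_def by (rule pair.integral_fst'[OF tr_int])
  also have "\<dots> = (\<Sum>u<n. pair.P.expectation (\<lambda>p. mpow n (signed_matrix s (\<lambda>e. \<zeta> e p)) a u u))"
    unfolding tr_def
  proof (rule Bochner_Integration.integral_sum)
    fix u assume u: "u \<in> {..<n}"
    show "integrable (M \<Otimes>\<^sub>M M) (\<lambda>p. mpow n (signed_matrix s (\<lambda>e. \<zeta> e p)) a u u)"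
    proof (rule pair.P.integrable_const_bound[of _ "(real n * 1) ^ a"])
      show "AE p in M \<Otimes>\<^sub>M M. norm (mpow n (signed_matrix s (\<lambda>e. \<zeta> e p)) a u u) \<le> (real n * 1) ^ a"
        unfolding real_norm_def using abs_sym_le s(1) u by (intro AE_I2 abs_mpow_le abs_signed_matrix_le) auto
      show "(\<lambda>p. mpow n (signed_matrix s (\<lambda>e. \<zeta> e p)) a u u) \<in> borel_measurable (M \<Otimes>\<^sub>M M)"
      proof (rule borel_measurable_mpow)
        fix u x assume "u < n" "x < n"
        then show "(\<lambda>p. signed_matrix s (\<lambda>e. \<zeta> e p) u x) \<in> borel_measurable (M \<Otimes>\<^sub>M M)"
          using measurable_sym doubleton_in_edges by (cases "u = x") (auto simp: signed_matrix_def)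
      qed (use u in auto)
    qed
  qed
  also have "\<dots> \<le> (\<Sum>u<n. ?\<Lambda> ^ a)"
  proof (rule sum_mono)
    fix u assume u: "u \<in> {..<n}"
    have "\<bar>pair.P.expectation (\<lambda>p. mpow n (signed_matrix s (\<lambda>e. \<zeta> e p)) a u u)\<bar> \<le> ?\<Lambda> ^ a"
      using measurable_sym abs_sym_le expectation_sym_prod expectation_sym_odd expectation_sym_square var s(1) \<tau> y u
      by (intro pair.P.trace_moment_bound) auto
    then show "pair.P.expectation (\<lambda>p. mpow n (signed_matrix s (\<lambda>e. \<zeta> e p)) a u u) \<le> ?\<Lambda> ^ a" by linarith
  qed
  finally have EG: "integral\<^sup>L M G \<le> real n * ?\<Lambda> ^ a" by simp
  \<comment> \<open>Markov's inequality is applied to \<open>G\<close> rather than to the trace on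
    the product space, since the event has to live on the original probability space.\<close>
  define E where "E = {\<omega> \<in> space M. T ^ a \<le> G \<omega>}"
  have E_ev: "E \<in> events" unfolding E_def using borel_measurable_integrable[OF G_int] by measurable
  have "prob E \<le> integral\<^sup>L M G / T ^ a"
    unfolding E_def using G_int T G_nonneg
    by (intro integral_Markov_inequality_measure[where A = "{}"]) auto
  also have "\<dots> \<le> real n * ?\<Lambda> ^ a / T ^ a" using EG T by (intro divide_right_mono) auto
  also have "\<dots> = real n * (?\<Lambda> / T) ^ a" by (simp add: power_divide)
  finally have pE: "prob E \<le> real n * (?\<Lambda> / T) ^ a" .
  have "norm (quad_form n (signed_matrix s (\<lambda>e. \<xi> e \<omega> - expectation (\<xi> e))) w) \<le> T"
    if \<omega>: "\<omega> \<in> space M - E" and w: "vnorm n w = 1" for \<omega> w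
  proof -
    define f where "f \<omega>' = quad_form n (signed_matrix s (\<lambda>e. \<zeta> e (\<omega>, \<omega>'))) w" for \<omega>'
    define c where "c u x = (if u = x then 0 else cnj (w u) * of_real (s u x) * w x)" for u x
    have f_eq: "f \<omega>' = (\<Sum>u<n. \<Sum>x<n. c u x * of_real (\<zeta> {u, x} (\<omega>, \<omega>')))" for \<omega>'
      unfolding f_def c_def by (rule quad_form_signed_matrix)
    have f_tr: "norm (f \<omega>') ^ a \<le> tr (\<omega>, \<omega>')" for \<omega>'
      unfolding f_def tr_def a by (rule quad_form_power_le_trace[OF symm \<theta> w j])
    have int_term: "integrable M (\<lambda>\<omega>'. c u x * of_real (\<zeta> {u, x} (\<omega>, \<omega>')))" if "u < n" "x < n" for u x
    proof (cases "u = x")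
      case False
      have "integrable M (\<lambda>\<omega>'. \<zeta> {u, x} (\<omega>, \<omega>'))"
        unfolding \<zeta>_def using integrable_\<xi>[OF doubleton_in_edges[OF that False]] by simp
      then show ?thesis by (intro integrable_mult_right integrable_of_real)
    qed (simp add: c_def)
    have f_int: "integrable M f"
      unfolding f_eq using int_term by (intro Bochner_Integration.integrable_sum) auto
    have "quad_form n (signed_matrix s (\<lambda>e. \<xi> e \<omega> - expectation (\<xi> e))) w
        = (\<Sum>u<n. \<Sum>x<n. c u x * of_real (\<xi> {u, x} \<omega> - expectation (\<xi> {u, x})))"
      unfolding c_def by (rule quad_form_signed_matrix)
    also have "\<dots> = (\<Sum>u<n. \<Sum>x<n. expectation (\<lambda>\<omega>'. c u x * of_real (\<zeta> {u, x} (\<omega>, \<omega>'))))"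
    proof (intro sum.cong refl)
      fix u x assume "u \<in> {..<n}" "x \<in> {..<n}"
      then show "c u x * of_real (\<xi> {u, x} \<omega> - expectation (\<xi> {u, x})) = expectation (\<lambda>\<omega>'. c u x * of_real (\<zeta> {u, x} (\<omega>, \<omega>')))"
        using integrable_\<xi>[OF doubleton_in_edges, of u x]
        by (cases "u = x") (simp_all add: c_def \<zeta>_def prob_space)
    qed
    also have "\<dots> = expectation f"
      unfolding f_eq using int_term
      by (subst Bochner_Integration.integral_sum; (intro Bochner_Integration.integrable_sum)?)
        (auto simp: Bochner_Integration.integral_sum)
    finally have eq: "quad_form n (signed_matrix s (\<lambda>e. \<xi> e \<omega> - expectation (\<xi> e))) w = expectation f" .
    have "norm (expectation f) ^ a \<le> expectation (\<lambda>\<omega>'. norm (f \<omega>')) ^ a"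
      by (intro power_mono integral_norm_bound) auto
    also have "\<dots> \<le> expectation (\<lambda>\<omega>'. norm (f \<omega>') ^ a)"
    proof (rule jensens_inequality[where I = UNIV])
      show "integrable M (\<lambda>\<omega>'. norm (f \<omega>'))" using f_int by simp
      have fm: "f \<in> borel_measurable M" using f_int by simp
      show "integrable M (\<lambda>\<omega>'. norm (f \<omega>') ^ a)"
        using \<omega> f_tr tr_nonneg fm
        by (intro Bochner_Integration.integrable_bound[OF tr_int2[of \<omega>]] AE_I2) auto
      show "convex_on UNIV (\<lambda>x::real. x ^ a)" using a by (intro convex_power_even) simp
    qed auto
    also have "\<dots> \<le> G \<omega>"
      unfolding G_def
    proof (rule integral_mono)
      have fm: "f \<in> borel_measurable M" using f_int by simp
      show "integrable M (\<lambda>\<omega>'. norm (f \<omega>') ^ a)"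
        using \<omega> f_tr tr_nonneg fm
        by (intro Bochner_Integration.integrable_bound[OF tr_int2[of \<omega>]] AE_I2) auto
      show "integrable M (\<lambda>\<omega>'. tr (\<omega>, \<omega>'))" using tr_int2 \<omega> by simp
    qed (rule f_tr)
    also have "\<dots> \<le> T ^ a" using \<omega> by (auto simp: E_def)
    finally have "norm (expectation f) ^ a \<le> T ^ a" .
    moreover have "a > 0" by (simp add: a)
    ultimately have "norm (expectation f) \<le> T" using T by (subst (asm) power_mono_iff) auto
    then show ?thesis unfolding eq .
  qed
  with E_ev pE show ?thesis by (rule that)
qed

end

subsection \<open>A Bernstein inequality\<close>

lemma exp_le_quadratic: "exp (x::real) \<le> 1 + x + x\<^sup>2 / 2 * exp \<bar>x\<bar>"
proof -
  obtain t where t: "\<bar>t\<bar> \<le> \<bar>x\<bar>" "exp x = (\<Sum>m<2. x ^ m / fact m) + exp t / fact 2 * x ^ 2"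
    using Maclaurin_exp_le[of x 2] by blast
  have "exp x = 1 + x + x\<^sup>2 / 2 * exp t" using t(2) by (simp add: numeral_2_eq_2)
  moreover have "x\<^sup>2 / 2 * exp t \<le> x\<^sup>2 / 2 * exp \<bar>x\<bar>" using t(1) by (intro mult_left_mono) auto
  ultimately show ?thesis by linarith
qed

context prob_space
begin

text \<open>Centring removes the linear term, and the second order remainder costs only exp(r K)
  because r K bounds |l Z|. When r K is small this is nearly the Gaussian bound exp(l^2 v /
  2).\<close>

lemma mgf_centered_le:
  fixes Z :: "'a \<Rightarrow> real"
  assumes meas: "Z \<in> borel_measurable M" and bdd: "\<And>\<omega>. \<omega> \<in> space M \<Longrightarrow> \<bar>Z \<omega>\<bar> \<le> K"
    and mean: "expectation Z = 0" and var: "expectation (\<lambda>\<omega>. (Z \<omega>)\<^sup>2) \<le> v" and l: "\<bar>l\<bar> \<le> r"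
  shows "expectation (\<lambda>\<omega>. exp (l * Z \<omega>)) \<le> exp (l\<^sup>2 * v / 2 * exp (r * K))"
proof -
  have K: "0 \<le> K"
  proof -
    obtain \<omega> where "\<omega> \<in> space M" using not_empty by auto
    then show ?thesis using bdd[of \<omega>] by linarith
  qed
  have lZ: "\<bar>l * Z \<omega>\<bar> \<le> r * K" if "\<omega> \<in> space M" for \<omega>
    unfolding abs_mult using bdd[OF that] l by (intro mult_mono) auto
  have int: "integrable M Z" using meas bdd by (intro integrable_const_bound[of _ K] AE_I2) auto
  have int2: "integrable M (\<lambda>\<omega>. (Z \<omega>)\<^sup>2)"
  proof (rule integrable_const_bound[of _ "K\<^sup>2"])
    show "AE \<omega> in M. norm ((Z \<omega>)\<^sup>2) \<le> K\<^sup>2"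
      using bdd K by (intro AE_I2) (simp add: abs_le_square_iff[symmetric])
  qed (use meas in measurable)
  have int_exp: "integrable M (\<lambda>\<omega>. exp (l * Z \<omega>))"
  proof (rule integrable_const_bound[of _ "exp (r * K)"])
    show "AE \<omega> in M. norm (exp (l * Z \<omega>)) \<le> exp (r * K)"
      using lZ by (intro AE_I2) fastforce
  qed (use meas in measurable)
  have "expectation (\<lambda>\<omega>. exp (l * Z \<omega>)) \<le> expectation (\<lambda>\<omega>. 1 + l * Z \<omega> + l\<^sup>2 / 2 * exp (r * K) * (Z \<omega>)\<^sup>2)"
  proof (rule integral_mono[OF int_exp])
    fix \<omega> assume \<omega>: "\<omega> \<in> space M"
    have "exp (l * Z \<omega>) \<le> 1 + l * Z \<omega> + (l * Z \<omega>)\<^sup>2 / 2 * exp \<bar>l * Z \<omega>\<bar>" by (rule exp_le_quadratic)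
    also have "\<dots> \<le> 1 + l * Z \<omega> + (l * Z \<omega>)\<^sup>2 / 2 * exp (r * K)"
      using lZ[OF \<omega>] by (intro add_left_mono mult_left_mono) auto
    also have "\<dots> = 1 + l * Z \<omega> + l\<^sup>2 / 2 * exp (r * K) * (Z \<omega>)\<^sup>2" by (simp add: power_mult_distrib)
    finally show "exp (l * Z \<omega>) \<le> 1 + l * Z \<omega> + l\<^sup>2 / 2 * exp (r * K) * (Z \<omega>)\<^sup>2" .
  qed (use int int2 in auto)
  also have "\<dots> = 1 + l\<^sup>2 / 2 * exp (r * K) * expectation (\<lambda>\<omega>. (Z \<omega>)\<^sup>2)"
    using int int2 mean by (simp add: prob_space)
  also have "\<dots> \<le> 1 + l\<^sup>2 / 2 * exp (r * K) * v" using var by (intro add_left_mono mult_left_mono) auto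
  also have "\<dots> \<le> exp (l\<^sup>2 / 2 * exp (r * K) * v)" by (rule exp_ge_add_one_self)
  finally show ?thesis by (simp add: mult.commute mult.left_commute)
qed

text \<open>Chernoff's method. The exponent l stays free so that it can later be adapted to the
  variance and the deviation.\<close>

lemma bernstein_one_sided:
  fixes Z :: "'i \<Rightarrow> 'a \<Rightarrow> real"
  assumes I: "finite I" and indep: "indep_vars (\<lambda>_. borel) Z I"
    and bdd: "\<And>i \<omega>. i \<in> I \<Longrightarrow> \<omega> \<in> space M \<Longrightarrow> \<bar>Z i \<omega>\<bar> \<le> K"
    and mean: "\<And>i. i \<in> I \<Longrightarrow> expectation (Z i) = 0"
    and var: "\<And>i. i \<in> I \<Longrightarrow> expectation (\<lambda>\<omega>. (Z i \<omega>)\<^sup>2) \<le> v"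
    and l: "l > 0"
  shows "prob {\<omega> \<in> space M. (\<Sum>i\<in>I. Z i \<omega>) \<ge> t} \<le> exp (- l * t + card I * (l\<^sup>2 * v / 2 * exp (l * K)))"
proof -
  have meas: "Z i \<in> borel_measurable M" if "i \<in> I" for i
    using indep that by (simp add: indep_vars_def)
  have exp_sum: "exp (l * (\<Sum>i\<in>I. Z i \<omega>)) = (\<Prod>i\<in>I. exp (l * Z i \<omega>))" for \<omega>
    using I by (simp add: sum_distrib_left exp_sum)
  have int1: "integrable M (\<lambda>\<omega>. exp (l * Z i \<omega>))" if "i \<in> I" for i
  proof (rule integrable_const_bound[of _ "exp (l * K)"])
    show "AE \<omega> in M. norm (exp (l * Z i \<omega>)) \<le> exp (l * K)"
      using bdd[OF that] l by (intro AE_I2) fastforce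
  qed (use meas[OF that] in measurable)
  have ind: "indep_vars (\<lambda>_. borel) (\<lambda>i \<omega>. exp (l * Z i \<omega>)) I"
    by (rule indep_vars_compose2[OF indep, of "\<lambda>_ t. exp (l * t)"]) measurable
  have "expectation (\<lambda>\<omega>. exp (l * (\<Sum>i\<in>I. Z i \<omega>))) = (\<Prod>i\<in>I. expectation (\<lambda>\<omega>. exp (l * Z i \<omega>)))"
    unfolding exp_sum by (rule indep_vars_lebesgue_integral[OF I ind int1])
  also have "\<dots> \<le> (\<Prod>i\<in>I. exp (l\<^sup>2 * v / 2 * exp (l * K)))"
    using mgf_centered_le[OF meas bdd mean var, of _ l l] l by (intro prod_mono) auto
  also have "\<dots> = exp (card I * (l\<^sup>2 * v / 2 * exp (l * K)))"
    by (simp only: prod_constant exp_of_nat_mult)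
  finally have mgf: "expectation (\<lambda>\<omega>. exp (l * (\<Sum>i\<in>I. Z i \<omega>))) \<le> exp (card I * (l\<^sup>2 * v / 2 * exp (l * K)))" .
  have "prob {\<omega> \<in> space M. (\<Sum>i\<in>I. Z i \<omega>) \<ge> t} = prob {\<omega> \<in> space M. exp (l * (\<Sum>i\<in>I. Z i \<omega>)) \<ge> exp (l * t)}"
    using l by simp
  also have "\<dots> \<le> expectation (\<lambda>\<omega>. exp (l * (\<Sum>i\<in>I. Z i \<omega>))) / exp (l * t)"
    unfolding exp_sum using indep_vars_integrable[OF I ind int1]
    by (intro integral_Markov_inequality_measure[where A = "{}"]) (auto intro!: prod_nonneg)
  also have "\<dots> \<le> exp (card I * (l\<^sup>2 * v / 2 * exp (l * K))) / exp (l * t)"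
    using mgf by (intro divide_right_mono) auto
  also have "\<dots> = exp (- l * t + card I * (l\<^sup>2 * v / 2 * exp (l * K)))"
    unfolding exp_diff[symmetric] by (simp add: algebra_simps)
  finally show ?thesis .
qed

lemma bernstein:
  fixes Z :: "'i \<Rightarrow> 'a \<Rightarrow> real"
  assumes I: "finite I" and indep: "indep_vars (\<lambda>_. borel) Z I"
    and bdd: "\<And>i \<omega>. i \<in> I \<Longrightarrow> \<omega> \<in> space M \<Longrightarrow> \<bar>Z i \<omega>\<bar> \<le> K"
    and mean: "\<And>i. i \<in> I \<Longrightarrow> expectation (Z i) = 0"
    and var: "\<And>i. i \<in> I \<Longrightarrow> expectation (\<lambda>\<omega>. (Z i \<omega>)\<^sup>2) \<le> v"
    and l: "l > 0"
  shows "prob {\<omega> \<in> space M. \<bar>\<Sum>i\<in>I. Z i \<omega>\<bar> \<ge> t} \<le> 2 * exp (- l * t + card I * (l\<^sup>2 * v / 2 * exp (l * K)))"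
proof -
  have meas: "Z i \<in> borel_measurable M" if "i \<in> I" for i
    using indep that by (simp add: indep_vars_def)
  have sum_meas: "(\<lambda>\<omega>. \<Sum>i\<in>I. Z i \<omega>) \<in> borel_measurable M" using meas by (intro borel_measurable_sum)
  have ind': "indep_vars (\<lambda>_. borel) (\<lambda>i \<omega>. - Z i \<omega>) I"
    by (rule indep_vars_compose2[OF indep, of "\<lambda>_ t. - t"]) measurable
  let ?A = "{\<omega> \<in> space M. (\<Sum>i\<in>I. Z i \<omega>) \<ge> t}" and ?B = "{\<omega> \<in> space M. (\<Sum>i\<in>I. - Z i \<omega>) \<ge> t}"
  have ev: "?A \<in> events" "?B \<in> events" using sum_meas unfolding sum_negf by measurable
  have "{\<omega> \<in> space M. \<bar>\<Sum>i\<in>I. Z i \<omega>\<bar> \<ge> t} \<subseteq> ?A \<union> ?B" by (auto simp: sum_negf)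
  then have "prob {\<omega> \<in> space M. \<bar>\<Sum>i\<in>I. Z i \<omega>\<bar> \<ge> t} \<le> prob (?A \<union> ?B)"
    using ev by (intro finite_measure_mono) auto
  also have "\<dots> \<le> prob ?A + prob ?B" using ev by (intro measure_Un_le)
  also have "\<dots> \<le> exp (- l * t + card I * (l\<^sup>2 * v / 2 * exp (l * K)))
      + exp (- l * t + card I * (l\<^sup>2 * v / 2 * exp (l * K)))"
    using assms ind' by (intro add_mono bernstein_one_sided) auto
  finally show ?thesis by simp
qed

end

subsection \<open>Eigenvalues and the numerical range\<close>

lemma quad_form_add:
  "quad_form n (\<lambda>u x. A u x + B u x) w = quad_form n A w + quad_form n B w"
  by (simp add: quad_form_def mat_act_def sum.distrib algebra_simps)

lemma quad_form_cong:
  assumes "\<And>u x. u < n \<Longrightarrow> x < n \<Longrightarrow> A u x = B u x"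
  shows "quad_form n A w = quad_form n B w"
  using assms by (simp add: quad_form_def mat_act_def)

lemma cnj_quad_form: "cnj (quad_form n A w) = quad_form n (\<lambda>u x. A x u) w"
proof -
  have "cnj (quad_form n A w) = (\<Sum>u<n. \<Sum>x<n. cnj (w x) * (of_real (A u x) * w u))"
    by (simp add: quad_form_def mat_act_def sum_distrib_left ac_simps)
  also have "\<dots> = (\<Sum>x<n. \<Sum>u<n. cnj (w x) * (of_real (A u x) * w u))" by (rule sum.swap)
  also have "\<dots> = quad_form n (\<lambda>u x. A x u) w"
    by (simp add: quad_form_def mat_act_def sum_distrib_left)
  finally show ?thesis .
qed

lemma quad_form_scale: "quad_form n (\<lambda>u x. c * A u x) w = of_real c * quad_form n A w"
  by (simp add: quad_form_def mat_act_def sum_distrib_left ac_simps)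

lemma quad_form_diag:
  "quad_form n (\<lambda>u x. if u = x then d u else 0) w = of_real (\<Sum>u<n. d u * (norm (w u))\<^sup>2)"
proof -
  have "mat_act n (\<lambda>u x. if u = x then d u else 0) w u = of_real (d u) * w u" if "u < n" for u
  proof -
    have "mat_act n (\<lambda>u x. if u = x then d u else 0) w u = (\<Sum>x<n. if x = u then of_real (d u) * w u else 0)"
      unfolding mat_act_def by (intro sum.cong) auto
    then show ?thesis using that by simp
  qed
  then have "quad_form n (\<lambda>u x. if u = x then d u else 0) w = (\<Sum>u<n. of_real (d u) * (cnj (w u) * w u))"
    unfolding quad_form_def by (intro sum.cong refl) simp
  also have "\<dots> = of_real (\<Sum>u<n. d u * (norm (w u))\<^sup>2)"
    by (simp only: of_real_sum of_real_mult complex_norm_square) (simp only: mult.commute)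
  finally show ?thesis .
qed

text \<open>For \<theta> = 1 and \<theta> = -1 these are the symmetric and the antisymmetric part
  without diagonal. The diagonal is split off because it carries the row sums of the Laplacian,
  which are not independent of the other entries.\<close>

definition offdiag_part :: "real \<Rightarrow> (nat \<Rightarrow> nat \<Rightarrow> real) \<Rightarrow> nat \<Rightarrow> nat \<Rightarrow> real" where
  "offdiag_part \<theta> a u x = (if u = x then 0 else (a u x + \<theta> * a x u) / 2)"

text \<open>Transposition conjugates the form of a real matrix, so symmetric parts have real and
  antisymmetric parts purely imaginary forms. The diagonal acts on the real axis only, which keeps
  the factor sqrt(log n) out of the imaginary bound.\<close>

lemma numerical_range_bound:
  assumes w: "vnorm n w = 1"
    and plus: "norm (quad_form n (offdiag_part 1 a) w) \<le> S"
    and minus: "norm (quad_form n (offdiag_part (- 1) a) w) \<le> T"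
    and diag: "\<And>u. u < n \<Longrightarrow> \<bar>a u u\<bar> \<le> d"
  shows "\<bar>Re (quad_form n a w)\<bar> \<le> S + d" and "\<bar>Im (quad_form n a w)\<bar> \<le> T"
proof -
  let ?p = "quad_form n (offdiag_part 1 a) w" and ?m = "quad_form n (offdiag_part (- 1) a) w"
  let ?d = "\<Sum>u<n. a u u * (norm (w u))\<^sup>2"
  have "quad_form n a w = quad_form n (\<lambda>u x. (if u = x then a u u else 0) + (offdiag_part 1 a u x + offdiag_part (- 1) a u x)) w"
    by (rule quad_form_cong) (simp add: offdiag_part_def field_simps)
  then have eq: "quad_form n a w = of_real ?d + (?p + ?m)"
    by (simp only: quad_form_add quad_form_diag)
  have "cnj ?p = ?p"
    unfolding cnj_quad_form by (rule quad_form_cong) (auto simp: offdiag_part_def)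
  then have p: "Im ?p = 0" by (simp add: complex_eq_iff)
  have "cnj ?m = of_real (- 1) * ?m"
    unfolding cnj_quad_form quad_form_scale[symmetric]
    by (rule quad_form_cong) (auto simp: offdiag_part_def field_simps)
  then have m: "Re ?m = 0" by (simp add: complex_eq_iff)
  have "\<bar>?d\<bar> \<le> (\<Sum>u<n. d * (norm (w u))\<^sup>2)"
    using diag by (intro order.trans[OF sum_abs] sum_mono) (auto simp: abs_mult intro!: mult_right_mono)
  also have "\<dots> = d" using w by (simp add: sum_distrib_left[symmetric] vnorm_power2[symmetric])
  finally have "\<bar>?d\<bar> \<le> d" .
  then show "\<bar>Re (quad_form n a w)\<bar> \<le> S + d"
    using eq m plus abs_Re_le_cmod[of ?p] by simp
  show "\<bar>Im (quad_form n a w)\<bar> \<le> T"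
    using eq p minus abs_Im_le_cmod[of ?m] by simp
qed

lemma vnorm_pos:
  assumes "u < n" "w u \<noteq> 0" shows "vnorm n w > 0"
proof -
  have "0 < norm (w u)" using assms by simp
  also have "\<dots> \<le> vnorm n w" unfolding vnorm_def using assms by (intro member_le_L2_set) auto
  finally show ?thesis .
qed

lemma eigen_equation_quad_form:
  assumes eq: "\<And>u. u < n \<Longrightarrow> mat_act n a v u = z * v u" and nz: "u\<^sub>0 < n" "v u\<^sub>0 \<noteq> 0"
  obtains w where "vnorm n w = 1" "z = quad_form n a w"
proof -
  define c where "c = vnorm n v"
  have c: "c > 0" unfolding c_def using nz by (rule vnorm_pos)
  define w where "w u = v u / of_real c" for u
  have "(vnorm n w)\<^sup>2 = (\<Sum>u<n. (norm (v u))\<^sup>2 / c\<^sup>2)"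
    unfolding vnorm_power2 w_def by (simp add: norm_divide power_divide)
  also have "\<dots> = (vnorm n v)\<^sup>2 / c\<^sup>2" by (simp add: vnorm_power2 sum_divide_distrib)
  also have "\<dots> = 1\<^sup>2" using c by (simp add: c_def)
  finally have w1: "vnorm n w = 1"
    using vnorm_nonneg[of n w] by (simp only: power2_eq_iff_nonneg zero_le_one)
  have "mat_act n a w u = z * w u" if "u < n" for u
  proof -
    have "mat_act n a w u = mat_act n a v u / of_real c"
      by (simp add: mat_act_def w_def sum_divide_distrib)
    then show ?thesis using eq[OF that] by (simp add: w_def)
  qed
  then have "quad_form n a w = (\<Sum>u<n. z * (w u * cnj (w u)))"
    unfolding quad_form_def by (intro sum.cong refl) simp
  also have "\<dots> = z * of_real ((vnorm n w)\<^sup>2)"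
    by (simp only: vnorm_power2 of_real_sum complex_norm_square sum_distrib_left)
  finally have "z = quad_form n a w" using w1 by simp
  with w1 show ?thesis by (rule that)
qed

lemma complex_eigenvalue_equation:
  assumes A: "A \<in> carrier_mat n n" and "complex_eigenvalue A z"
  obtains v u\<^sub>0 where "u\<^sub>0 < n" "v u\<^sub>0 \<noteq> 0" "\<And>u. u < n \<Longrightarrow> mat_act n (\<lambda>u x. A $$ (u, x)) v u = z * v u"
proof -
  let ?A = "map_mat complex_of_real A"
  have cA: "?A \<in> carrier_mat n n" using A by simp
  obtain v where v: "v \<in> carrier_vec n" "v \<noteq> 0\<^sub>v n" "?A *\<^sub>v v = z \<cdot>\<^sub>v v"
    using assms cA unfolding complex_eigenvalue_def eigenvalue_def eigenvector_def by auto
  have "\<exists>u<n. v $ u \<noteq> 0"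
  proof (rule ccontr)
    assume "\<not> ?thesis"
    then have "v = 0\<^sub>v n" using v(1) by (intro eq_vecI) auto
    then show False using v(2) by simp
  qed
  then obtain u\<^sub>0 where u0: "u\<^sub>0 < n" "v $ u\<^sub>0 \<noteq> 0" by blast
  have "mat_act n (\<lambda>u x. A $$ (u, x)) (($) v) u = z * v $ u" if u: "u < n" for u
  proof -
    have "(?A *\<^sub>v v) $ u = (\<Sum>x<n. ?A $$ (u, x) * v $ x)"
      using u v(1) A by (simp add: scalar_prod_def lessThan_atLeast0)
    also have "\<dots> = mat_act n (\<lambda>u x. A $$ (u, x)) (($) v) u"
      unfolding mat_act_def using u A by (intro sum.cong) auto
    finally show ?thesis using v u by simp
  qed
  then show ?thesis using u0 that by blast
qed

lemma complex_eigenvalue_transpose: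
  assumes A: "A \<in> carrier_mat n n" and "complex_eigenvalue A z"
  shows "complex_eigenvalue (transpose_mat A) z"
proof -
  have cA: "map_mat complex_of_real A \<in> carrier_mat n n" using A by simp
  have "map_mat complex_of_real (transpose_mat A) = transpose_mat (map_mat complex_of_real A)"
    by (rule eq_matI) auto
  then show ?thesis
    using assms(2) cA char_poly_transpose_mat[OF cA]
    unfolding complex_eigenvalue_def by (simp add: eigenvalue_root_char_poly[where n = n])
qed

text \<open>A left eigenvector of a matrix with vanishing row sums is orthogonal to the constants, and on
  such vectors the expectation of the Laplacian acts as a scalar.\<close>

lemma eigenvalue_shift:
  assumes A: "A \<in> carrier_mat n n" and C: "C \<in> carrier_mat n n"
    and rows: "\<And>u. u < n \<Longrightarrow> (\<Sum>x<n. A $$ (u, x)) = 0"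
    and shift: "\<And>u x. u < n \<Longrightarrow> x < n \<Longrightarrow> C $$ (u, x) = A $$ (u, x) - (m - (if u = x then c else 0))"
    and ev: "complex_eigenvalue A z" and z: "z \<noteq> 0"
  obtains v u\<^sub>0 where "u\<^sub>0 < n" "v u\<^sub>0 \<noteq> 0"
    "\<And>u. u < n \<Longrightarrow> mat_act n (\<lambda>u x. C $$ (x, u)) v u = (z + of_real c) * v u"
proof -
  have tA: "transpose_mat A \<in> carrier_mat n n" using A by simp
  obtain v :: "nat \<Rightarrow> complex" and u\<^sub>0 where v: "u\<^sub>0 < n" "v u\<^sub>0 \<noteq> 0"
    "\<And>u. u < n \<Longrightarrow> mat_act n (\<lambda>u x. transpose_mat A $$ (u, x)) v u = z * v u"
    by (rule complex_eigenvalue_equation[OF tA complex_eigenvalue_transpose[OF A ev]]) (rule that)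
  have v3: "(\<Sum>x<n. of_real (A $$ (x, u)) * v x) = z * v u" if "u < n" for u
    using v(3)[OF that] A that unfolding mat_act_def by simp
  have "z * (\<Sum>u<n. v u) = (\<Sum>u<n. \<Sum>x<n. of_real (A $$ (x, u)) * v x)"
    unfolding sum_distrib_left using v3 by (intro sum.cong) auto
  also have "\<dots> = (\<Sum>x<n. \<Sum>u<n. of_real (A $$ (x, u)) * v x)" by (rule sum.swap)
  also have "\<dots> = (\<Sum>x<n. of_real (\<Sum>u<n. A $$ (x, u)) * v x)"
    by (simp add: sum_distrib_right)
  also have "\<dots> = 0" using rows by simp
  finally have s0: "(\<Sum>u<n. v u) = 0" using z by simp
  have "mat_act n (\<lambda>u x. C $$ (x, u)) v u = (z + of_real c) * v u" if u: "u < n" for u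
  proof -
    have "mat_act n (\<lambda>u x. C $$ (x, u)) v u
        = (\<Sum>x<n. of_real (A $$ (x, u)) * v x - of_real m * v x + (if x = u then of_real c * v x else 0))"
      unfolding mat_act_def
    proof (intro sum.cong refl)
      fix x assume "x \<in> {..<n}"
      then have x: "x < n" by simp
      show "of_real (C $$ (x, u)) * v x
          = of_real (A $$ (x, u)) * v x - of_real m * v x + (if x = u then of_real c * v x else 0)"
        unfolding shift[OF x u] by (cases "x = u") (simp_all add: algebra_simps)
    qed
    also have "\<dots> = z * v u - of_real m * (\<Sum>x<n. v x) + of_real c * v u"
      using v3[OF u] u by (simp add: sum.distrib sum_subtractf sum_distrib_left)
    finally show ?thesis using s0 by (simp add: algebra_simps)
  qed
  with v(1,2) show ?thesis by (rule that)
qed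

subsection \<open>Matrices with independent identically distributed entries\<close>

lemma edge_Min_Max:
  assumes "e \<in> edges n"
  shows "Min e < Max e" "Max e < n" "e = {Min e, Max e}"
proof -
  obtain a b where "e = {a, b}" "a \<noteq> b" using assms by (auto simp: edges_def doubleton_def card_2_iff)
  moreover from this have "a < n" "b < n" using assms by (auto simp: edges_def)
  ultimately show "Min e < Max e" "Max e < n" "e = {Min e, Max e}" by (auto simp: min_def max_def)
qed

text \<open>One scalar per unordered edge encodes a matrix with
  \<open>A x u = \<theta> * A u x\<close>: the entry above the diagonal is taken as it is, the one
  below is multiplied by \<theta>. The value 0 at u = x makes the relation hold on the diagonal also
  for \<theta> = -1.\<close>

definition edge_sign :: "real \<Rightarrow> nat \<Rightarrow> nat \<Rightarrow> real" where
  "edge_sign \<theta> u x = (if u < x then 1 else if x < u then \<theta> else 0)"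

text \<open>Stated for a single size n, with the common law represented by range, mean and variance.
  The range is pointwise rather than almost sure, so that the oscillation bound of the edge family
  holds everywhere; \<open>clip\<close> arranges this later.\<close>

locale iid_matrix = prob_space +
  fixes n :: nat and X :: "nat \<Rightarrow> nat \<Rightarrow> 'a \<Rightarrow> real" and B m v :: real
  assumes B: "B > 0"
    and indep: "indep_vars (\<lambda>_. borel) (\<lambda>(i, j). X i j) ({..<n} \<times> {..<n})"
    and range: "\<And>i j \<omega>. i < n \<Longrightarrow> j < n \<Longrightarrow> \<omega> \<in> space M \<Longrightarrow> 0 \<le> X i j \<omega> \<and> X i j \<omega> \<le> B"
    and mean: "\<And>i j. i < n \<Longrightarrow> j < n \<Longrightarrow> expectation (X i j) = m"
    and var: "\<And>i j. i < n \<Longrightarrow> j < n \<Longrightarrow> variance (X i j) = v"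
begin

lemma measurable_X: "i < n \<Longrightarrow> j < n \<Longrightarrow> X i j \<in> borel_measurable M"
  using indep unfolding indep_vars_def by auto

lemma integrable_X:
  assumes "i < n" "j < n" shows "integrable M (X i j)"
  using range[OF assms] measurable_X[OF assms] by (intro integrable_const_bound[of _ B] AE_I2) auto

lemma mean_range: assumes "n > 0" shows "0 \<le> m" "m \<le> B"
proof -
  have "0 \<le> expectation (X 0 0)" using range[OF assms assms] by (intro integral_nonneg_AE AE_I2) auto
  then show "0 \<le> m" using mean[OF assms assms] by simp
  have "expectation (X 0 0) \<le> expectation (\<lambda>_. B)"
    using range[OF assms assms] integrable_X[OF assms assms] by (intro integral_mono) auto
  then show "m \<le> B" using mean[OF assms assms] by (simp add: prob_space)
qed

lemma abs_centered_le:
  assumes "i < n" "j < n" "\<omega> \<in> space M" shows "\<bar>X i j \<omega> - m\<bar> \<le> B"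
  using range[OF assms] mean_range assms(1) by fastforce

lemma var_square: "i < n \<Longrightarrow> j < n \<Longrightarrow> expectation (\<lambda>\<omega>. (X i j \<omega> - m)\<^sup>2) = v"
  using var mean by simp

lemma integrable_square:
  assumes "i < n" "j < n" shows "integrable M (\<lambda>\<omega>. (X i j \<omega> - m)\<^sup>2)"
proof (rule integrable_const_bound[of _ "B\<^sup>2"])
  show "AE \<omega> in M. norm ((X i j \<omega> - m)\<^sup>2) \<le> B\<^sup>2"
    using abs_centered_le[OF assms] B by (intro AE_I2) (simp add: abs_le_square_iff[symmetric])
qed (use measurable_X[OF assms] in measurable)

lemma var_le: assumes "n > 0" shows "0 \<le> v" "v \<le> B\<^sup>2"
proof -
  show "0 \<le> v" unfolding var_square[OF assms assms, symmetric] by simp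
  have "expectation (\<lambda>\<omega>. (X 0 0 \<omega> - m)\<^sup>2) \<le> expectation (\<lambda>_. B\<^sup>2)"
    using abs_centered_le[OF assms assms] B integrable_square[OF assms assms]
    by (intro integral_mono) (auto simp: abs_le_square_iff[symmetric])
  then show "v \<le> B\<^sup>2" using var_square[OF assms assms] by (simp add: prob_space)
qed

lemma indep_centered:
  "indep_vars (\<lambda>_. borel) (\<lambda>p \<omega>. X (fst p) (snd p) \<omega> - m) ({..<n} \<times> {..<n})"
proof -
  have "indep_vars (\<lambda>_. borel) (\<lambda>p \<omega>. (case p of (i, j) \<Rightarrow> X i j) \<omega> - m) ({..<n} \<times> {..<n})"
    by (rule indep_vars_compose2[OF indep, of "\<lambda>_ t. t - m"]) measurable
  then show ?thesis by (simp add: case_prod_beta)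
qed

lemma expectation_centered_mult:
  assumes "a < n" "b < n" "a \<noteq> b"
  shows "expectation (\<lambda>\<omega>. (X a b \<omega> - m) * (X b a \<omega> - m)) = 0"
    and "integrable M (\<lambda>\<omega>. (X a b \<omega> - m) * (X b a \<omega> - m))"
proof -
  let ?I = "{(a, b), (b, a)}"
  have ind: "indep_vars (\<lambda>_. borel) (\<lambda>p \<omega>. X (fst p) (snd p) \<omega> - m) ?I"
    using assms by (intro indep_vars_subset[OF indep_centered]) auto
  have int: "integrable M (\<lambda>\<omega>. X (fst p) (snd p) \<omega> - m)" if "p \<in> ?I" for p
    using that integrable_X assms by auto
  have eq: "(\<lambda>\<omega>. (X a b \<omega> - m) * (X b a \<omega> - m)) = (\<lambda>\<omega>. \<Prod>p\<in>?I. X (fst p) (snd p) \<omega> - m)"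
    using assms(3) by simp
  show "integrable M (\<lambda>\<omega>. (X a b \<omega> - m) * (X b a \<omega> - m))"
    unfolding eq by (rule indep_vars_integrable[OF _ ind int]) simp
  have "expectation (\<lambda>\<omega>. (X a b \<omega> - m) * (X b a \<omega> - m)) = (\<Prod>p\<in>?I. expectation (\<lambda>\<omega>. X (fst p) (snd p) \<omega> - m))"
    unfolding eq by (rule indep_vars_lebesgue_integral[OF _ ind int]) simp
  also have "\<dots> = 0"
  proof (rule prod_zero)
    have "expectation (\<lambda>\<omega>. X a b \<omega> - m) = 0"
      using integrable_X[OF assms(1,2)] mean[OF assms(1,2)] by (simp add: prob_space)
    then show "\<exists>p\<in>?I. expectation (\<lambda>\<omega>. X (fst p) (snd p) \<omega> - m) = 0" by simp
  qed simp
  finally show "expectation (\<lambda>\<omega>. (X a b \<omega> - m) * (X b a \<omega> - m)) = 0" .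
qed

text \<open>The entries of the two parts divided by B, which makes the oscillation at most 1. Each
  of the two independent entries contributes v / (4 B^2) to the variance, so twice the variance is v
  / B^2, the value taken for \<tau>.\<close>

definition \<xi> :: "real \<Rightarrow> nat set \<Rightarrow> 'a \<Rightarrow> real" where
  "\<xi> \<theta> e \<omega> = (X (Min e) (Max e) \<omega> + \<theta> * X (Max e) (Min e) \<omega>) / (2 * B)"

lemma expectation_\<xi>:
  assumes "e \<in> edges n"
  shows "expectation (\<xi> \<theta> e) = (m + \<theta> * m) / (2 * B)"
proof -
  note e = edge_Min_Max[OF assms]
  have "Min e < n" using e by linarith
  then show ?thesis unfolding \<xi>_def using e integrable_X mean by simp
qed

lemma variance_\<xi>:
  assumes "e \<in> edges n" "\<bar>\<theta>\<bar> = 1"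
  shows "2 * variance (\<xi> \<theta> e) = v / B\<^sup>2"
proof -
  define a b where "a = Min e" and "b = Max e"
  have ab: "a < n" "b < n" "a \<noteq> b" using edge_Min_Max[OF assms(1)] by (auto simp: a_def b_def)
  have "\<theta>\<^sup>2 = 1" using assms(2) by (metis power2_abs power_one)
  then have sq: "(\<xi> \<theta> e \<omega> - expectation (\<xi> \<theta> e))\<^sup>2 =
      ((X a b \<omega> - m)\<^sup>2 + 2 * \<theta> * ((X a b \<omega> - m) * (X b a \<omega> - m)) + (X b a \<omega> - m)\<^sup>2) / (4 * B\<^sup>2)" for \<omega>
  proof -
    have "\<xi> \<theta> e \<omega> - expectation (\<xi> \<theta> e) = ((X a b \<omega> - m) + \<theta> * (X b a \<omega> - m)) / (2 * B)"
      unfolding expectation_\<xi>[OF assms(1)] \<xi>_def a_def b_def diff_divide_distrib[symmetric]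
      by (simp add: algebra_simps)
    also have "\<dots>\<^sup>2 = ((X a b \<omega> - m)\<^sup>2 + 2 * \<theta> * ((X a b \<omega> - m) * (X b a \<omega> - m)) + \<theta>\<^sup>2 * (X b a \<omega> - m)\<^sup>2) / (4 * B\<^sup>2)"
      unfolding power_divide power2_sum power_mult_distrib by (simp add: algebra_simps)
    finally show ?thesis using \<open>\<theta>\<^sup>2 = 1\<close> by simp
  qed
  have "variance (\<xi> \<theta> e) = (v + 2 * \<theta> * 0 + v) / (4 * B\<^sup>2)"
    unfolding sq using integrable_square[OF ab(1,2)] integrable_square[OF ab(2,1)]
      var_square[OF ab(1,2)] var_square[OF ab(2,1)] expectation_centered_mult[OF ab] by simp
  then show ?thesis by simp
qed

text \<open>Each edge owns the two positions (Min e, Max e) and (Max e, Min e), and distinct edges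
  own disjoint pairs.\<close>

lemma indep_\<xi>: "indep_vars (\<lambda>_. borel) (\<xi> \<theta>) (edges n)"
proof -
  define K where "K e = {(Min e, Max e), (Max e, Min e)}" for e :: "nat set"
  have "disjoint_family_on K (edges n)"
    unfolding disjoint_family_on_def K_def
  proof (intro ballI impI)
    fix e f assume ef: "e \<in> edges n" "f \<in> edges n" "e \<noteq> f"
    have "\<not> (Min e = Min f \<and> Max e = Max f)" using ef edge_Min_Max(3) by metis
    then show "{(Min e, Max e), (Max e, Min e)} \<inter> {(Min f, Max f), (Max f, Min f)} = {}"
      using edge_Min_Max(1)[OF ef(1)] edge_Min_Max(1)[OF ef(2)] by auto
  qed
  moreover have "K e \<subseteq> {..<n} \<times> {..<n}" if "e \<in> edges n" for e
    using edge_Min_Max[OF that] unfolding K_def by auto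
  ultimately have ind: "indep_vars (\<lambda>e. PiM (K e) (\<lambda>_. borel))
      (\<lambda>e \<omega>. restrict (\<lambda>p. (case p of (i, j) \<Rightarrow> X i j) \<omega>) (K e)) (edges n)"
    by (intro indep_vars_restrict[OF indep]) auto
  have "indep_vars (\<lambda>_. borel)
      (\<lambda>e \<omega>. (restrict (\<lambda>p. (case p of (i, j) \<Rightarrow> X i j) \<omega>) (K e) (Min e, Max e)
        + \<theta> * restrict (\<lambda>p. (case p of (i, j) \<Rightarrow> X i j) \<omega>) (K e) (Max e, Min e)) / (2 * B)) (edges n)"
  proof (rule indep_vars_compose2[OF ind, of "\<lambda>e f. (f (Min e, Max e) + \<theta> * f (Max e, Min e)) / (2 * B)"])
    fix e
    have "(\<lambda>f. f p) \<in> borel_measurable (PiM (K e) (\<lambda>_. borel))" if "p \<in> K e" for p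
      using that by (rule measurable_component_singleton)
    then show "(\<lambda>f. (f (Min e, Max e) + \<theta> * f (Max e, Min e)) / (2 * B)) \<in> borel_measurable (PiM (K e) (\<lambda>_. borel))"
      by (intro borel_measurable_divide borel_measurable_add borel_measurable_times) (auto simp: K_def)
  qed
  then show ?thesis unfolding \<xi>_def[abs_def] by (simp add: K_def)
qed

lemma bounded_edge_family_\<xi>:
  assumes "\<bar>\<theta>\<bar> = 1"
  shows "bounded_edge_family M n (\<xi> \<theta>)"
proof
  show "indep_vars (\<lambda>_. borel) (\<xi> \<theta>) (edges n)" by (rule indep_\<xi>)
  fix e \<omega> \<omega>' assume e: "e \<in> edges n" and \<omega>: "\<omega> \<in> space M" "\<omega>' \<in> space M"
  define a b where "a = Min e" and "b = Max e"
  have ab: "a < n" "b < n" using edge_Min_Max[OF e] by (auto simp: a_def b_def)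
  have "\<bar>X a b \<omega> - X a b \<omega>'\<bar> \<le> B" "\<bar>X b a \<omega> - X b a \<omega>'\<bar> \<le> B"
    using range[OF ab \<omega>(1)] range[OF ab \<omega>(2)] range[OF ab(2,1) \<omega>(1)] range[OF ab(2,1) \<omega>(2)] by linarith+
  then have "\<bar>(X a b \<omega> - X a b \<omega>') + \<theta> * (X b a \<omega> - X b a \<omega>')\<bar> \<le> B + 1 * B"
    using assms by (intro order.trans[OF abs_triangle_ineq] add_mono) (auto simp: abs_mult)
  moreover have "\<xi> \<theta> e \<omega> - \<xi> \<theta> e \<omega>' = ((X a b \<omega> - X a b \<omega>') + \<theta> * (X b a \<omega> - X b a \<omega>')) / (2 * B)"
    unfolding \<xi>_def a_def b_def diff_divide_distrib[symmetric] by (simp add: algebra_simps)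
  ultimately show "\<bar>\<xi> \<theta> e \<omega> - \<xi> \<theta> e \<omega>'\<bar> \<le> 1" using B by (simp add: divide_le_eq)
qed

lemma offdiag_part_eq:
  assumes \<theta>: "\<bar>\<theta>\<bar> = 1" and ux: "u < n" "x < n"
    and a: "\<And>u x. u < n \<Longrightarrow> x < n \<Longrightarrow> u \<noteq> x \<Longrightarrow> a u x = X u x \<omega> - m"
  shows "offdiag_part \<theta> a u x
    = B * signed_matrix (edge_sign \<theta>) (\<lambda>e. \<xi> \<theta> e \<omega> - expectation (\<xi> \<theta> e)) u x"
proof (cases "u = x")
  case True
  then show ?thesis by (simp add: offdiag_part_def signed_matrix_def)
next
  case False
  have \<theta>2: "\<theta> * \<theta> = 1" using \<theta> by (metis abs_mult_self_eq mult_1)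
  have eq: "\<xi> \<theta> {u, x} \<omega> - expectation (\<xi> \<theta> {u, x})
      = ((X (min u x) (max u x) \<omega> - m) + \<theta> * (X (max u x) (min u x) \<omega> - m)) / (2 * B)"
    unfolding expectation_\<xi>[OF doubleton_in_edges[OF ux False]] \<xi>_def diff_divide_distrib[symmetric]
    by (simp add: algebra_simps)
  have a_eq: "a u x = X u x \<omega> - m" "a x u = X x u \<omega> - m" using a ux False by auto
  show ?thesis
  proof (cases "u < x")
    case True
    then show ?thesis unfolding offdiag_part_def signed_matrix_def eq a_eq using B by (simp add: edge_sign_def)
  next
    case less: False
    have "\<theta> * ((X x u \<omega> - m) + \<theta> * (X u x \<omega> - m)) = \<theta> * (X x u \<omega> - m) + (\<theta> * \<theta>) * (X u x \<omega> - m)"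
      by (simp only: distrib_left mult.assoc)
    then have "\<theta> * ((X x u \<omega> - m) + \<theta> * (X u x \<omega> - m)) = (X u x \<omega> - m) + \<theta> * (X x u \<omega> - m)"
      unfolding \<theta>2 by simp
    then show ?thesis unfolding offdiag_part_def signed_matrix_def eq a_eq
      using B less False by (simp add: edge_sign_def)
  qed
qed

definition offdiag_good :: "real \<Rightarrow> real \<Rightarrow> 'a \<Rightarrow> bool" where
  "offdiag_good \<theta> S \<omega> \<longleftrightarrow> (\<forall>w A. vnorm n w = 1 \<longrightarrow>
    (\<forall>u<n. \<forall>x<n. u \<noteq> x \<longrightarrow> A u x = X u x \<omega> - m) \<longrightarrow>
    norm (quad_form n (offdiag_part \<theta> A) w) \<le> S)"

lemma offdiag_tail:
  assumes \<theta>: "\<bar>\<theta>\<bar> = 1" and n: "n > 0" and j: "j \<ge> 1" and y: "y > 0" and T: "T > 0" and a: "a = 2 * 2 ^ j"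
  obtains E where "E \<in> events"
    "prob E \<le> real n * ((y * (real n * (v / B\<^sup>2) + real a + 2 * real a * 2 ^ q) + (1 + real a / 2 ^ q) / y) / T) ^ a"
    "\<And>\<omega>. \<omega> \<in> space M - E \<Longrightarrow> offdiag_good \<theta> (B * T) \<omega>"
proof -
  interpret bounded_edge_family M n "\<xi> \<theta>" by (rule bounded_edge_family_\<xi>[OF \<theta>])
  have \<theta>2: "\<theta> * \<theta> = 1" using \<theta> by (metis abs_mult_self_eq mult_1)
  have s: "\<bar>edge_sign \<theta> u x\<bar> \<le> 1" "edge_sign \<theta> x u = \<theta> * edge_sign \<theta> u x" for u x
    using \<theta> \<theta>2 by (auto simp: edge_sign_def)
  have vB: "0 \<le> v / B\<^sup>2" "v / B\<^sup>2 \<le> 1" using var_le[OF n] B by (auto simp: divide_le_eq)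
  obtain E where E: "E \<in> events"
    "prob E \<le> real n * ((y * (real n * (v / B\<^sup>2) + real a + 2 * real a * 2 ^ q) + (1 + real a / 2 ^ q) / y) / T) ^ a"
    "\<And>\<omega> w. \<omega> \<in> space M - E \<Longrightarrow> vnorm n w = 1 \<Longrightarrow>
      norm (quad_form n (signed_matrix (edge_sign \<theta>) (\<lambda>e. \<xi> \<theta> e \<omega> - expectation (\<xi> \<theta> e))) w) \<le> T"
    by (rule quad_form_tail[OF _ vB s \<theta> j y T a, of q]) (simp add: variance_\<xi> \<theta>, rule that)
  have "norm (quad_form n (offdiag_part \<theta> A) w) \<le> B * T"
    if \<omega>: "\<omega> \<in> space M - E" and w: "vnorm n w = 1"
      and A: "\<And>u x. u < n \<Longrightarrow> x < n \<Longrightarrow> u \<noteq> x \<Longrightarrow> A u x = X u x \<omega> - m" for \<omega> w A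
  proof -
    have "quad_form n (offdiag_part \<theta> A) w
        = quad_form n (\<lambda>u x. B * signed_matrix (edge_sign \<theta>) (\<lambda>e. \<xi> \<theta> e \<omega> - expectation (\<xi> \<theta> e)) u x) w"
      by (rule quad_form_cong) (rule offdiag_part_eq[OF \<theta> _ _ A])
    then have "norm (quad_form n (offdiag_part \<theta> A) w)
        = B * norm (quad_form n (signed_matrix (edge_sign \<theta>) (\<lambda>e. \<xi> \<theta> e \<omega> - expectation (\<xi> \<theta> e))) w)"
      unfolding quad_form_scale using B by (simp add: norm_mult)
    then show ?thesis using E(3)[OF \<omega> w] B by simp
  qed
  then have "offdiag_good \<theta> (B * T) \<omega>" if "\<omega> \<in> space M - E" for \<omega>
    unfolding offdiag_good_def using that by blast
  with E(1,2) show ?thesis by (rule that)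
qed

lemma row_sum_tail:
  assumes n: "n > 0" and l: "l > 0"
  obtains E where "E \<in> events"
    "prob E \<le> real n * (2 * exp (- l * t + real n * (l\<^sup>2 * v / 2 * exp (l * B))))"
    "\<And>\<omega> u. \<omega> \<in> space M - E \<Longrightarrow> u < n \<Longrightarrow> \<bar>\<Sum>k<n. (X u k \<omega> - m)\<bar> < t"
proof -
  define F where "F u = {\<omega> \<in> space M. \<bar>\<Sum>k<n. (X u k \<omega> - m)\<bar> \<ge> t}" for u
  have ev: "F u \<in> events" if "u < n" for u
    unfolding F_def using measurable_X[OF that] by measurable
  have le: "prob (F u) \<le> 2 * exp (- l * t + real n * (l\<^sup>2 * v / 2 * exp (l * B)))" if u: "u < n" for u
  proof -
    let ?I = "{u} \<times> {..<n}"
    have ind: "indep_vars (\<lambda>_. borel) (\<lambda>p \<omega>. X (fst p) (snd p) \<omega> - m) ?I"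
      using u by (intro indep_vars_subset[OF indep_centered]) auto
    have "(\<Sum>p\<in>?I. X (fst p) (snd p) \<omega> - m) = (\<Sum>k<n. (X u k \<omega> - m))" for \<omega>
      by (rule sum.reindex_bij_witness[of _ "\<lambda>k. (u, k)" snd]) auto
    then have "prob (F u) = prob {\<omega> \<in> space M. \<bar>\<Sum>p\<in>?I. X (fst p) (snd p) \<omega> - m\<bar> \<ge> t}"
      unfolding F_def by simp
    also have "\<dots> \<le> 2 * exp (- l * t + card ?I * (l\<^sup>2 * v / 2 * exp (l * B)))"
    proof (rule bernstein[OF _ ind _ _ _ l])
      show "expectation (\<lambda>\<omega>. X (fst p) (snd p) \<omega> - m) = 0" if "p \<in> ?I" for p
        using that u integrable_X mean by (auto simp: prob_space)
      show "expectation (\<lambda>\<omega>. (X (fst p) (snd p) \<omega> - m)\<^sup>2) \<le> v" if "p \<in> ?I" for p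
        using that u var_square[of "fst p" "snd p"] by auto
      show "\<bar>X (fst p) (snd p) \<omega> - m\<bar> \<le> B" if "p \<in> ?I" "\<omega> \<in> space M" for p \<omega>
        using that u by (intro abs_centered_le) auto
    qed simp
    finally show ?thesis by (simp add: card_cartesian_product)
  qed
  have "prob (\<Union>u\<in>{..<n}. F u) \<le> (\<Sum>u<n. prob (F u))"
    using ev by (intro finite_measure_subadditive_finite) auto
  also have "\<dots> \<le> (\<Sum>u<n. 2 * exp (- l * t + real n * (l\<^sup>2 * v / 2 * exp (l * B))))"
    using le by (intro sum_mono) auto
  finally have "prob (\<Union>u\<in>{..<n}. F u) \<le> real n * (2 * exp (- l * t + real n * (l\<^sup>2 * v / 2 * exp (l * B))))"
    by simp
  moreover have "(\<Union>u\<in>{..<n}. F u) \<in> events" using ev by auto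
  moreover have "\<bar>\<Sum>k<n. (X u k \<omega> - m)\<bar> < t" if "\<omega> \<in> space M - (\<Union>u\<in>{..<n}. F u)" "u < n" for \<omega> u
    using that by (auto simp: F_def not_le)
  ultimately show ?thesis using that by blast
qed

end

section \<open>Choice of the parameters in the tail bounds\<close>

lemma dyadic_between:
  fixes x :: real assumes "x \<ge> 2"
  obtains j :: nat where "j \<ge> 1" "x \<le> 2 ^ j" "2 ^ j \<le> 2 * x"
proof -
  obtain k where k: "x < 2 ^ k" using real_arch_pow[of 2 x] by auto
  define j where "j = (LEAST k. x \<le> (2::real) ^ k)"
  have 1: "x \<le> 2 ^ j" unfolding j_def
    by (rule LeastI[of "\<lambda>k. x \<le> (2::real) ^ k" k]) (use k in simp)
  have 2: "j \<noteq> 0" using 1 assms by (intro notI) simp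
  have "j - 1 < j" using 2 by simp
  then have "\<not> x \<le> 2 ^ (j - 1)" unfolding j_def by (rule not_less_Least)
  then have "2 * 2 ^ (j - 1) \<le> 2 * x" by simp
  moreover have "(2::real) * 2 ^ (j - 1) = 2 ^ j" using 2 by (cases j) auto
  ultimately show ?thesis using that[of j] 1 2 by simp
qed

text \<open>The value of y \<alpha> + \<beta> / y at its minimum over y > 0; it balances insertions
  against removals and produces the leading factor 2.\<close>

lemma optimal_scaling:
  fixes \<alpha> \<beta> :: real assumes "\<alpha> > 0" "\<beta> > 0"
  shows "sqrt (\<beta> / \<alpha>) * \<alpha> + \<beta> / sqrt (\<beta> / \<alpha>) = 2 * sqrt \<beta> * sqrt \<alpha>"
proof -
  have a: "sqrt \<alpha> * sqrt \<alpha> = \<alpha>" "sqrt \<beta> * sqrt \<beta> = \<beta>" using assms by auto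
  have pos: "sqrt \<alpha> \<noteq> 0" "sqrt \<beta> \<noteq> 0" using assms by auto
  have alg: "r / s * (s * s) = r * s" "r * r / (r / s) = r * s" if "r \<noteq> 0" "s \<noteq> 0" for r s :: real
    using that by simp_all
  have "sqrt (\<beta> / \<alpha>) * \<alpha> = sqrt \<beta> / sqrt \<alpha> * (sqrt \<alpha> * sqrt \<alpha>)" by (simp only: real_sqrt_divide a)
  also have "\<dots> = sqrt \<beta> * sqrt \<alpha>" by (rule alg(1)[OF pos(2,1)])
  finally have 1: "sqrt (\<beta> / \<alpha>) * \<alpha> = sqrt \<beta> * sqrt \<alpha>" .
  have "\<beta> / sqrt (\<beta> / \<alpha>) = (sqrt \<beta> * sqrt \<beta>) / (sqrt \<beta> / sqrt \<alpha>)" by (simp only: real_sqrt_divide a)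
  also have "\<dots> = sqrt \<beta> * sqrt \<alpha>" by (rule alg(2)[OF pos(2,1)])
  finally show ?thesis using 1 by simp
qed

lemma (in iid_matrix) offdiag_bound:
  fixes \<eta> :: real
  assumes \<eta>: "\<eta> > 0" and c: "2 / 2 ^ c \<le> \<eta>" and \<theta>: "\<bar>\<theta>\<bar> = 1" and n: "n \<ge> 3"
  obtains E where "E \<in> events" "prob E \<le> 1 / (real n)\<^sup>2"
    "\<And>\<omega>. \<omega> \<in> space M - E \<Longrightarrow> offdiag_good \<theta>
      (2 * (1 + \<eta>)\<^sup>2 * (sqrt (real n * v) + B * (2 ^ (c + 1) * (4 * (2 + 3 / ln (1 + \<eta>)) * ln (real n))))) \<omega>"
proof -
  define L where "L = ln (real n)"
  have "exp 1 \<le> real n" using n e_less_272 by linarith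
  then have L: "L \<ge> 1" unfolding L_def using n by (subst ln_ge_iff) auto
  have l\<eta>: "ln (1 + \<eta>) > 0" using \<eta> by simp
  \<comment> \<open>A length of at least 3 L / ln(1 + \<eta>) makes (1 + \<eta>)^a at least n^3,
    which outweighs the n diagonal entries of the trace and leaves n^(-2). The summand 2 meets the
    hypothesis of \<open>dyadic_between\<close>.\<close>
  define x where "x = 2 + 3 * L / ln (1 + \<eta>)"
  have x2: "x \<ge> 2" unfolding x_def using L l\<eta> by simp
  obtain j where j: "j \<ge> 1" "x \<le> 2 ^ j" "2 ^ j \<le> 2 * x" using dyadic_between[OF x2] by blast
  define a :: nat where "a = 2 * 2 ^ j"
  \<comment> \<open>Thus 2^q = 2^c a / 2: the discounted removals contribute a / 2^q = 2 / 2^c \<le>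
    \<eta>, and the penalty 2 a 2^q is 2^c a^2, of order log^2 n.\<close>
  define q where "q = j + c"
  define \<alpha> where "\<alpha> = real n * (v / B\<^sup>2) + real a + 2 * real a * 2 ^ q"
  define \<beta> where "\<beta> = 1 + real a / 2 ^ q"
  have n0: "n > 0" using n by simp
  have a_real: "real a = 2 * 2 ^ j" by (simp add: a_def)
  have vB: "0 \<le> v / B\<^sup>2" using var_le[OF n0] by simp
  have \<alpha>0: "\<alpha> > 0" 
  proof -
    have "0 \<le> real n * (v / B\<^sup>2)" using vB by (intro mult_nonneg_nonneg) auto
    moreover have "0 < real a" "0 \<le> 2 * real a * 2 ^ q" by (simp_all add: a_real)
    ultimately show ?thesis unfolding \<alpha>_def by linarith
  qed
  have \<beta>_eq: "\<beta> = 1 + 2 / 2 ^ c" unfolding \<beta>_def q_def a_real by (simp add: power_add)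
  have \<beta>0: "\<beta> > 0" "\<beta> \<le> 1 + \<eta>" unfolding \<beta>_eq using c by (auto intro: add_pos_pos)
  define y where "y = sqrt (\<beta> / \<alpha>)"
  have y: "y > 0" unfolding y_def using \<alpha>0 \<beta>0 by simp
  define \<Lambda> where "\<Lambda> = y * \<alpha> + \<beta> / y"
  have \<Lambda>: "\<Lambda> = 2 * sqrt \<beta> * sqrt \<alpha>" unfolding \<Lambda>_def y_def by (rule optimal_scaling[OF \<alpha>0 \<beta>0(1)])
  have \<Lambda>0: "\<Lambda> > 0" unfolding \<Lambda> using \<alpha>0 \<beta>0 by simp
  \<comment> \<open>Exceeding \<Lambda> by the factor 1 + \<eta> is unlikely because the moment of
    order a compares a-th powers.\<close>
  define T where "T = (1 + \<eta>) * \<Lambda>"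
  have T: "T > 0" unfolding T_def using \<Lambda>0 \<eta> by simp
  obtain E where E: "E \<in> events"
    "prob E \<le> real n * ((y * \<alpha> + \<beta> / y) / T) ^ a"
    "\<And>\<omega>. \<omega> \<in> space M - E \<Longrightarrow> offdiag_good \<theta> (B * T) \<omega>"
    by (rule offdiag_tail[OF \<theta> n0 j(1) y T a_def, of q, folded \<alpha>_def \<beta>_def]) (rule that)
  have "3 * L \<le> real a * ln (1 + \<eta>)"
  proof -
    have "3 * L / ln (1 + \<eta>) \<le> x" unfolding x_def by simp
    also have "\<dots> \<le> real a" using j(2) a_real by (simp add: order.trans[of x "2 ^ j"])
    finally show ?thesis using l\<eta> by (simp add: divide_le_eq)
  qed
  then have "exp (3 * L) \<le> exp (real a * ln (1 + \<eta>))" by simp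
  also have "\<dots> = (1 + \<eta>) ^ a" unfolding exp_of_nat_mult using \<eta> by simp
  finally have "exp (3 * L) \<le> (1 + \<eta>) ^ a" .
  moreover have "exp (3 * L) = real n ^ 3"
  proof -
    have "exp (3 * L) = exp (real 3 * L)" by simp
    also have "\<dots> = exp L ^ 3" by (rule exp_of_nat_mult)
    finally show ?thesis using n by (simp add: L_def)
  qed
  ultimately have pw: "real n ^ 3 \<le> (1 + \<eta>) ^ a" by simp
  have "\<Lambda> / T = 1 / (1 + \<eta>)" unfolding T_def using \<Lambda>0 by simp
  then have "prob E \<le> real n / (1 + \<eta>) ^ a" using E(2)[folded \<Lambda>_def] by (simp add: power_divide)
  also have "\<dots> \<le> real n / real n ^ 3" using pw n \<eta> by (intro divide_left_mono) auto
  also have "\<dots> = 1 / (real n)\<^sup>2" using n by (simp add: power3_eq_cube power2_eq_square)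
  finally have pE: "prob E \<le> 1 / (real n)\<^sup>2" .
  have a_le: "real a \<le> 4 * (2 + 3 / ln (1 + \<eta>)) * L"
  proof -
    have "real a \<le> 4 * x" using j(3) a_real by simp
    also have "x \<le> 2 * L + 3 * L / ln (1 + \<eta>)" unfolding x_def using L by simp
    finally show ?thesis by (simp add: algebra_simps)
  qed
  have "sqrt \<beta> \<le> sqrt ((1 + \<eta>)\<^sup>2)" 
  proof (rule real_sqrt_le_mono)
    have "1 + \<eta> \<le> (1 + \<eta>)\<^sup>2" using \<eta> by (intro self_le_power) auto
    then show "\<beta> \<le> (1 + \<eta>)\<^sup>2" using \<beta>0 by linarith
  qed
  then have sb: "sqrt \<beta> \<le> 1 + \<eta>" using \<eta> by simp
  have sa: "B * sqrt \<alpha> \<le> sqrt (real n * v) + B * (2 ^ (c + 1) * real a)"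
  proof -
    \<comment> \<open>Undoing the normalisation by B separates the leading n v from a term of order
      a^2; subadditivity of the square root then leaves an additive O(log n).\<close>
    have "B\<^sup>2 * \<alpha> = real n * v + B\<^sup>2 * (real a + 2 ^ c * (real a)\<^sup>2)"
      unfolding \<alpha>_def q_def a_real using B by (simp add: algebra_simps power_add power2_eq_square)
    also have "\<dots> \<le> real n * v + B\<^sup>2 * (2 ^ (c + 1) * real a)\<^sup>2"
    proof -
      have "1 \<le> real a" using a_real one_le_power[of "2::real" j] by linarith
      then have "real a \<le> (real a)\<^sup>2" by (intro self_le_power) auto
      moreover have "(1::real) \<le> 2 ^ c" by simp
      then have "(real a)\<^sup>2 \<le> 2 ^ c * (real a)\<^sup>2" by (simp add: mult_le_cancel_right1)
      moreover have "2 ^ (c + 1) * (real a)\<^sup>2 = 2 * (2 ^ c * (real a)\<^sup>2)" by simp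
      ultimately have "real a + 2 ^ c * (real a)\<^sup>2 \<le> 2 ^ (c + 1) * (real a)\<^sup>2" by linarith
      also have "\<dots> \<le> (2 ^ (c + 1))\<^sup>2 * (real a)\<^sup>2"
        by (intro mult_right_mono self_le_power one_le_power) auto
      also have "\<dots> = (2 ^ (c + 1) * real a)\<^sup>2" by (simp only: power_mult_distrib)
      finally show ?thesis by (intro add_left_mono mult_left_mono) auto
    qed
    finally have "sqrt (B\<^sup>2 * \<alpha>) \<le> sqrt (real n * v + (B * (2 ^ (c + 1) * real a))\<^sup>2)"
      by (simp add: power_mult_distrib)
    also have "\<dots> \<le> sqrt (real n * v) + sqrt ((B * (2 ^ (c + 1) * real a))\<^sup>2)"
      using var_le[OF n0] by (intro sqrt_add_le_add_sqrt) auto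
    finally show ?thesis using B by (simp add: real_sqrt_mult)
  qed
  have "B * T = 2 * (1 + \<eta>) * sqrt \<beta> * (B * sqrt \<alpha>)" unfolding T_def \<Lambda> by simp
  also have "\<dots> \<le> 2 * (1 + \<eta>) * (1 + \<eta>) * (sqrt (real n * v) + B * (2 ^ (c + 1) * (4 * (2 + 3 / ln (1 + \<eta>)) * L)))"
  proof (intro mult_mono)
    have "B * (2 ^ (c + 1) * real a) \<le> B * (2 ^ (c + 1) * (4 * (2 + 3 / ln (1 + \<eta>)) * L))"
      using a_le B by (intro mult_left_mono) auto
    then show "B * sqrt \<alpha> \<le> sqrt (real n * v) + B * (2 ^ (c + 1) * (4 * (2 + 3 / ln (1 + \<eta>)) * L))"
      using sa by linarith
  qed (use sb \<eta> B \<alpha>0 \<beta>0 in auto)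
  finally have "B * T \<le> 2 * (1 + \<eta>)\<^sup>2 * (sqrt (real n * v) + B * (2 ^ (c + 1) * (4 * (2 + 3 / ln (1 + \<eta>)) * ln (real n))))"
    unfolding L_def by (simp only: power2_eq_square mult.assoc)
  then have "offdiag_good \<theta> (2 * (1 + \<eta>)\<^sup>2 * (sqrt (real n * v) + B * (2 ^ (c + 1) * (4 * (2 + 3 / ln (1 + \<eta>)) * ln (real n))))) \<omega>"
    if "\<omega> \<in> space M - E" for \<omega>
    using E(3)[OF that] unfolding offdiag_good_def by (meson order.trans)
  with E(1) pE show ?thesis by (rule that)
qed

text \<open>The assumption \<open>small\<close> says that the Bernstein correction exp(l B) is close
  to 1. Its tolerance is chosen so that (2 + \<eta>)^2 / 2 times the correction is at most (2 +
  \<eta>)(1 + \<eta>), which leaves the exponent -(2 + \<eta>) log n for each row.\<close>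

lemma (in iid_matrix) row_sum_bound:
  fixes \<eta> :: real
  assumes \<eta>: "\<eta> > 0" and n: "n \<ge> 3" and v: "v > 0"
    and small: "exp ((2 + \<eta>) * sqrt (ln (real n) / (real n * v)) * B) \<le> 1 + \<eta> / (2 + \<eta>)"
  obtains E where "E \<in> events" "prob E \<le> 2 * real n powr (- 1 - \<eta>)"
    "\<And>\<omega> u. \<omega> \<in> space M - E \<Longrightarrow> u < n \<Longrightarrow>
      \<bar>\<Sum>k<n. (X u k \<omega> - m)\<bar> < (2 + \<eta>) * sqrt (real n * v * ln (real n))"
proof -
  define L where "L = ln (real n)"
  have L: "L > 0" unfolding L_def using n by simp
  \<comment> \<open>This is t / (n v), the optimal exponent for a Gaussian variable of variance n
    v.\<close>
  define l where "l = (2 + \<eta>) * sqrt (L / (real n * v))"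
  define t where "t = (2 + \<eta>) * sqrt (real n * v * L)"
  have nv: "real n * v > 0" using n v by simp
  have l: "l > 0" unfolding l_def using L nv \<eta> by simp
  have lt: "l * t = (2 + \<eta>)\<^sup>2 * L"
  proof -
    have "L / (real n * v) * (real n * v * L) = L\<^sup>2" using n v by (simp add: power2_eq_square)
    then have "sqrt (L / (real n * v)) * sqrt (real n * v * L) = sqrt (L\<^sup>2)"
      by (simp only: real_sqrt_mult[symmetric])
    then show ?thesis unfolding l_def t_def using L by (simp add: power2_eq_square algebra_simps)
  qed
  have l2: "real n * (l\<^sup>2 * v / 2) = (2 + \<eta>)\<^sup>2 * L / 2"
    unfolding l_def power_mult_distrib using n v L by (simp add: field_simps)
  have n0: "n > 0" using n by simp
  obtain E where E: "E \<in> events"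
    "prob E \<le> real n * (2 * exp (- l * t + real n * (l\<^sup>2 * v / 2 * exp (l * B))))"
    "\<And>\<omega> u. \<omega> \<in> space M - E \<Longrightarrow> u < n \<Longrightarrow> \<bar>\<Sum>k<n. (X u k \<omega> - m)\<bar> < t"
    by (rule row_sum_tail[OF n0 l, of t]) (rule that)
  have "real n * (l\<^sup>2 * v / 2 * exp (l * B)) = (2 + \<eta>)\<^sup>2 * L / 2 * exp (l * B)"
    unfolding l2[symmetric] by simp
  also have "\<dots> \<le> (2 + \<eta>)\<^sup>2 * L / 2 * (1 + \<eta> / (2 + \<eta>))"
    using small L unfolding l_def L_def by (intro mult_left_mono) auto
  also have "\<dots> = (2 + \<eta>) * (1 + \<eta>) * L"
    using \<eta> by (simp add: field_simps power2_eq_square)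
  finally have "- l * t + real n * (l\<^sup>2 * v / 2 * exp (l * B)) \<le> - (2 + \<eta>)\<^sup>2 * L + (2 + \<eta>) * (1 + \<eta>) * L"
    using lt by simp
  also have "\<dots> = - (2 + \<eta>) * L" by (simp add: power2_eq_square algebra_simps)
  finally have "prob E \<le> real n * (2 * exp (- (2 + \<eta>) * L))"
    using E(2) by (elim order.trans) (intro mult_left_mono, auto)
  also have "\<dots> = 2 * real n powr (- 1 - \<eta>)"
  proof -
    have "exp (- (2 + \<eta>) * L) = real n powr (- (2 + \<eta>))" using n by (simp add: powr_def L_def)
    moreover have "real n * real n powr (- (2 + \<eta>)) = real n powr (- 1 - \<eta>)"
      using n powr_add[of "real n" 1 "- (2 + \<eta>)"] by simp
    ultimately show ?thesis by simp
  qed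
  finally show ?thesis using E(1,3) that[of E] unfolding t_def L_def by simp
qed

subsection \<open>Eigenvalues of the Laplacian\<close>

lemma dim_random_laplacian: "random_laplacian n X \<omega> \<in> carrier_mat n n"
  by (simp add: random_laplacian_def sample_matrix_def row_sum_diag_def minus_carrier_mat)

lemma dim_centered_laplacian: "centered_laplacian M n X \<omega> \<in> carrier_mat n n"
  by (simp add: centered_laplacian_def mean_matrix_def minus_carrier_mat)

lemma random_laplacian_index:
  assumes "u < n" "x < n"
  shows "random_laplacian n X \<omega> $$ (u, x) = X u x \<omega> - (if u = x then \<Sum>k<n. X u k \<omega> else 0)"
  using assms by (simp add: random_laplacian_def sample_matrix_def row_sum_diag_def)

lemma random_laplacian_cong:
  assumes "\<And>u x. u < n \<Longrightarrow> x < n \<Longrightarrow> X u x \<omega> = Y u x \<omega>"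
  shows "random_laplacian n X \<omega> = random_laplacian n Y \<omega>"
proof (rule eq_matI)
  fix i j assume "i < dim_row (random_laplacian n Y \<omega>)" "j < dim_col (random_laplacian n Y \<omega>)"
  then have ij: "i < n" "j < n" using dim_random_laplacian[of n Y \<omega>] by auto
  then show "random_laplacian n X \<omega> $$ (i, j) = random_laplacian n Y \<omega> $$ (i, j)"
    using assms by (simp add: random_laplacian_index)
qed (use dim_random_laplacian[of n X \<omega>] dim_random_laplacian[of n Y \<omega>] in auto)

lemma random_laplacian_row_sum:
  assumes "u < n" shows "(\<Sum>x<n. random_laplacian n X \<omega> $$ (u, x)) = 0"
proof -
  have "(\<Sum>x<n. random_laplacian n X \<omega> $$ (u, x))
      = (\<Sum>x<n. X u x \<omega>) - (\<Sum>x<n. if x = u then \<Sum>k<n. X u k \<omega> else 0)"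
    using assms by (simp add: random_laplacian_index sum_subtractf eq_commute cong: if_cong)
  then show ?thesis using assms by simp
qed

lemma offdiag_part_transpose: "offdiag_part \<theta> (\<lambda>u x. A x u) u x = offdiag_part \<theta> A x u"
  by (simp add: offdiag_part_def)

context iid_matrix
begin

lemma mean_laplacian_index:
  assumes "u < n" "x < n"
  shows "mean_matrix M n (random_laplacian n X) $$ (u, x) = m - (if u = x then real n * m else 0)"
proof -
  have "mean_matrix M n (random_laplacian n X) $$ (u, x)
      = expectation (\<lambda>\<omega>. X u x \<omega> - (if u = x then \<Sum>k<n. X u k \<omega> else 0))"
    using assms by (simp add: mean_matrix_def random_laplacian_index)
  also have "\<dots> = m - (if u = x then real n * m else 0)"
  proof (cases "u = x")
    case True
    have row: "integrable M (X u k)" "expectation (X u k) = m" if "k \<in> {..<n}" for k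
      using that assms(1) integrable_X mean by auto
    have "expectation (\<lambda>\<omega>. \<Sum>k<n. X u k \<omega>) = (\<Sum>k<n. expectation (X u k))"
      by (intro Bochner_Integration.integral_sum row)
    also have "\<dots> = real n * m" by (simp add: row(2))
    finally have "expectation (\<lambda>\<omega>. \<Sum>k<n. X u k \<omega>) = real n * m" .
    moreover have "expectation (\<lambda>\<omega>. X u x \<omega> - (\<Sum>k<n. X u k \<omega>))
        = expectation (X u x) - expectation (\<lambda>\<omega>. \<Sum>k<n. X u k \<omega>)"
      by (intro Bochner_Integration.integral_diff Bochner_Integration.integrable_sum integrable_X row assms)
    ultimately show ?thesis using True mean[OF assms] by simp
  qed (use mean[OF assms] in simp)
  finally show ?thesis .
qed

lemma centered_laplacian_index:
  assumes "u < n" "x < n"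
  shows "centered_laplacian M n X \<omega> $$ (u, x)
    = random_laplacian n X \<omega> $$ (u, x) - (m - (if u = x then real n * m else 0))"
  using assms mean_laplacian_index[OF assms]
  by (simp add: centered_laplacian_def mean_matrix_def)

lemma eigenvalue_bounds:
  assumes \<omega>: "\<omega> \<in> space M" and good: "offdiag_good 1 S \<omega>" "offdiag_good (- 1) S \<omega>"
    and rows: "\<And>u. u < n \<Longrightarrow> \<bar>\<Sum>k<n. (X u k \<omega> - m)\<bar> < t"
  shows "complex_eigenvalue (centered_laplacian M n X \<omega>) z \<Longrightarrow> \<bar>Re z\<bar> \<le> S + (B + t) \<and> \<bar>Im z\<bar> \<le> S"
    and "complex_eigenvalue (random_laplacian n X \<omega>) z \<Longrightarrow> z \<noteq> 0 \<Longrightarrow>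
      \<bar>Re z + m * real n\<bar> \<le> S + (B + t) \<and> \<bar>Im z\<bar> \<le> S"
proof -
  define A where "A u x = centered_laplacian M n X \<omega> $$ (u, x)" for u x
  have A_eq: "(\<lambda>u x. centered_laplacian M n X \<omega> $$ (u, x)) = A"
    "(\<lambda>u x. centered_laplacian M n X \<omega> $$ (x, u)) = (\<lambda>u x. A x u)"
    by (simp_all add: A_def fun_eq_iff)
  have off: "A u x = X u x \<omega> - m" if "u < n" "x < n" "u \<noteq> x" for u x
    using that by (simp add: A_def centered_laplacian_index random_laplacian_index)
  have diag: "\<bar>A u u\<bar> \<le> B + t" if u: "u < n" for u
  proof -
    \<comment> \<open>The entry X u u contributes only a bounded term, later absorbed in the error;
      the centred row sum is the dominant part.\<close>
    have "A u u = (X u u \<omega> - m) - (\<Sum>k<n. (X u k \<omega> - m))"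
      using u by (simp add: A_def centered_laplacian_index random_laplacian_index sum_subtractf)
    then show ?thesis using abs_centered_le[OF u u \<omega>] rows[OF u] by linarith
  qed
  have qf: "norm (quad_form n (offdiag_part \<theta> A) w) \<le> S" if "\<theta> = 1 \<or> \<theta> = - 1" "vnorm n w = 1" for \<theta> w
    using good off that unfolding offdiag_good_def by blast
  \<comment> \<open>Nonzero eigenvalues of the Laplacian are reached through left eigenvectors,
    hence through the transposed matrix, whose forms are the complex conjugates.\<close>
  have qf_t: "norm (quad_form n (offdiag_part \<theta> (\<lambda>u x. A x u)) w) \<le> S" if "\<theta> = 1 \<or> \<theta> = - 1" "vnorm n w = 1" for \<theta> w
  proof -
    have "quad_form n (offdiag_part \<theta> (\<lambda>u x. A x u)) w = cnj (quad_form n (offdiag_part \<theta> A) w)"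
      unfolding cnj_quad_form by (rule quad_form_cong) (rule offdiag_part_transpose)
    then show ?thesis using qf[OF that] by simp
  qed
  show "\<bar>Re z\<bar> \<le> S + (B + t) \<and> \<bar>Im z\<bar> \<le> S" if ev: "complex_eigenvalue (centered_laplacian M n X \<omega>) z"
  proof -
    obtain v u\<^sub>0 where v: "u\<^sub>0 < n" "v u\<^sub>0 \<noteq> 0" "\<And>u. u < n \<Longrightarrow> mat_act n A v u = z * v u"
      by (rule complex_eigenvalue_equation[OF dim_centered_laplacian ev, unfolded A_eq]) (rule that)
    obtain w where w: "vnorm n w = 1" "z = quad_form n A w"
      by (rule eigen_equation_quad_form[OF v(3,1,2)]) (assumption | rule that)+
    show ?thesis unfolding w(2)
      using numerical_range_bound[OF w(1) qf[OF _ w(1)] qf[OF _ w(1)] diag] by simp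
  qed
  show "\<bar>Re z + m * real n\<bar> \<le> S + (B + t) \<and> \<bar>Im z\<bar> \<le> S"
    if ev: "complex_eigenvalue (random_laplacian n X \<omega>) z" and z: "z \<noteq> 0"
  proof -
    obtain v u\<^sub>0 where v: "u\<^sub>0 < n" "v u\<^sub>0 \<noteq> 0"
      "\<And>u. u < n \<Longrightarrow> mat_act n (\<lambda>u x. A x u) v u = (z + of_real (real n * m)) * v u"
      by (rule eigenvalue_shift[OF dim_random_laplacian dim_centered_laplacian
            random_laplacian_row_sum centered_laplacian_index ev z, unfolded A_eq]) (assumption | rule that)+
    obtain w where w: "vnorm n w = 1" "z + of_real (real n * m) = quad_form n (\<lambda>u x. A x u) w"
      by (rule eigen_equation_quad_form[OF v(3,1,2)]) (assumption | rule that)+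
    have "\<bar>Re (z + of_real (real n * m))\<bar> \<le> S + (B + t)" "\<bar>Im (z + of_real (real n * m))\<bar> \<le> S"
      unfolding w(2)
      using numerical_range_bound[OF w(1) qf_t[OF _ w(1)] qf_t[OF _ w(1)] diag] by simp_all
    then show ?thesis by (simp add: mult.commute)
  qed
qed

end

text \<open>Produces the o(1) from bounds for each fixed tolerance by a diagonal choice: the index
  used at n is the largest one already valid, and so it tends to infinity, possibly very
  slowly.\<close>

lemma eventually_choose_null_sequence:
  fixes Q :: "real \<Rightarrow> nat \<Rightarrow> bool"
  assumes "\<And>k. eventually (Q (1 / real (Suc k))) sequentially"
  obtains \<epsilon> where "\<epsilon> \<longlonglongrightarrow> 0" "eventually (\<lambda>n. Q (\<epsilon> n) n) sequentially"
proof -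
  \<comment> \<open>The restriction k \<le> n keeps the set finite, and admitting k = 0
    unconditionally keeps it nonempty. This default may be wrong for small n, but \<open>Q 1\<close>
    holds eventually.\<close>
  define S where "S n = {k. k \<le> n \<and> (k = 0 \<or> Q (1 / real (Suc k)) n)}" for n
  define g where "g n = Max (S n)" for n
  have fin: "finite (S n)" for n unfolding S_def by simp
  have ne: "0 \<in> S n" for n unfolding S_def by simp
  have gS: "g n \<in> S n" for n unfolding g_def using fin ne by (intro Max_in) auto
  have "eventually (\<lambda>n. Q (1 / real (Suc (g n))) n) sequentially"
    using assms[of 0]
  proof eventually_elim
    case (elim n)
    then show ?case using gS[of n] by (auto simp: S_def)
  qed
  moreover have "filterlim g at_top sequentially"
    unfolding filterlim_at_top
  proof
    fix K
    show "eventually (\<lambda>n. K \<le> g n) sequentially"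
      using assms[of K] eventually_ge_at_top[of K]
    proof eventually_elim
      case (elim n)
      then have "K \<in> S n" by (simp add: S_def)
      then show ?case unfolding g_def using fin by (intro Max_ge)
    qed
  qed
  then have "(\<lambda>n. 1 / real (Suc (g n))) \<longlonglongrightarrow> 0"
    using filterlim_compose[OF LIMSEQ_Suc[OF lim_1_over_n]] by (simp add: o_def)
  ultimately show ?thesis using that[of "\<lambda>n. 1 / real (Suc (g n))"] by blast
qed

section \<open>Borel-Cantelli and the lower order terms\<close>

definition spectrum_within ::
  "'a measure \<Rightarrow> nat \<Rightarrow> (nat \<Rightarrow> nat \<Rightarrow> 'a \<Rightarrow> real) \<Rightarrow> real \<Rightarrow> 'a \<Rightarrow> real \<Rightarrow> real \<Rightarrow> bool" where
  "spectrum_within M n X m \<omega> R I \<longleftrightarrow>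
    (\<forall>z. complex_eigenvalue (centered_laplacian M n X \<omega>) z \<longrightarrow> \<bar>Re z\<bar> \<le> R \<and> \<bar>Im z\<bar> \<le> I) \<and>
    (\<forall>z. complex_eigenvalue (random_laplacian n X \<omega>) z \<and> z \<noteq> 0 \<longrightarrow>
      \<bar>Re z + m * real n\<bar> \<le> R \<and> \<bar>Im z\<bar> \<le> I)"

lemma spectrum_within_mono:
  assumes "spectrum_within M n X m \<omega> R I" "R \<le> R'" "I \<le> I'"
  shows "spectrum_within M n X m \<omega> R' I'"
  using assms unfolding spectrum_within_def by (meson order.trans)

lemma (in iid_matrix) spectrum_within_event:
  fixes \<eta> :: real and c :: nat
  defines "S \<equiv> 2 * (1 + \<eta>)\<^sup>2 * (sqrt (real n * v) + B * (2 ^ (c + 1) * (4 * (2 + 3 / ln (1 + \<eta>)) * ln (real n))))"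
  assumes \<eta>: "\<eta> > 0" and c: "2 / 2 ^ c \<le> \<eta>" and n: "n \<ge> 3" and v: "v > 0"
    and small: "exp ((2 + \<eta>) * sqrt (ln (real n) / (real n * v)) * B) \<le> 1 + \<eta> / (2 + \<eta>)"
  shows "\<exists>E\<in>events. prob E \<le> 2 / (real n)\<^sup>2 + 2 * real n powr (- 1 - \<eta>) \<and>
    (\<forall>\<omega>\<in>space M - E. spectrum_within M n X m \<omega> (S + (B + (2 + \<eta>) * sqrt (real n * v * ln (real n)))) S)"
proof -
  obtain E1 where E1: "E1 \<in> events" "prob E1 \<le> 1 / (real n)\<^sup>2"
    "\<And>\<omega>. \<omega> \<in> space M - E1 \<Longrightarrow> offdiag_good 1 S \<omega>"
    by (rule offdiag_bound[OF \<eta> c _ n, of 1, folded S_def]) (simp, rule that)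
  obtain E2 where E2: "E2 \<in> events" "prob E2 \<le> 1 / (real n)\<^sup>2"
    "\<And>\<omega>. \<omega> \<in> space M - E2 \<Longrightarrow> offdiag_good (- 1) S \<omega>"
    by (rule offdiag_bound[OF \<eta> c _ n, of "- 1", folded S_def]) (simp, rule that)
  obtain E3 where E3: "E3 \<in> events" "prob E3 \<le> 2 * real n powr (- 1 - \<eta>)"
    "\<And>\<omega> u. \<omega> \<in> space M - E3 \<Longrightarrow> u < n \<Longrightarrow>
      \<bar>\<Sum>k<n. (X u k \<omega> - m)\<bar> < (2 + \<eta>) * sqrt (real n * v * ln (real n))"
    by (rule row_sum_bound[OF \<eta> n v small]) (rule that)
  have "prob (E1 \<union> E2 \<union> E3) \<le> prob (E1 \<union> E2) + prob E3"
    using E1(1) E2(1) E3(1) by (intro measure_Un_le) auto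
  also have "prob (E1 \<union> E2) \<le> prob E1 + prob E2"
    using E1(1) E2(1) by (intro measure_Un_le)
  finally have "prob (E1 \<union> E2 \<union> E3) \<le> 2 / (real n)\<^sup>2 + 2 * real n powr (- 1 - \<eta>)"
    using E1(2) E2(2) E3(2) by simp
  moreover have "spectrum_within M n X m \<omega> (S + (B + (2 + \<eta>) * sqrt (real n * v * ln (real n)))) S"
    if "\<omega> \<in> space M - (E1 \<union> E2 \<union> E3)" for \<omega>
  proof -
    have \<omega>: "\<omega> \<in> space M" and good: "offdiag_good 1 S \<omega>" "offdiag_good (- 1) S \<omega>"
      and rows: "\<And>u. u < n \<Longrightarrow> \<bar>\<Sum>k<n. (X u k \<omega> - m)\<bar> < (2 + \<eta>) * sqrt (real n * v * ln (real n))"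
      using that E1(3) E2(3) E3(3) by auto
    show ?thesis
      unfolding spectrum_within_def using eigenvalue_bounds[OF \<omega> good rows] by blast
  qed
  moreover have "E1 \<union> E2 \<union> E3 \<in> events" using E1(1) E2(1) E3(1) by auto
  ultimately show ?thesis by blast
qed

text \<open>For a fixed tolerance the exceptional probabilities n^(-2) and n^(-1-\<eta>) are
  summable, so Borel-Cantelli applies whatever the joint law across sizes. The error term can have
  coefficient one, since every constant multiple of log n is eventually below it.\<close>

lemma (in prob_space) AE_eventually_spectrum_within:
  fixes X :: "nat \<Rightarrow> nat \<Rightarrow> nat \<Rightarrow> 'a \<Rightarrow> real" and m \<sigma> :: "nat \<Rightarrow> real" and B e :: real
  assumes iid: "\<And>n. n \<ge> 1 \<Longrightarrow> iid_matrix M n (X n) B (m n) ((\<sigma> n)\<^sup>2)"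
    and \<sigma>: "\<And>n. n \<ge> 1 \<Longrightarrow> \<sigma> n > 0"
    and growth: "filterlim (\<lambda>n. real n * (\<sigma> n)\<^sup>2 / ln (real n)) at_top sequentially"
    and e: "e > 0"
  shows "AE \<omega> in M. eventually (\<lambda>n. spectrum_within M n (X n) (m n) \<omega>
      ((2 + e) * \<sigma> n * sqrt (real n * ln (real n)) + \<sigma> n powr (1/2) * real n powr (1/4) * ln (real n))
      ((2 + e) * \<sigma> n * sqrt (real n) + \<sigma> n powr (1/2) * real n powr (1/4) * ln (real n))) sequentially"
proof -
  interpret I1: iid_matrix M 1 "X 1" B "m 1" "(\<sigma> 1)\<^sup>2" by (rule iid) simp
  have B: "B > 0" by (rule I1.B)
  \<comment> \<open>With \<eta> \<le> 1 one has 2 (1 + \<eta>)^2 \<le> 2 + 6 \<eta> \<le> 2 +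
    e.\<close>
  define \<eta> where "\<eta> = min 1 (e / 6)"
  have \<eta>: "\<eta> > 0" "\<eta> \<le> 1" "6 * \<eta> \<le> e" unfolding \<eta>_def using e by auto
  obtain c :: nat where c: "2 / 2 ^ c \<le> \<eta>"
  proof -
    obtain c :: nat where "2 / \<eta> < 2 ^ c" using real_arch_pow[of 2 "2 / \<eta>"] by auto
    then have "2 / 2 ^ c \<le> \<eta>" using \<eta>(1) by (simp add: field_simps)
    then show ?thesis by (rule that)
  qed
  define S where "S n = 2 * (1 + \<eta>)\<^sup>2 * (sqrt (real n * (\<sigma> n)\<^sup>2) +
      B * (2 ^ (c + 1) * (4 * (2 + 3 / ln (1 + \<eta>)) * ln (real n))))" for n
  define R where "R n = S n + (B + (2 + \<eta>) * sqrt (real n * (\<sigma> n)\<^sup>2 * ln (real n)))" for n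
  define bad where "bad n E \<longleftrightarrow> E \<in> events \<and> prob E \<le> 2 / (real n)\<^sup>2 + 2 * real n powr (- 1 - \<eta>) \<and>
    (\<forall>\<omega>\<in>space M - E. spectrum_within M n (X n) (m n) \<omega> (R n) (S n))" for n E
  have ge3: "eventually (\<lambda>n. 3 \<le> n) sequentially" by (rule eventually_ge_at_top)
  have ln_ge: "1 \<le> ln (real n)" if "3 \<le> n" for n
  proof -
    have "exp 1 \<le> real n" using that e_less_272 by linarith
    then show ?thesis using that by (subst ln_ge_iff) auto
  qed
  have "((\<lambda>n. inverse (real n * (\<sigma> n)\<^sup>2 / ln (real n))) \<longlongrightarrow> 0) sequentially"
    by (rule tendsto_inverse_0_at_top[OF growth])
  then have "((\<lambda>n. ln (real n) / (real n * (\<sigma> n)\<^sup>2)) \<longlongrightarrow> 0) sequentially" by simp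
  then have "((\<lambda>n. exp ((2 + \<eta>) * sqrt (ln (real n) / (real n * (\<sigma> n)\<^sup>2)) * B)) \<longlongrightarrow> exp ((2 + \<eta>) * sqrt 0 * B)) sequentially"
    by (intro tendsto_intros)
  moreover have "exp ((2 + \<eta>) * sqrt 0 * B) < 1 + \<eta> / (2 + \<eta>)" using \<eta> by simp
  ultimately have small: "eventually (\<lambda>n. exp ((2 + \<eta>) * sqrt (ln (real n) / (real n * (\<sigma> n)\<^sup>2)) * B) < 1 + \<eta> / (2 + \<eta>)) sequentially"
    by (rule order_tendstoD(2))
  have "eventually (\<lambda>n. \<exists>E. bad n E) sequentially"
    using small ge3
  proof eventually_elim
    case (elim n)
    interpret In: iid_matrix M n "X n" B "m n" "(\<sigma> n)\<^sup>2" by (rule iid) (use elim in simp)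
    have "\<sigma> n > 0" using \<sigma> elim by simp
    then show ?case
      using In.spectrum_within_event[OF \<eta>(1) c elim(2) _ less_imp_le[OF elim(1)]]
      unfolding bad_def R_def S_def by auto
  qed
  then obtain N where N: "\<And>n. n \<ge> N \<Longrightarrow> \<exists>E. bad n E" unfolding eventually_sequentially by blast
  \<comment> \<open>Below N no exceptional event is available; the empty set keeps the sequence
    measurable and leaves its tail unchanged.\<close>
  define E where "E n = (if n \<ge> N then SOME E. bad n E else {})" for n
  have bad: "bad n (E n)" if "n \<ge> N" for n
    using N[OF that] that unfolding E_def by (simp add: someI_ex)
  have E_ev: "E n \<in> events" for n
    using bad[of n] by (cases "n \<ge> N") (auto simp: bad_def E_def)
  have "summable (\<lambda>n. 2 / (real n)\<^sup>2 + 2 * real n powr (- 1 - \<eta>))"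
  proof (rule summable_add)
    have "summable (\<lambda>n. 2 * inverse (real n ^ 2))" by (intro summable_mult inverse_power_summable) simp
    then show "summable (\<lambda>n. 2 / (real n)\<^sup>2)" by (simp add: field_simps)
    show "summable (\<lambda>n. 2 * real n powr (- 1 - \<eta>))"
      using \<eta> by (intro summable_mult) (simp add: summable_real_powr_iff)
  qed
  then have "summable (\<lambda>n. prob (E n))"
    by (rule summable_comparison_test_ev[rotated])
      (use bad in \<open>auto simp: bad_def eventually_sequentially intro!: exI[of _ N]\<close>)
  then have io: "AE \<omega> in M. eventually (\<lambda>n. \<omega> \<in> space M - E n) sequentially"
    using E_ev by (intro borel_cantelli_AE1) (simp_all add: less_top[symmetric])
  have limits: "eventually (\<lambda>n. S n \<le> (2 + e) * \<sigma> n * sqrt (real n) + \<sigma> n powr (1/2) * real n powr (1/4) * ln (real n) \<and>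
      R n \<le> (2 + e) * \<sigma> n * sqrt (real n * ln (real n)) + \<sigma> n powr (1/2) * real n powr (1/4) * ln (real n)) sequentially"
  proof -
    define K where "K = 2 * (1 + \<eta>)\<^sup>2 * (B * (2 ^ (c + 1) * (4 * (2 + 3 / ln (1 + \<eta>)))))"
    have K: "K \<ge> 0" unfolding K_def using B \<eta> by simp
    have sq: "2 * (1 + \<eta>)\<^sup>2 \<le> 2 + e"
    proof -
      have "\<eta>\<^sup>2 \<le> \<eta>" using \<eta> by (simp add: power2_eq_square mult_le_cancel_left2)
      moreover have "2 * (1 + \<eta>)\<^sup>2 = 2 + 4 * \<eta> + 2 * \<eta>\<^sup>2" by (simp add: power2_eq_square algebra_simps)
      ultimately show ?thesis using \<eta> by linarith
    qed
    \<comment> \<open>As log n \<ge> 1, the fourth root gives K + B \<le> \<sigma>^(1/2) n^(1/4),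
      which after multiplication by log n absorbs K log n + B into the error term.\<close>
    have "eventually (\<lambda>n. (K + B) ^ 4 \<le> real n * (\<sigma> n)\<^sup>2 / ln (real n)) sequentially"
      using growth by (simp add: filterlim_at_top)
    moreover have "filterlim (\<lambda>n. ln (real n)) at_top sequentially"
      by (rule filterlim_compose[OF ln_at_top filterlim_real_sequentially])
    \<comment> \<open>Makes the norm term (2 + e) \<sigma> sqrt n at most e/2 times \<sigma> sqrt(n
      log n). In the real part it uses half of the tolerance e, and the row sums use the other
      half.\<close>
    then have "eventually (\<lambda>n. (2 * (2 + e) / e)\<^sup>2 \<le> ln (real n)) sequentially"
      by (simp add: filterlim_at_top)
    ultimately show ?thesis
      using ge3
    proof eventually_elim
      case (elim n)
      define L where "L = ln (real n)"
      have L: "L \<ge> 1" unfolding L_def using ln_ge elim by simp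
      have \<sigma>n: "\<sigma> n > 0" using \<sigma> elim by simp
      define r where "r = \<sigma> n * sqrt (real n)"
      have r: "r \<ge> 0" unfolding r_def using \<sigma>n by simp
      define W where "W = \<sigma> n powr (1/2) * real n powr (1/4) * L"
      have sqrt_eq: "sqrt (real n * (\<sigma> n)\<^sup>2) = r"
        unfolding r_def using \<sigma>n by (simp add: real_sqrt_mult)
      have sqrt_eq2: "sqrt (real n * (\<sigma> n)\<^sup>2 * L) = r * sqrt L"
        using sqrt_eq by (simp add: real_sqrt_mult)
      have sqrt_eq3: "(2 + e) * \<sigma> n * sqrt (real n * L) = (2 + e) * (r * sqrt L)"
        unfolding r_def by (simp add: real_sqrt_mult)
      have W: "(K + B) * L \<le> W"
      proof -
        have "(K + B) ^ 4 \<le> (K + B) ^ 4 * L" using L K B by (simp add: mult_le_cancel_left1)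
        also have "\<dots> \<le> real n * (\<sigma> n)\<^sup>2"
          using elim(1) L unfolding L_def[symmetric] by (simp add: le_divide_eq)
        finally have "(K + B) ^ 4 \<le> real n * (\<sigma> n)\<^sup>2" .
        then have "((K + B) ^ 4) powr (1/4) \<le> (real n * (\<sigma> n)\<^sup>2) powr (1/4)"
          using K B by (intro powr_mono2) auto
        moreover have "((K + B) ^ 4) powr (1/4) = K + B"
        proof -
          have "(K + B) ^ 4 = (K + B) powr 4" using K B by (subst powr_numeral) auto
          then show ?thesis using K B by (simp only: powr_powr) simp
        qed
        moreover have "(real n * (\<sigma> n)\<^sup>2) powr (1/4) = \<sigma> n powr (1/2) * real n powr (1/4)"
        proof -
          have "(\<sigma> n)\<^sup>2 = \<sigma> n powr 2" using \<sigma>n by (subst powr_numeral) auto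
          then have "((\<sigma> n)\<^sup>2) powr (1/4) = \<sigma> n powr (1/2)" by (simp only: powr_powr) simp
          then show ?thesis by (simp add: powr_mult)
        qed
        ultimately show ?thesis unfolding W_def using L by (intro mult_right_mono) auto
      qed
      have S_eq: "S n = 2 * (1 + \<eta>)\<^sup>2 * r + K * L"
        unfolding S_def K_def sqrt_eq L_def[symmetric] by (simp add: algebra_simps)
      have KL: "K * L + B \<le> (K + B) * L" using L B by (simp add: algebra_simps mult_le_cancel_left1)
      have "2 * (1 + \<eta>)\<^sup>2 * r \<le> (2 + e) * r" using sq r by (rule mult_right_mono)
      then have 1: "S n \<le> (2 + e) * r + W" using S_eq KL W B by linarith
      have "sqrt ((2 * (2 + e) / e)\<^sup>2) \<le> sqrt L" using elim(2) unfolding L_def by (intro real_sqrt_le_mono)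
      then have "2 * (2 + e) / e \<le> sqrt L" using e by simp
      then have "2 + e \<le> e / 2 * sqrt L" using e by (simp add: field_simps)
      then have "2 * (1 + \<eta>)\<^sup>2 * r \<le> e / 2 * sqrt L * r" using sq r by (intro mult_right_mono) auto
      moreover have "(2 + \<eta>) * (r * sqrt L) \<le> (2 + e / 2) * (r * sqrt L)"
        using \<eta> r L by (intro mult_right_mono) auto
      moreover have "e / 2 * sqrt L * r + (2 + e / 2) * (r * sqrt L) = (2 + e) * (r * sqrt L)"
        by (simp add: algebra_simps)
      ultimately have "R n \<le> (2 + e) * (r * sqrt L) + W"
        unfolding R_def L_def[symmetric] sqrt_eq2 using S_eq KL W by linarith
      with 1 show ?case unfolding L_def[symmetric] sqrt_eq3 W_def[symmetric] by (simp add: r_def mult.assoc)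
    qed
  qed
  show ?thesis
    using io
  proof eventually_elim
    case (elim \<omega>)
    show ?case
      using elim limits eventually_ge_at_top[of N]
    proof eventually_elim
      case (elim n)
      then have "spectrum_within M n (X n) (m n) \<omega> (R n) (S n)" using bad[of n] by (auto simp: bad_def)
      then show ?case by (rule spectrum_within_mono) (use elim in auto)
    qed
  qed
qed

subsection \<open>The almost sure bounds\<close>

text \<open>The entries are bounded only almost surely; truncation changes them on a null set and
  yields the pointwise range that \<open>iid_matrix\<close> demands.\<close>

definition clip :: "real \<Rightarrow> real \<Rightarrow> real" where
  "clip B t = max 0 (min B t)"

lemma borel_measurable_clip [measurable]: "clip B \<in> borel_measurable borel"
  unfolding clip_def by measurable

lemma clip_range: "B \<ge> 0 \<Longrightarrow> 0 \<le> clip B t \<and> clip B t \<le> B"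
  by (simp add: clip_def)

lemma clip_eq: "0 \<le> t \<Longrightarrow> t \<le> B \<Longrightarrow> clip B t = t"
  by (simp add: clip_def)

lemma mean_laplacian_cong_AE:
  assumes meas: "\<And>u x. u < n \<Longrightarrow> x < n \<Longrightarrow> X u x \<in> borel_measurable M"
    "\<And>u x. u < n \<Longrightarrow> x < n \<Longrightarrow> Y u x \<in> borel_measurable M"
    and ae: "AE \<omega> in M. \<forall>u<n. \<forall>x<n. X u x \<omega> = Y u x \<omega>"
  shows "mean_matrix M n (random_laplacian n X) = mean_matrix M n (random_laplacian n Y)"
proof (rule eq_matI)
  have lap_meas: "(\<lambda>\<omega>. random_laplacian n Z \<omega> $$ (i, j)) \<in> borel_measurable M"
    if Z: "\<And>u x. u < n \<Longrightarrow> x < n \<Longrightarrow> Z u x \<in> borel_measurable M" and "i < n" "j < n" for Z i j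
  proof -
    have "(\<lambda>\<omega>. \<Sum>k<n. Z i k \<omega>) \<in> borel_measurable M" using that by (intro borel_measurable_sum) auto
    then show ?thesis using that by (cases "i = j") (simp_all add: random_laplacian_index)
  qed
  fix i j assume "i < dim_row (mean_matrix M n (random_laplacian n Y))" "j < dim_col (mean_matrix M n (random_laplacian n Y))"
  then have ij: "i < n" "j < n" by (simp_all add: mean_matrix_def)
  have "(\<integral>\<omega>. random_laplacian n X \<omega> $$ (i, j) \<partial>M) = (\<integral>\<omega>. random_laplacian n Y \<omega> $$ (i, j) \<partial>M)"
  proof (rule integral_cong_AE)
    show "(\<lambda>\<omega>. random_laplacian n X \<omega> $$ (i, j)) \<in> borel_measurable M"
      "(\<lambda>\<omega>. random_laplacian n Y \<omega> $$ (i, j)) \<in> borel_measurable M"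
      using lap_meas meas ij by blast+
    show "AE \<omega> in M. random_laplacian n X \<omega> $$ (i, j) = random_laplacian n Y \<omega> $$ (i, j)"
      using ae
    proof eventually_elim
      case (elim \<omega>)
      then have "random_laplacian n X \<omega> = random_laplacian n Y \<omega>" by (intro random_laplacian_cong) auto
      then show ?case by simp
    qed
  qed
  then show "mean_matrix M n (random_laplacian n X) $$ (i, j) = mean_matrix M n (random_laplacian n Y) $$ (i, j)"
    using ij by (simp add: mean_matrix_def)
qed (simp_all add: mean_matrix_def)

theorem theorem1p6:
  fixes M :: "'a measure"
    and X :: "nat \<Rightarrow> nat \<Rightarrow> nat \<Rightarrow> 'a \<Rightarrow> real"
    and x y bern :: "nat \<Rightarrow> 'a \<Rightarrow> real"
    and \<nu> :: "real measure"
    and p m \<sigma> :: "nat \<Rightarrow> real"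
    and B :: real
  assumes prob: "prob_space M"
    and x_eq: "\<And>n \<omega>. n \<ge> 1 \<Longrightarrow> \<omega> \<in> space M \<Longrightarrow> x n \<omega> = bern n \<omega> * y n \<omega>"
    and y_law: "\<And>n. n \<ge> 1 \<Longrightarrow> distr M borel (y n) = \<nu>"
    and y_nonneg_bounded: "\<And>n. n \<ge> 1 \<Longrightarrow> AE \<omega> in M. 0 \<le> y n \<omega> \<and> y n \<omega> \<le> B"
    and p_prob: "\<And>n. n \<ge> 1 \<Longrightarrow> 0 \<le> p n \<and> p n \<le> 1"
    and bern_law: "\<And>n. n \<ge> 1 \<Longrightarrow>
      distr M borel (bern n) = distr (measure_pmf (bernoulli_pmf (p n))) borel of_bool"
    and bern_indep_y: "\<And>n. n \<ge> 1 \<Longrightarrow>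
      prob_space.indep_var M borel (bern n) borel (y n)"
    and p_to_0: "p \<longlonglongrightarrow> 0"
    and np_to_infinity: "filterlim (\<lambda>n. real n * p n) at_top sequentially"
    and X_indep: "\<And>n. n \<ge> 1 \<Longrightarrow>
      prob_space.indep_vars M (\<lambda>_. borel) (\<lambda>(i, j). X n i j) ({..<n} \<times> {..<n})"
    and X_law: "\<And>n i j. n \<ge> 1 \<Longrightarrow> i < n \<Longrightarrow> j < n \<Longrightarrow>
      distr M borel (X n i j) = distr M borel (x n)"
    and m_mean: "\<And>n. n \<ge> 1 \<Longrightarrow> m n = prob_space.expectation M (x n)"
    and \<sigma>_pos: "\<And>n. n \<ge> 1 \<Longrightarrow> \<sigma> n > 0"
    and \<sigma>_variance: "\<And>n. n \<ge> 1 \<Longrightarrow> (\<sigma> n)\<^sup>2 = prob_space.variance M (x n)"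
    and growth: "filterlim (\<lambda>n. real n * (\<sigma> n)\<^sup>2 / ln (real n)) at_top sequentially"
  shows
    "(AE \<omega> in M. \<exists>(\<epsilon> :: nat \<Rightarrow> real) (C :: real) (n\<^sub>0 :: nat). \<epsilon> \<longlonglongrightarrow> 0 \<and>
       (\<forall>n\<ge>n\<^sub>0. \<forall>z. complex_eigenvalue (centered_laplacian M n (X n) \<omega>) z \<longrightarrow>
          \<bar>Re z\<bar> \<le> (2 + \<epsilon> n) * \<sigma> n * sqrt (real n * ln (real n))
                     + C * (\<sigma> n powr (1/2) * real n powr (1/4) * ln (real n)) \<and>
          \<bar>Im z\<bar> \<le> (2 + \<epsilon> n) * \<sigma> n * sqrt (real n)
                     + C * (\<sigma> n powr (1/2) * real n powr (1/4) * ln (real n)))) \<and>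
     (AE \<omega> in M. \<exists>(\<epsilon> :: nat \<Rightarrow> real) (C :: real) (n\<^sub>0 :: nat). \<epsilon> \<longlonglongrightarrow> 0 \<and>
       (\<forall>n\<ge>n\<^sub>0. \<forall>z. complex_eigenvalue (random_laplacian n (X n) \<omega>) z \<and> z \<noteq> 0 \<longrightarrow>
          \<bar>Re z + m n * real n\<bar> \<le> (2 + \<epsilon> n) * \<sigma> n * sqrt (real n * ln (real n))
                     + C * (\<sigma> n powr (1/2) * real n powr (1/4) * ln (real n)) \<and>
          \<bar>Im z\<bar> \<le> (2 + \<epsilon> n) * \<sigma> n * sqrt (real n)
                     + C * (\<sigma> n powr (1/2) * real n powr (1/4) * ln (real n))))"
proof -
  interpret prob_space M by (rule prob)
  define B' where "B' = max 1 B"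
  have B': "B' > 0" "B \<le> B'" by (auto simp: B'_def)
  define Y where "Y n i j \<omega> = clip B' (X n i j \<omega>)" for n i j \<omega>

  have x_meas: "x n \<in> borel_measurable M" if n: "n \<ge> 1" for n
  proof -
    have "bern n \<in> borel_measurable M" "y n \<in> borel_measurable M"
      using indep_var_rv1[OF bern_indep_y[OF n]] indep_var_rv2[OF bern_indep_y[OF n]] by auto
    then have "(\<lambda>\<omega>. bern n \<omega> * y n \<omega>) \<in> borel_measurable M" by measurable
    then show ?thesis using x_eq[OF n] by (subst measurable_cong) auto
  qed
  have X_meas: "X n i j \<in> borel_measurable M" if "n \<ge> 1" "i < n" "j < n" for n i j
    using X_indep[OF that(1)] that(2,3) unfolding indep_vars_def by auto
  have x_range: "AE \<omega> in M. 0 \<le> x n \<omega> \<and> x n \<omega> \<le> B'" if n: "n \<ge> 1" for n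
  proof -
    have "AE t in distr (measure_pmf (bernoulli_pmf (p n))) borel of_bool. t \<in> {0, 1::real}"
      by (subst AE_distr_iff) auto
    then have "AE t in distr M borel (bern n). t \<in> {0, 1}" unfolding bern_law[OF n] .
    then have "AE \<omega> in M. bern n \<omega> \<in> {0, 1}"
      using indep_var_rv1[OF bern_indep_y[OF n]] by (subst (asm) AE_distr_iff) auto
    then show ?thesis using y_nonneg_bounded[OF n] AE_space
    proof eventually_elim
      case (elim \<omega>)
      then show ?case using x_eq[OF n] B' by auto
    qed
  qed
  have X_range: "AE \<omega> in M. 0 \<le> X n i j \<omega> \<and> X n i j \<omega> \<le> B'" if nij: "n \<ge> 1" "i < n" "j < n" for n i j
  proof -
    have "AE t in distr M borel (x n). 0 \<le> t \<and> t \<le> B'"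
      using x_range[OF nij(1)] x_meas[OF nij(1)] by (subst AE_distr_iff) auto
    then have "AE t in distr M borel (X n i j). 0 \<le> t \<and> t \<le> B'" unfolding X_law[OF nij] .
    then show ?thesis using X_meas[OF nij] by (subst (asm) AE_distr_iff) auto
  qed
  have XY: "AE \<omega> in M. X n i j \<omega> = Y n i j \<omega>" if "n \<ge> 1" "i < n" "j < n" for n i j
    using X_range[OF that] by eventually_elim (simp add: Y_def clip_eq)
  have Y_meas: "Y n i j \<in> borel_measurable M" if "n \<ge> 1" "i < n" "j < n" for n i j
    unfolding Y_def using X_meas[OF that] by measurable
  have transfer: "expectation (\<lambda>\<omega>. f (Y n i j \<omega>)) = expectation (\<lambda>\<omega>. f (x n \<omega>))"
    if nij: "n \<ge> 1" "i < n" "j < n" and f [measurable]: "f \<in> borel_measurable borel" for n i j and f :: "real \<Rightarrow> real"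
  proof -
    note [measurable] = X_meas[OF nij] x_meas[OF nij(1)] Y_meas[OF nij]
    have "expectation (\<lambda>\<omega>. f (Y n i j \<omega>)) = expectation (\<lambda>\<omega>. f (X n i j \<omega>))"
      using XY[OF nij] by (intro integral_cong_AE) auto
    also have "\<dots> = integral\<^sup>L (distr M borel (X n i j)) f" by (subst integral_distr) auto
    also have "\<dots> = expectation (\<lambda>\<omega>. f (x n \<omega>))" unfolding X_law[OF nij] by (subst integral_distr) auto
    finally show ?thesis .
  qed

  have iid: "iid_matrix M n (Y n) B' (m n) ((\<sigma> n)\<^sup>2)" if n: "n \<ge> 1" for n
  proof
    have "indep_vars (\<lambda>_. borel) (\<lambda>q \<omega>. clip B' ((case q of (i, j) \<Rightarrow> X n i j) \<omega>)) ({..<n} \<times> {..<n})"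
      by (rule indep_vars_compose2[OF X_indep[OF n], of "\<lambda>_. clip B'"]) measurable
    moreover have "(\<lambda>q \<omega>. clip B' ((case q of (i, j) \<Rightarrow> X n i j) \<omega>)) = (\<lambda>(i, j). Y n i j)"
      by (auto simp: Y_def fun_eq_iff)
    ultimately show "indep_vars (\<lambda>_. borel) (\<lambda>(i, j). Y n i j) ({..<n} \<times> {..<n})" by simp
    show "0 < B'" by (rule B')
    fix i j assume ij: "i < n" "j < n"
    show mean: "expectation (Y n i j) = m n"
      using transfer[OF n ij, of "\<lambda>t. t"] m_mean[OF n] by simp
    show "variance (Y n i j) = (\<sigma> n)\<^sup>2"
      using transfer[OF n ij, of "\<lambda>t. (t - m n)\<^sup>2"] \<sigma>_variance[OF n] mean m_mean[OF n] by simp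
  next
    fix i j \<omega> assume "i < n" "j < n" "\<omega> \<in> space M"
    show "0 \<le> Y n i j \<omega> \<and> Y n i j \<omega> \<le> B'" unfolding Y_def using B' by (intro clip_range) simp
  qed

  define R where "R e n = (2 + e) * \<sigma> n * sqrt (real n * ln (real n)) + \<sigma> n powr (1/2) * real n powr (1/4) * ln (real n)" for e n
  define I where "I e n = (2 + e) * \<sigma> n * sqrt (real n) + \<sigma> n powr (1/2) * real n powr (1/4) * ln (real n)" for e n
  have ev: "AE \<omega> in M. \<forall>k. eventually (\<lambda>n. spectrum_within M n (Y n) (m n) \<omega> (R (1 / real (Suc k)) n) (I (1 / real (Suc k)) n)) sequentially"
    unfolding AE_all_countable
  proof
    fix k
    show "AE \<omega> in M. eventually (\<lambda>n. spectrum_within M n (Y n) (m n) \<omega> (R (1 / real (Suc k)) n) (I (1 / real (Suc k)) n)) sequentially"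
      unfolding R_def I_def by (rule AE_eventually_spectrum_within[OF iid \<sigma>_pos growth]) auto
  qed
  \<comment> \<open>Countably many null sets, so a single almost sure event serves all sizes and all
    entries.\<close>
  have eq: "AE \<omega> in M. \<forall>n\<in>{1..}. \<forall>i\<in>{..<n}. \<forall>j\<in>{..<n}. X n i j \<omega> = Y n i j \<omega>"
    by (intro AE_ball_countable' XY) auto
  have mean_eq: "mean_matrix M n (random_laplacian n (X n)) = mean_matrix M n (random_laplacian n (Y n))" if n: "n \<ge> 1" for n
    by (rule mean_laplacian_cong_AE) (use n X_meas Y_meas eq in \<open>auto elim!: eventually_mono\<close>)
  have main: "AE \<omega> in M. \<exists>\<epsilon> n\<^sub>0. \<epsilon> \<longlonglongrightarrow> 0 \<and> (\<forall>n\<ge>n\<^sub>0. spectrum_within M n (X n) (m n) \<omega> (R (\<epsilon> n) n) (I (\<epsilon> n) n))"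
    using ev eq
  proof eventually_elim
    case (elim \<omega>)
    obtain \<epsilon> where \<epsilon>: "\<epsilon> \<longlonglongrightarrow> 0"
      "eventually (\<lambda>n. spectrum_within M n (Y n) (m n) \<omega> (R (\<epsilon> n) n) (I (\<epsilon> n) n)) sequentially"
      by (rule eventually_choose_null_sequence[of "\<lambda>e n. spectrum_within M n (Y n) (m n) \<omega> (R e n) (I e n)"])
        (use elim(1) in blast)+
    obtain N where N: "\<And>n. n \<ge> N \<Longrightarrow> spectrum_within M n (Y n) (m n) \<omega> (R (\<epsilon> n) n) (I (\<epsilon> n) n)"
      using \<epsilon>(2) unfolding eventually_sequentially by blast
    have "spectrum_within M n (X n) (m n) \<omega> (R (\<epsilon> n) n) (I (\<epsilon> n) n)" if "n \<ge> max 1 N" for n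
    proof -
      have n: "n \<ge> 1" "n \<ge> N" using that by auto
      have L: "random_laplacian n (X n) \<omega> = random_laplacian n (Y n) \<omega>"
        by (rule random_laplacian_cong) (use elim(2) n in auto)
      then have "centered_laplacian M n (X n) \<omega> = centered_laplacian M n (Y n) \<omega>"
        unfolding centered_laplacian_def mean_eq[OF n(1)] by simp
      then show ?thesis using N[OF n(2)] L unfolding spectrum_within_def by simp
    qed
    with \<epsilon>(1) show ?case by blast
  qed
  show ?thesis
  proof
    show "AE \<omega> in M. \<exists>(\<epsilon> :: nat \<Rightarrow> real) (C :: real) (n\<^sub>0 :: nat). \<epsilon> \<longlonglongrightarrow> 0 \<and>
       (\<forall>n\<ge>n\<^sub>0. \<forall>z. complex_eigenvalue (centered_laplacian M n (X n) \<omega>) z \<longrightarrow>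
          \<bar>Re z\<bar> \<le> (2 + \<epsilon> n) * \<sigma> n * sqrt (real n * ln (real n))
                     + C * (\<sigma> n powr (1/2) * real n powr (1/4) * ln (real n)) \<and>
          \<bar>Im z\<bar> \<le> (2 + \<epsilon> n) * \<sigma> n * sqrt (real n)
                     + C * (\<sigma> n powr (1/2) * real n powr (1/4) * ln (real n)))"
      using main
    proof eventually_elim
      case (elim \<omega>)
      then obtain \<epsilon> n\<^sub>0 where \<epsilon>: "\<epsilon> \<longlonglongrightarrow> 0"
        and sp: "\<And>n. n \<ge> n\<^sub>0 \<Longrightarrow> spectrum_within M n (X n) (m n) \<omega> (R (\<epsilon> n) n) (I (\<epsilon> n) n)" by blast
      \<comment> \<open>C = 1 suffices, the remaining constants having been absorbed for large n;
        only \<epsilon> and the threshold depend on \<omega>.\<close>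
      show ?case
        by (rule exI[of _ \<epsilon>], rule exI[of _ 1], rule exI[of _ n\<^sub>0])
          (use \<epsilon> sp in \<open>simp add: spectrum_within_def R_def I_def\<close>)
    qed
    show "AE \<omega> in M. \<exists>(\<epsilon> :: nat \<Rightarrow> real) (C :: real) (n\<^sub>0 :: nat). \<epsilon> \<longlonglongrightarrow> 0 \<and>
       (\<forall>n\<ge>n\<^sub>0. \<forall>z. complex_eigenvalue (random_laplacian n (X n) \<omega>) z \<and> z \<noteq> 0 \<longrightarrow>
          \<bar>Re z + m n * real n\<bar> \<le> (2 + \<epsilon> n) * \<sigma> n * sqrt (real n * ln (real n))
                     + C * (\<sigma> n powr (1/2) * real n powr (1/4) * ln (real n)) \<and>
          \<bar>Im z\<bar> \<le> (2 + \<epsilon> n) * \<sigma> n * sqrt (real n)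
                     + C * (\<sigma> n powr (1/2) * real n powr (1/4) * ln (real n)))"
      using main
    proof eventually_elim
      case (elim \<omega>)
      then obtain \<epsilon> n\<^sub>0 where \<epsilon>: "\<epsilon> \<longlonglongrightarrow> 0"
        and sp: "\<And>n. n \<ge> n\<^sub>0 \<Longrightarrow> spectrum_within M n (X n) (m n) \<omega> (R (\<epsilon> n) n) (I (\<epsilon> n) n)" by blast
      show ?case
        by (rule exI[of _ \<epsilon>], rule exI[of _ 1], rule exI[of _ n\<^sub>0])
          (use \<epsilon> sp in \<open>simp add: spectrum_within_def R_def I_def\<close>)
    qed
  qed
qed

end
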